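(* Let $q$ be a prime power and let $V$ be a $6$-dimensional vector space over $\mathbb{F}_q$ provided with a nondegenerate symplectic form. Let $\Gamma$ be the graph whose vertices are the totally isotropic planes (totally isotropic $3$-dimensional subspaces of $V$), two being adjacent when they are disjoint (intersect only in the zero vector). Then $\Gamma$ is strongly regular, with parameters $$v = (q^3+1)(q^2+1)(q+1),\quad k = q^6,\quad \lambda = q^2(q^3-1)(q-1),\quad \mu = (q-1)q^5.$$ If $q$ is even, then $\Gamma$ has rank $3$; otherwise $\Gamma$ has rank $4$. The local graph $\Delta$ of $\Gamma$ (at any vertex) is strongly regular with parameters $$v' = k,\quad k' = \lambda,\quad \lambda' = \mu' - q^2(q-2),\quad \mu' = q^2(q-1)(q^3-q^2-1).$$ Moreover, $\Gamma$ satisfies the $4$-vertex condition.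
   Context: A graph of order $v$ is strongly regular with parameters $(v,k,\lambda,\mu)$ if it is neither complete nor edgeless, each vertex has degree $k$, any two adjacent vertices have exactly $\lambda$ common neighbors, and any two distinct non-adjacent vertices have exactly $\mu$ common neighbors. A graph with vertex set $W$ has rank $r$ if its automorphism group is transitive on $W$ and has exactly $r$ orbits on $W \times W$. The local graph of $\Gamma$ at a vertex $x$ is the subgraph induced on the set of neighbors of $x$. A graph $\Gamma$ satisfies the $t$-vertex condition if, for all triples $(T,x_0,y_0)$ consisting of a $t$-vertex graph $T$ together with two distinct distinguished vertices $x_0,y_0$ of $T$, and all pairs of distinct vertices $x,y$ of $\Gamma$, the number of isomorphic copies of $T$ in $\Gamma$ (as induced subgraphs), where the isomorphism maps $x_0$ to $x$ and $y_0$ to $y$, does not depend on the choice of the pair $x,y$ but only on whether $x,y$ are adjacent or nonadjacent. *)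

theory Defs
  imports
    Complex_Main
    "HOL-Library.Cardinality"
    "HOL-Number_Theory.Prime_Powers"
    "HOL-Algebra.Group_Action"
begin

text \<open>
  A graph is given by a vertex set \<open>W\<close> and an adjacency predicate \<open>adj\<close>, of which only the
  values on \<open>W\<close> matter. Hence the subgraph induced on \<open>S \<subseteq> W\<close> is the pair \<open>S\<close>, \<open>adj\<close>, and the
  local graph at \<open>x\<close> is the pair \<open>neighbors W adj x\<close>, \<open>adj\<close>.
\<close>

definition simple_graph :: "'v set \<Rightarrow> ('v \<Rightarrow> 'v \<Rightarrow> bool) \<Rightarrow> bool" where
  "simple_graph W adj \<longleftrightarrow>
     finite W \<and>
     (\<forall>x\<in>W. \<not> adj x x) \<and>
     (\<forall>x\<in>W. \<forall>y\<in>W. adj x y \<longrightarrow> adj y x)"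

definition neighbors :: "'v set \<Rightarrow> ('v \<Rightarrow> 'v \<Rightarrow> bool) \<Rightarrow> 'v \<Rightarrow> 'v set" where
  "neighbors W adj x = {y \<in> W. adj x y}"

definition strongly_regular ::
  "'v set \<Rightarrow> ('v \<Rightarrow> 'v \<Rightarrow> bool) \<Rightarrow> nat \<Rightarrow> nat \<Rightarrow> nat \<Rightarrow> nat \<Rightarrow> bool" where
  "strongly_regular W adj v k l m \<longleftrightarrow>
     simple_graph W adj \<and>
     card W = v \<and>
     (\<exists>x\<in>W. \<exists>y\<in>W. x \<noteq> y \<and> \<not> adj x y) \<and>
     (\<exists>x\<in>W. \<exists>y\<in>W. adj x y) \<and>
     (\<forall>x\<in>W. card (neighbors W adj x) = k) \<and>
     (\<forall>x\<in>W. \<forall>y\<in>W. adj x y \<longrightarrow>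
        card (neighbors W adj x \<inter> neighbors W adj y) = l) \<and>
     (\<forall>x\<in>W. \<forall>y\<in>W. x \<noteq> y \<longrightarrow> \<not> adj x y \<longrightarrow>
        card (neighbors W adj x \<inter> neighbors W adj y) = m)"

definition graph_aut_group :: "'v set \<Rightarrow> ('v \<Rightarrow> 'v \<Rightarrow> bool) \<Rightarrow> ('v \<Rightarrow> 'v) monoid" where
  "graph_aut_group W adj = BijGroup W
     \<lparr>carrier := {f \<in> Bij W. \<forall>x\<in>W. \<forall>y\<in>W. adj (f x) (f y) \<longleftrightarrow> adj x y}\<rparr>"

definition has_rank :: "'v set \<Rightarrow> ('v \<Rightarrow> 'v \<Rightarrow> bool) \<Rightarrow> nat \<Rightarrow> bool" where
  "has_rank W adj r \<longleftrightarrow>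
     transitive_action (graph_aut_group W adj) W (\<lambda>f. f) \<and>
     card (orbits (graph_aut_group W adj) (W \<times> W) (\<lambda>f (x, y). (f x, f y))) = r"

text \<open>
  A copy of a graph \<open>T\<close> with distinguished vertices \<open>x0\<close>, \<open>y0\<close> at the pair \<open>x\<close>, \<open>y\<close> is an
  induced subgraph (identified with its vertex set \<open>S\<close>) admitting an isomorphism from \<open>T\<close> that
  takes \<open>x0\<close> to \<open>x\<close> and \<open>y0\<close> to \<open>y\<close>. Subgraphs are counted, not isomorphisms.
\<close>

definition copies ::
  "'t set \<Rightarrow> ('t \<Rightarrow> 't \<Rightarrow> bool) \<Rightarrow> 't \<Rightarrow> 't \<Rightarrow>
   'v set \<Rightarrow> ('v \<Rightarrow> 'v \<Rightarrow> bool) \<Rightarrow> 'v \<Rightarrow> 'v \<Rightarrow> 'v set set" where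
  "copies T adjT x0 y0 W adj x y =
     {S. S \<subseteq> W \<and>
         (\<exists>f. bij_betw f T S \<and> f x0 = x \<and> f y0 = y \<and>
              (\<forall>a\<in>T. \<forall>b\<in>T. adj (f a) (f b) \<longleftrightarrow> adjT a b))}"

text \<open>
  It is enough to let \<open>T\<close> range over graphs with vertices in \<open>nat\<close>, as every finite graph is
  isomorphic to one of these.
\<close>

definition vertex_condition :: "nat \<Rightarrow> 'v set \<Rightarrow> ('v \<Rightarrow> 'v \<Rightarrow> bool) \<Rightarrow> bool" where
  "vertex_condition t W adj \<longleftrightarrow>
     (\<forall>(T :: nat set) adjT x0 y0.
        simple_graph T adjT \<longrightarrow> card T = t \<longrightarrow> x0 \<in> T \<longrightarrow> y0 \<in> T \<longrightarrow> x0 \<noteq> y0 \<longrightarrow>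
        (\<forall>x\<in>W. \<forall>y\<in>W. \<forall>x'\<in>W. \<forall>y'\<in>W.
           x \<noteq> y \<longrightarrow> x' \<noteq> y' \<longrightarrow> (adj x y \<longleftrightarrow> adj x' y') \<longrightarrow>
           card (copies T adjT x0 y0 W adj x y) = card (copies T adjT x0 y0 W adj x' y')))"

definition symplectic_form ::
  "('a::field \<Rightarrow> 'b::ab_group_add \<Rightarrow> 'b) \<Rightarrow> ('b \<Rightarrow> 'b \<Rightarrow> 'a) \<Rightarrow> bool" where
  "symplectic_form scale B \<longleftrightarrow>
     (\<forall>x. Vector_Spaces.linear scale (*) (\<lambda>y. B x y)) \<and>
     (\<forall>y. Vector_Spaces.linear scale (*) (\<lambda>x. B x y)) \<and>
     (\<forall>x. B x x = 0)"

definition nondegenerate :: "('b::zero \<Rightarrow> 'b \<Rightarrow> 'a::zero) \<Rightarrow> bool" where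
  "nondegenerate B \<longleftrightarrow> (\<forall>x. (\<forall>y. B x y = 0) \<longrightarrow> x = 0)"

definition isotropic_planes ::
  "('a::field \<Rightarrow> 'b::ab_group_add \<Rightarrow> 'b) \<Rightarrow> ('b \<Rightarrow> 'b \<Rightarrow> 'a) \<Rightarrow> 'b set set" where
  "isotropic_planes scale B =
     {U. module.subspace scale U \<and> vector_space.dim scale U = 3 \<and>
         (\<forall>x\<in>U. \<forall>y\<in>U. B x y = 0)}"

definition disjoint_subspaces :: "'b::zero set \<Rightarrow> 'b set \<Rightarrow> bool" where
  "disjoint_subspaces U U' \<longleftrightarrow> U \<inter> U' = {0}"

end

theory Submission
  imports Defs "HOL-Analysis.Determinants"
begin

text \<open>
  Fix a totally isotropic plane. The planes disjoint from it are the graphs of the symmetric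
  \<open>3 \<times> 3\<close> matrices, and two such graphs are disjoint iff the difference of the matrices is
  nonsingular. A pair of planes can be brought into a standard position with respect to a symplectic
  frame, depending only on the dimension of the intersection, so all parameters of \<open>\<Gamma>\<close> and of its
  local graphs reduce to counting symmetric matrices by Schur complements. The value of \<open>\<lambda>'\<close> is
  obtained indirectly: it is constant because nonsingular symmetric matrices of order three are
  congruent up to a scalar, and then it follows from double counting.
  The 4-vertex condition holds because all local graphs are strongly regular with the same parameters.

  The group of isometries has four orbits on pairs. For odd \<open>q\<close> the planes meeting in a line and those
  meeting in a point are told apart by the hyperbolic lines of the complementary graph. For even \<open>q\<close>
  the spin embedding identifies \<open>\<Gamma>\<close> with the non-collinearity graph of a quadric in projective
  \<open>7\<close>-space, which has isometries that exchange the two kinds of pairs.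
\<close>

section \<open>Strongly regular graphs and the 4-vertex condition\<close>

text \<open>There are two kinds of non-adjacent pairs, yet only one \<mu>. Two coincidences cause
  this. The condition on the symmetric matrix of a common neighbour is that its leading entry,
  respectively its leading 2x2 minor, is nonzero, and each holds for exactly q^2 (q-1) of the q^3
  leading blocks. Moreover, a nonzero leading block extends to (q-1) q^2 nonsingular matrices
  whatever its rank, which yields a single \<mu>' as well. The planes are never enumerated: v is the
  solution of k (k-1-\<lambda>) = (v-1-k) \<mu>. Alternating matrices in characteristic two cannot
  be diagonalised. Normal forms therefore rest on hyperbolic planes and partial inverses, which
  keeps the classification of pairs uniform in q. For even q the determinant that decides
  disjointness is bilinear in eight minors, because the other terms cancel in pairs. The additional
  automorphism is then a mere permutation of these eight coordinates.\<close>

lemma neighbors_subset: "neighbors W adj x \<subseteq> W"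
  by (auto simp: neighbors_def)

lemma neighbors_within: "S \<subseteq> W \<Longrightarrow> neighbors S adj y = S \<inter> neighbors W adj y"
  by (auto simp: neighbors_def)

lemma simple_graph_subset: "simple_graph W adj \<Longrightarrow> S \<subseteq> W \<Longrightarrow> simple_graph S adj"
  unfolding simple_graph_def by (meson finite_subset subsetD)

text \<open>Both sides count the edges between the neighbours and the non-neighbours of
  \<open>x\<close>. The order is left as \<open>card W\<close>: the identity is solved for the order
  of \<Gamma>, and in a local graph for the number of common neighbours of adjacent
  vertices.\<close>

lemma strongly_regular_double_count:
  assumes "simple_graph W adj" and "x \<in> W"
    and deg: "\<forall>x\<in>W. card (neighbors W adj x) = k"
    and adj: "\<forall>x\<in>W. \<forall>y\<in>W. adj x y \<longrightarrow> card (neighbors W adj x \<inter> neighbors W adj y) = l"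
    and nonadj: "\<forall>x\<in>W. \<forall>y\<in>W. x \<noteq> y \<longrightarrow> \<not> adj x y \<longrightarrow>
        card (neighbors W adj x \<inter> neighbors W adj y) = m"
  shows "int k * (int k - 1 - int l) = (int (card W) - 1 - int k) * int m"
proof -
  have fin: "finite W" and irr: "\<And>x. x \<in> W \<Longrightarrow> \<not> adj x x"
    and sym: "\<And>x y. x \<in> W \<Longrightarrow> y \<in> W \<Longrightarrow> adj x y \<longleftrightarrow> adj y x"
    using assms(1) unfolding simple_graph_def by blast+
  let ?N = "neighbors W adj"
  define A where "A = ?N x"
  define C where "C = W - insert x A"
  have finA: "finite A" and finC: "finite C" and "A \<subseteq> W" and xA: "x \<notin> A"
    using fin irr assms(2) by (auto simp: A_def C_def neighbors_def)
  have cA: "card A = k" using deg assms(2) by (simp add: A_def)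
  have cC: "int (card C) = int (card W) - 1 - int k"
    using fin finA \<open>A \<subseteq> W\<close> assms(2) xA cA card_mono[OF fin, of "insert x A"]
    by (simp add: C_def card_Diff_subset)
  have 1: "int (card {b\<in>C. adj a b}) = int k - 1 - int l" if "a \<in> A" for a
  proof -
    have aW: "a \<in> W" and xa: "adj x a" using that by (auto simp: A_def neighbors_def)
    have eq: "?N a = insert x (?N x \<inter> ?N a) \<union> {b\<in>C. adj a b}"
      using aW xa sym assms(2) by (auto simp: A_def C_def neighbors_def)
    have "card (?N a) = card (insert x (?N x \<inter> ?N a)) + card {b\<in>C. adj a b}"
      by (subst eq, rule card_Un_disjoint) (use fin in \<open>auto simp: A_def C_def neighbors_def\<close>)
    moreover have "card (insert x (?N x \<inter> ?N a)) = Suc l"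
      using fin irr assms(2) adj aW xa by (subst card_insert_disjoint) (auto simp: neighbors_def)
    ultimately show ?thesis using deg aW by simp
  qed
  have 2: "card {a\<in>A. adj a b} = m" if "b \<in> C" for b
  proof -
    have "{a\<in>A. adj a b} = ?N x \<inter> ?N b"
      using that sym assms(2) by (auto simp: A_def C_def neighbors_def)
    then show ?thesis using nonadj that assms(2) by (auto simp: C_def A_def neighbors_def)
  qed
  have "(\<Sum>a\<in>A. card {b\<in>C. adj a b}) = (\<Sum>b\<in>C. m)"
    using 2 by (intro sum_multicount_gen finA finC) auto
  then have "int (\<Sum>a\<in>A. card {b\<in>C. adj a b}) = int (card C) * int m"
    by simp
  then have "(\<Sum>a\<in>A. int (card {b\<in>C. adj a b})) = int (card C) * int m"
    by (simp only: of_nat_sum)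
  then show ?thesis using 1 cA cC by simp
qed

section \<open>Counts relative to a pair of vertices\<close>

context
  fixes W :: "'v set" and adj :: "'v \<Rightarrow> 'v \<Rightarrow> bool" and v k l m l' m' :: nat
  assumes srg: "strongly_regular W adj v k l m"
    and local: "\<And>x. x \<in> W \<Longrightarrow> strongly_regular (neighbors W adj x) adj k l l' m'"
begin

lemma finite_W: "finite W"
  and adj_irrefl: "x \<in> W \<Longrightarrow> \<not> adj x x"
  and adj_sym: "x \<in> W \<Longrightarrow> y \<in> W \<Longrightarrow> adj x y \<longleftrightarrow> adj y x"
  using srg unfolding strongly_regular_def simple_graph_def by blast+

definition part :: "bool \<Rightarrow> bool \<Rightarrow> 'v \<Rightarrow> 'v \<Rightarrow> 'v set" where
  "part p p' x y = {c \<in> W - {x, y}. adj x c = p \<and> adj y c = p'}"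

text \<open>An edge inside a single part is counted twice. Only equality between different pairs of
  vertices matters, and ordered counting makes the table of these numbers symmetric.\<close>

definition part_edges where
  "part_edges p p' r r' x y = (\<Sum>c\<in>part p p' x y. card {d\<in>part r r' x y. adj c d})"

lemma finite_part [simp]: "finite (part p p' x y)"
  using finite_W by (simp add: part_def)

lemma common_card:
  assumes "x \<in> W" "y \<in> W" "x \<noteq> y"
  shows "card (neighbors W adj x \<inter> neighbors W adj y) = (if adj x y then l else m)"
  using srg assms unfolding strongly_regular_def by auto

lemma degree: "x \<in> W \<Longrightarrow> card (neighbors W adj x) = k"
  using srg unfolding strongly_regular_def by auto

lemma part_card:
  assumes x: "x \<in> W" and y: "y \<in> W" and "x \<noteq> y"
  defines "t \<equiv> adj x y"
  shows "card (part True True x y) = (if t then l else m)"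
    and "card (part True True x y) + card (part True False x y) + of_bool t = k"
    and "card (part True True x y) + card (part False True x y) + of_bool t = k"
    and "card (part True True x y) + card (part True False x y) +
         card (part False True x y) + card (part False False x y) + 2 = v"
proof -
  have "part True True x y = neighbors W adj x \<inter> neighbors W adj y"
    using x y adj_irrefl by (auto simp: part_def neighbors_def)
  then show "card (part True True x y) = (if t then l else m)"
    using common_card assms by simp
  have "neighbors W adj x - {y} = part True True x y \<union> part True False x y"
    using x y adj_irrefl by (auto simp: part_def neighbors_def)
  then have "card (neighbors W adj x - {y}) = card (part True True x y) + card (part True False x y)"
    by (simp add: card_Un_disjoint part_def disjoint_iff finite_W)
  moreover have "card (neighbors W adj x - {y}) + of_bool t = k"
    using degree[OF x] finite_W y card_Suc_Diff1[of "neighbors W adj x" y]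
    by (auto simp: t_def neighbors_def)
  ultimately show "card (part True True x y) + card (part True False x y) + of_bool t = k" by simp
  have "neighbors W adj y - {x} = part True True x y \<union> part False True x y"
    using x y adj_irrefl by (auto simp: part_def neighbors_def)
  then have "card (neighbors W adj y - {x}) = card (part True True x y) + card (part False True x y)"
    by (simp add: card_Un_disjoint part_def disjoint_iff finite_W)
  moreover have "card (neighbors W adj y - {x}) + of_bool t = k"
    using degree[OF y] finite_W x y card_Suc_Diff1[of "neighbors W adj y" x] adj_sym
    by (auto simp: t_def neighbors_def)
  ultimately show "card (part True True x y) + card (part False True x y) + of_bool t = k" by simp
  have "W - {x,y} = (part True True x y \<union> part True False x y) \<union>
      (part False True x y \<union> part False False x y)"
    by (auto simp: part_def)
  then have "card (W - {x,y}) = card (part True True x y \<union> part True False x y) +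
      card (part False True x y \<union> part False False x y)"
    by (simp only:) (rule card_Un_disjoint, simp_all, auto simp: part_def)
  moreover have "card (part p q x y \<union> part r s x y) = card (part p q x y) + card (part r s x y)"
    if "(p, q) \<noteq> (r, s)" for p q r s
    using that by (intro card_Un_disjoint) (auto simp: part_def finite_W)
  moreover have "card (W - {x,y}) + 2 = v"
  proof -
    have "card {x,y} \<le> card W" using x y finite_W by (intro card_mono) auto
    then show ?thesis using x y finite_W srg \<open>x \<noteq> y\<close> by (simp add: card_Diff_subset strongly_regular_def)
  qed
  ultimately show "card (part True True x y) + card (part True False x y) +
         card (part False True x y) + card (part False False x y) + 2 = v"
    by simp
qed

lemma part_edges_commute: "part_edges p p' r r' x y = part_edges r r' p p' x y"
proof -
  have "part_edges p p' r r' x y = (\<Sum>d\<in>part r r' x y. card {c\<in>part p p' x y. adj c d})"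
    unfolding part_edges_def by (rule sum_multicount_gen) auto
  also have "\<dots> = part_edges r r' p p' x y"
    unfolding part_edges_def
    by (intro sum.cong refl arg_cong[of _ _ card]) (use adj_sym in \<open>auto simp: part_def\<close>)
  finally show ?thesis .
qed

lemma card_part_Un:
  assumes "(p, q) \<noteq> (r, s)"
  shows "card {d\<in>part p q x y. adj c d} + card {d\<in>part r s x y. adj c d} =
    card {d\<in>part p q x y \<union> part r s x y. adj c d}"
  using assms by (subst card_Un_disjoint[symmetric])
    (auto simp: part_def finite_W intro!: arg_cong[of _ _ card])

text \<open>For \<open>c\<close> in a given part, its common neighbours with \<open>x\<close>, its
  common neighbours with \<open>y\<close> and its degree give three linear relations. The remaining
  datum comes from the local graph at \<open>c\<close>, of which \<open>x\<close> and
  \<open>y\<close> are vertices when \<open>c\<close> is adjacent to both: their common neighbours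
  there are the neighbours of \<open>c\<close> among the common neighbours of \<open>x\<close> and
  \<open>y\<close>.\<close>

lemma part_edges_sums:
  assumes x: "x \<in> W" and y: "y \<in> W" and "x \<noteq> y"
  defines "t \<equiv> adj x y" and "n \<equiv> \<lambda>p p'. card (part p p' x y)"
  shows "part_edges True True True True x y = n True True * (if t then l' else m')"
    and "part_edges p p' True True x y + part_edges p p' True False x y =
         n p p' * ((if p then l else m) - of_bool (t \<and> p'))"
    and "part_edges p p' True True x y + part_edges p p' False True x y =
         n p p' * ((if p' then l else m) - of_bool (t \<and> p))"
    and "part_edges p p' True True x y + part_edges p p' True False x y +
         part_edges p p' False True x y + part_edges p p' False False x y =
         n p p' * (k - of_bool p - of_bool p')"
proof -
  have c: "c \<in> W" "c \<noteq> x" "c \<noteq> y" "adj x c = p" "adj y c = p'" "adj c x = p" "adj c y = p'"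
    if "c \<in> part p p' x y" for c p p'
    using that adj_sym x y by (auto simp: part_def)
  have "card {d\<in>part True True x y. adj c d} = (if t then l' else m')"
    if "c \<in> part True True x y" for c
  proof -
    note c = c[OF that]
    have "strongly_regular (neighbors W adj c) adj k l l' m'" using local c by simp
    moreover have "x \<in> neighbors W adj c" "y \<in> neighbors W adj c" using c x y
      by (auto simp: neighbors_def)
    ultimately have "card (neighbors (neighbors W adj c) adj x \<inter> neighbors (neighbors W adj c) adj y)
       = (if t then l' else m')"
      using \<open>x \<noteq> y\<close> by (auto simp: strongly_regular_def t_def)
    moreover have "neighbors (neighbors W adj c) adj x \<inter> neighbors (neighbors W adj c) adj y =
      {d\<in>part True True x y. adj c d}"
      using x y adj_irrefl by (auto simp: part_def neighbors_def)
    ultimately show ?thesis by simp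
  qed
  then show "part_edges True True True True x y = n True True * (if t then l' else m')"
    by (simp add: part_edges_def n_def)
  have "card {d\<in>part True True x y. adj c d} + card {d\<in>part True False x y. adj c d} =
     (if p then l else m) - of_bool (t \<and> p')" if "c \<in> part p p' x y" for c
  proof -
    note c = c[OF that]
    have "{d\<in>part True True x y \<union> part True False x y. adj c d} =
      (neighbors W adj x \<inter> neighbors W adj c) - {y}"
      using x y adj_irrefl c by (auto simp: part_def neighbors_def)
    \<comment> \<open>\<open>y\<close> belongs to no part, so it has to be subtracted whenever it is
      a common neighbour of \<open>x\<close> and \<open>c\<close>.\<close>
    moreover have "y \<in> neighbors W adj x \<inter> neighbors W adj c \<longleftrightarrow> t \<and> p'"
      using y c by (auto simp: neighbors_def t_def)
    ultimately show ?thesis using common_card[OF x c(1)] c finite_W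
      by (simp add: card_part_Un card_Diff_singleton_if)
  qed
  then show "part_edges p p' True True x y + part_edges p p' True False x y =
         n p p' * ((if p then l else m) - of_bool (t \<and> p'))"
    by (simp add: part_edges_def n_def flip: sum.distrib)
  have "card {d\<in>part True True x y. adj c d} + card {d\<in>part False True x y. adj c d} =
     (if p' then l else m) - of_bool (t \<and> p)" if "c \<in> part p p' x y" for c
  proof -
    note c = c[OF that]
    have "{d\<in>part True True x y \<union> part False True x y. adj c d} =
      (neighbors W adj y \<inter> neighbors W adj c) - {x}"
      using x y adj_irrefl c by (auto simp: part_def neighbors_def)
    moreover have "x \<in> neighbors W adj y \<inter> neighbors W adj c \<longleftrightarrow> t \<and> p"
      using x y c adj_sym by (auto simp: neighbors_def t_def)
    ultimately show ?thesis using common_card[OF y c(1)] c finite_W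
      by (simp add: card_part_Un card_Diff_singleton_if)
  qed
  then show "part_edges p p' True True x y + part_edges p p' False True x y =
         n p p' * ((if p' then l else m) - of_bool (t \<and> p))"
    by (simp add: part_edges_def n_def flip: sum.distrib)
  have "card {d\<in>part True True x y. adj c d} + card {d\<in>part True False x y. adj c d} +
     (card {d\<in>part False True x y. adj c d} + card {d\<in>part False False x y. adj c d}) =
     k - of_bool p - of_bool p'" if "c \<in> part p p' x y" for c
  proof -
    note c = c[OF that]
    have "card {d\<in>part True True x y \<union> part True False x y. adj c d} +
      card {d\<in>part False True x y \<union> part False False x y. adj c d} =
      card ({d\<in>part True True x y \<union> part True False x y. adj c d} \<union>
      {d\<in>part False True x y \<union> part False False x y. adj c d})"
      by (rule card_Un_disjoint[symmetric]) (auto simp: part_def finite_W)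
    also have "\<dots> = card (neighbors W adj c - {x} - {y})"
      using x y adj_irrefl c by (intro arg_cong[of _ _ card]) (auto simp: part_def neighbors_def)
    also have "\<dots> = k - of_bool p - of_bool p'"
      using degree[OF c(1)] x y c \<open>x \<noteq> y\<close> finite_W
      by (auto simp: neighbors_def card_Diff_singleton_if)
    finally show ?thesis by (simp add: card_part_Un)
  qed
  then show "part_edges p p' True True x y + part_edges p p' True False x y +
         part_edges p p' False True x y + part_edges p p' False False x y =
         n p p' * (k - of_bool p - of_bool p')"
    by (simp add: part_edges_def n_def add.assoc flip: sum.distrib)
qed

definition completions where
  "completions p p' r r' s x y =
     {(c, d) \<in> part p p' x y \<times> part r r' x y. c \<noteq> d \<and> adj c d = s}"

lemma finite_completions [simp]: "finite (completions p p' r r' s x y)"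
  by (rule finite_subset[of _ "part p p' x y \<times> part r r' x y"]) (auto simp: completions_def)

lemma card_completions_True: "card (completions p p' r r' True x y) = part_edges p p' r r' x y"
proof -
  have "completions p p' r r' True x y = (SIGMA c:part p p' x y. {d\<in>part r r' x y. adj c d})"
    using adj_irrefl by (auto simp: completions_def part_def)
  then show ?thesis by (simp add: part_edges_def)
qed

text \<open>The third summand accounts for the diagonal pairs \<open>(c, c)\<close>, which exist
  only when the two parts coincide.\<close>

lemma card_completions_sum:
  "card (completions p p' r r' True x y) + card (completions p p' r r' False x y) +
     (if (p, p') = (r, r') then card (part p p' x y) else 0) =
   card (part p p' x y) * card (part r r' x y)"
proof -
  have "part p p' x y \<times> part r r' x y =
    (completions p p' r r' True x y \<union> completions p p' r r' False x y) \<union>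
    (if (p, p') = (r, r') then (\<lambda>c. (c, c)) ` part p p' x y else {})"
    by (auto simp: completions_def part_def)
  then have "card (part p p' x y \<times> part r r' x y) =
    card ((completions p p' r r' True x y \<union> completions p p' r r' False x y) \<union>
    (if (p, p') = (r, r') then (\<lambda>c. (c, c)) ` part p p' x y else {}))"
    by simp
  also have "\<dots> = card (completions p p' r r' True x y \<union> completions p p' r r' False x y) +
    card (if (p, p') = (r, r') then (\<lambda>c. (c, c)) ` part p p' x y else {})"
    by (rule card_Un_disjoint, simp_all) (auto simp: completions_def)
  also have "card (completions p p' r r' True x y \<union> completions p p' r r' False x y) =
    card (completions p p' r r' True x y) + card (completions p p' r r' False x y)"
    by (rule card_Un_disjoint, simp_all) (auto simp: completions_def)
  finally show ?thesis
    by (auto simp: card_cartesian_product card_image inj_on_def)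
qed

context
  fixes x y x' y'
  assumes xy: "x \<in> W" "y \<in> W" "x' \<in> W" "y' \<in> W" "x \<noteq> y" "x' \<noteq> y'" "adj x y = adj x' y'"
begin

lemma part_card_eq: "card (part p p' x y) = card (part p p' x' y')"
proof -
  note a = part_card[OF xy(1,2,5)] and b = part_card[OF xy(3,4,6)]
  have tt: "card (part True True x y) = card (part True True x' y')"
    using a(1) b(1) xy(7) by simp
  have tf: "card (part True False x y) = card (part True False x' y')"
    using a(2) b(2) tt unfolding xy(7) by linarith
  have ft: "card (part False True x y) = card (part False True x' y')"
    using a(3) b(3) tt unfolding xy(7) by linarith
  have ff: "card (part False False x y) = card (part False False x' y')"
    using a(4) b(4) tt tf ft by linarith
  show ?thesis using tt tf ft ff by (cases p; cases p') simp_all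
qed

text \<open>The counts form a symmetric 4x4 table. Three relations leave one unknown in each row.
  The entry for the common neighbours alone settles its row, symmetry turns this row into a column,
  and the column settles all rows.\<close>

lemma part_edges_eq: "part_edges p p' r r' x y = part_edges p p' r r' x' y'"
proof -
  note s = part_edges_sums[OF xy(1,2,5)] and s' = part_edges_sums[OF xy(3,4,6)]
  note eqs = xy(7) part_card_eq
  let ?E = "\<lambda>p p' r r'. part_edges p p' r r' x y = part_edges p p' r r' x' y'"
  have 1: "?E True True True True" unfolding s(1) s'(1) eqs by (rule refl)
  have row: "?E p p' r r'" if "?E p p' True True" for p p' r r'
  proof -
    let ?e = "part_edges p p'"
    have "?e True True x y + ?e True False x y = ?e True True x' y' + ?e True False x' y'"
      unfolding s(2) s'(2) eqs by (rule refl)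
    then have tf: "?E p p' True False" using that by linarith
    have "?e True True x y + ?e False True x y = ?e True True x' y' + ?e False True x' y'"
      unfolding s(3) s'(3) eqs by (rule refl)
    then have ft: "?E p p' False True" using that by linarith
    have "?e True True x y + ?e True False x y + ?e False True x y + ?e False False x y =
        ?e True True x' y' + ?e True False x' y' + ?e False True x' y' + ?e False False x' y'"
      unfolding s(4) s'(4) eqs by (rule refl)
    then have ff: "?E p p' False False" using that tf ft by linarith
    show ?thesis using that tf ft ff by (cases r; cases r') simp_all
  qed
  have 2: "?E p p' True True" for p p'
    using row[OF 1, of p p'] unfolding part_edges_commute[of p p' True True] .
  show ?thesis by (rule row[OF 2])
qed

lemma card_completions_eq:
  "card (completions p p' r r' s x y) = card (completions p p' r r' s x' y')"
proof (cases s)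
  case True
  then show ?thesis using part_edges_eq card_completions_True by metis
next
  case False
  then show ?thesis
    using card_completions_sum[of p p' r r' x y] card_completions_sum[of p p' r r' x' y']
      unfolding part_edges_eq part_card_eq card_completions_True by simp
qed

end

text \<open>A copy is a vertex set, a completion an ordered pair. The set
  \<open>{x, y, c, d}\<close> arises from \<open>(c, d)\<close>, and also from \<open>(d, c)\<close>
  exactly when the two further vertices of \<open>T\<close> are related to the distinguished ones in
  the same way; hence the factor 2.\<close>

lemma card_copies:
  assumes T: "simple_graph T adjT" "card T = 4" "x0 \<in> T" "y0 \<in> T" "x0 \<noteq> y0"
  shows "\<exists>p p' r r' s. \<forall>x\<in>W. \<forall>y\<in>W. x \<noteq> y \<longrightarrow>
    (if adj x y = adjT x0 y0
     then (if (p, p') = (r, r') then 2 else 1) * card (copies T adjT x0 y0 W adj x y) =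
       card (completions p p' r r' s x y)
     else copies T adjT x0 y0 W adj x y = {})"
proof -
  have "finite T" using T(1) by (simp add: simple_graph_def)
  then have "card (T - {x0, y0}) = 2" using T by (simp add: card_Diff_subset)
  then obtain a b where ab: "T - {x0, y0} = {a, b}" "a \<noteq> b" by (meson card_2_iff)
  then have Teq: "T = {x0, y0, a, b}" and
    ne: "a \<noteq> x0" "a \<noteq> y0" "b \<noteq> x0" "b \<noteq> y0" "a \<noteq> b" using T by blast+
  have Tsym: "\<And>u w. u \<in> T \<Longrightarrow> w \<in> T \<Longrightarrow> adjT u w \<longleftrightarrow> adjT w u" and Tirr: "\<And>u. u \<in> T \<Longrightarrow> \<not> adjT u u"
    using T(1) by (auto simp: simple_graph_def)
  let ?p = "adjT x0 a" and ?p' = "adjT y0 a" and ?r = "adjT x0 b" and ?r' = "adjT y0 b"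
    and ?s = "adjT a b"
  have "if adj x y = adjT x0 y0
     then (if (?p, ?p') = (?r, ?r') then 2 else 1) * card (copies T adjT x0 y0 W adj x y) =
       card (completions ?p ?p' ?r ?r' ?s x y)
     else copies T adjT x0 y0 W adj x y = {}"
    if xy: "x \<in> W" "y \<in> W" "x \<noteq> y" for x y
  proof (cases "adj x y = adjT x0 y0")
    case False
    then show ?thesis using T(3,4) by (auto simp: copies_def)
  next
    case True
    let ?R = "completions ?p ?p' ?r ?r' ?s x y" and ?h = "\<lambda>(c, d). {x, y, c, d}"
    have R: "c \<in> W" "d \<in> W" "c \<noteq> x" "c \<noteq> y" "d \<noteq> x" "d \<noteq> y" "c \<noteq> d"
      if "(c, d) \<in> ?R" for c d
      using that by (auto simp: completions_def part_def)
    have "S \<in> copies T adjT x0 y0 W adj x y" if "S \<in> ?h ` ?R" for S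
    proof -
      obtain c d where cd: "(c, d) \<in> ?R" and S: "S = {x, y, c, d}"
        using \<open>S \<in> ?h ` ?R\<close> by auto
      \<comment> \<open>The default value \<open>d\<close> is the image of \<open>b\<close>, the one
        vertex of \<open>T\<close> that is not listed.\<close>
      define f where "f = (\<lambda>_. d)(x0 := x, y0 := y, a := c)"
      have f: "f x0 = x" "f y0 = y" "f a = c" "f b = d" using ne T(5) by (auto simp: f_def)
      have "bij_betw f T S"
        unfolding bij_betw_def inj_on_def Teq S using f R[OF cd] xy(3) by simp
      moreover have "\<forall>u\<in>T. \<forall>w\<in>T. adj (f u) (f w) \<longleftrightarrow> adjT u w"
      proof -
        have irr: "\<not> adj x x" "\<not> adj y y" "\<not> adj c c" "\<not> adj d d"
          using adj_irrefl xy R[OF cd] by blast+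
        have sym: "adj y x = adj x y" "adj c x = adj x c" "adj c y = adj y c" "adj d x = adj x d"
          "adj d y = adj y d" "adj d c = adj c d"
          using adj_sym xy R[OF cd] by blast+
        have symT: "adjT y0 x0 = adjT x0 y0" "adjT a x0 = ?p" "adjT a y0 = ?p'" "adjT b x0 = ?r"
          "adjT b y0 = ?r'" "adjT b a = ?s"
          using Tsym by (simp_all add: Teq)
        show ?thesis unfolding Teq using cd True Tirr[unfolded Teq]
          by (simp add: f irr sym symT completions_def part_def)
      qed
      ultimately show ?thesis unfolding copies_def using S R[OF cd] xy f by blast
    qed
    moreover have "S \<in> ?h ` ?R" if "S \<in> copies T adjT x0 y0 W adj x y" for S
    proof -
      obtain f where f: "bij_betw f T S" "f x0 = x" "f y0 = y"
        "\<forall>u\<in>T. \<forall>w\<in>T. adj (f u) (f w) \<longleftrightarrow> adjT u w" and "S \<subseteq> W"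
        using \<open>S \<in> copies T adjT x0 y0 W adj x y\<close> by (auto simp: copies_def)
      have S: "S = {x, y, f a, f b}" using f(1-3) unfolding bij_betw_def Teq by auto
      have "f a \<noteq> f b" "f a \<noteq> x" "f a \<noteq> y" "f b \<noteq> x" "f b \<noteq> y"
        using f(1-3) ne T(5) unfolding bij_betw_def Teq inj_on_def by auto
      moreover have "adj x (f a) = ?p" "adj y (f a) = ?p'" "adj x (f b) = ?r" "adj y (f b) = ?r'"
        "adj (f a) (f b) = ?s"
        using f(2-4) unfolding Teq by auto
      ultimately have "(f a, f b) \<in> ?R"
        using \<open>S \<subseteq> W\<close> S by (auto simp: completions_def part_def)
      then show ?thesis using S by force
    qed
    ultimately have img: "copies T adjT x0 y0 W adj x y = ?h ` ?R" by blast
    have fib: "{z\<in>?R. ?h z = ?h (c, d)} =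
        (if (?p, ?p') = (?r, ?r') then {(c, d), (d, c)} else {(c, d)})"
      if cd: "(c, d) \<in> ?R" for c d
    proof -
      have "(c', d') = (c, d) \<or> (c', d') = (d, c)"
        if "(c', d') \<in> ?R" "{x, y, c', d'} = {x, y, c, d}" for c' d'
        using R[OF cd] R[OF that(1)] xy(3) that(2) by (metis insert_iff singletonD)
      moreover have "(d, c) \<in> ?R \<longleftrightarrow> (?p, ?p') = (?r, ?r')"
        using cd R[OF cd] adj_sym by (auto simp: completions_def part_def)
      moreover have "{x, y, d, c} = {x, y, c, d}" by blast
      ultimately have mem: "(c', d') \<in> ?R \<and> {x, y, c', d'} = {x, y, c, d} \<longleftrightarrow>
          (c', d') = (c, d) \<or> ((?p, ?p') = (?r, ?r') \<and> (c', d') = (d, c))" for c' d'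
        using cd by blast
      show ?thesis
      proof (rule Set.set_eqI)
        fix z :: "'v \<times> 'v"
        obtain c' d' where z: "z = (c', d')" by (cases z)
        show "z \<in> {z\<in>?R. ?h z = ?h (c, d)} \<longleftrightarrow>
            z \<in> (if (?p, ?p') = (?r, ?r') then {(c, d), (d, c)} else {(c, d)})"
          unfolding z using mem[of c' d'] by (simp only: mem_Collect_eq prod.case split: if_split) blast
      qed
    qed
    have "card ?R = (\<Sum>S\<in>?h ` ?R. card {z\<in>?R. ?h z = S})"
      using sum.image_gen[of ?R "\<lambda>_. 1::nat" ?h] by simp
    also have "\<dots> = (\<Sum>S\<in>?h ` ?R. if (?p, ?p') = (?r, ?r') then 2 else 1)"
    proof (rule sum.cong[OF refl])
      fix S assume "S \<in> ?h ` ?R"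
      then obtain c d where cd: "(c, d) \<in> ?R" "S = ?h (c, d)" by auto
      show "card {z\<in>?R. ?h z = S} = (if (?p, ?p') = (?r, ?r') then 2 else 1)"
        unfolding cd(2) fib[OF cd(1)] using R(7)[OF cd(1)] by auto
    qed
    finally show ?thesis using True by (simp add: img)
  qed
  then show ?thesis by blast
qed

lemma vertex_condition_4: "vertex_condition 4 W adj"
  unfolding vertex_condition_def
proof (intro allI impI ballI)
  fix T :: "nat set" and adjT x0 y0 x y x' y'
  assume T: "simple_graph T adjT" "card T = 4" "x0 \<in> T" "y0 \<in> T" "x0 \<noteq> y0"
    and xy: "x \<in> W" "y \<in> W" "x' \<in> W" "y' \<in> W" "x \<noteq> y" "x' \<noteq> y'" "adj x y = adj x' y'"
  obtain p p' r r' s where *: "\<forall>x\<in>W. \<forall>y\<in>W. x \<noteq> y \<longrightarrow>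
    (if adj x y = adjT x0 y0
     then (if (p, p') = (r, r') then 2 else 1) * card (copies T adjT x0 y0 W adj x y) =
       card (completions p p' r r' s x y)
     else copies T adjT x0 y0 W adj x y = {})"
    using card_copies[OF T] by blast
  show "card (copies T adjT x0 y0 W adj x y) = card (copies T adjT x0 y0 W adj x' y')"
    using *[rule_format, OF xy(1,2,5)] *[rule_format, OF xy(3,4,6)] card_completions_eq[OF xy]
    unfolding xy(7) by (auto split: if_splits)
qed

end

section \<open>The rank of a graph\<close>

text \<open>Values outside \<open>W\<close> are left free, unlike in \<open>graph_aut_group\<close>,
  so that maps compose and invert without being restricted to \<open>W\<close>.\<close>

definition graph_aut :: "'v set \<Rightarrow> ('v \<Rightarrow> 'v \<Rightarrow> bool) \<Rightarrow> ('v \<Rightarrow> 'v) \<Rightarrow> bool" where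
  "graph_aut W adj f \<longleftrightarrow> bij_betw f W W \<and> (\<forall>x\<in>W. \<forall>y\<in>W. adj (f x) (f y) \<longleftrightarrow> adj x y)"

lemma graph_aut_in: "graph_aut W adj f \<Longrightarrow> x \<in> W \<Longrightarrow> f x \<in> W"
  by (auto simp: graph_aut_def bij_betw_def)

lemma carrier_graph_aut_group:
  "carrier (graph_aut_group W adj) = {f \<in> extensional W. graph_aut W adj f}"
  by (auto simp: graph_aut_group_def graph_aut_def Bij_def)

lemma graph_aut_restrict:
  "graph_aut W adj f \<Longrightarrow> restrict f W \<in> carrier (graph_aut_group W adj)"
  by (auto simp: carrier_graph_aut_group graph_aut_def cong: bij_betw_cong)

lemma graph_aut_comp: "graph_aut W adj f \<Longrightarrow> graph_aut W adj g \<Longrightarrow> graph_aut W adj (g \<circ> f)"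
  unfolding graph_aut_def by (metis bij_betw_apply bij_betw_trans comp_apply)

lemma graph_aut_inv:
  assumes "graph_aut W adj f"
  shows "graph_aut W adj (inv_into W f)"
proof -
  have f: "bij_betw f W W" and adj: "\<And>x y. x \<in> W \<Longrightarrow> y \<in> W \<Longrightarrow> adj (f x) (f y) \<longleftrightarrow> adj x y"
    using assms by (auto simp: graph_aut_def)
  have "inv_into W f x \<in> W" "f (inv_into W f x) = x" if "x \<in> W" for x
    using f that by (auto simp: bij_betw_def intro: inv_into_into f_inv_into_f)
  then show ?thesis
    unfolding graph_aut_def using bij_betw_inv_into[OF f] adj by metis
qed

lemma subgroup_graph_aut:
  "subgroup (carrier (graph_aut_group W adj)) (BijGroup W)"
proof (rule group.subgroupI[OF group_BijGroup])
  show "carrier (graph_aut_group W adj) \<subseteq> carrier (BijGroup W)"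
    by (auto simp: graph_aut_group_def BijGroup_def)
  have "restrict id W \<in> carrier (graph_aut_group W adj)"
    by (rule graph_aut_restrict) (simp add: graph_aut_def)
  then show "carrier (graph_aut_group W adj) \<noteq> {}" by blast
next
  fix f assume f: "f \<in> carrier (graph_aut_group W adj)"
  then have "f \<in> Bij W" by (simp add: graph_aut_group_def)
  then show "inv\<^bsub>BijGroup W\<^esub> f \<in> carrier (graph_aut_group W adj)"
    using f graph_aut_restrict[OF graph_aut_inv, of W adj f]
    by (simp add: inv_BijGroup carrier_graph_aut_group)
next
  fix f g assume fg: "f \<in> carrier (graph_aut_group W adj)" "g \<in> carrier (graph_aut_group W adj)"
  then have "f \<in> Bij W" "g \<in> Bij W" by (auto simp: graph_aut_group_def)
  then show "f \<otimes>\<^bsub>BijGroup W\<^esub> g \<in> carrier (graph_aut_group W adj)"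
    using fg graph_aut_restrict[OF graph_aut_comp, of W adj g f]
    by (simp add: BijGroup_def carrier_graph_aut_group compose_def comp_def restrict_def)
qed

lemma graph_aut_group_eq:
  "graph_aut_group W adj = BijGroup W\<lparr>carrier := carrier (graph_aut_group W adj)\<rparr>"
  by (simp add: graph_aut_group_def)

lemma group_action_graph_aut: "group_action (graph_aut_group W adj) W (\<lambda>f. f)"
proof -
  have "group (graph_aut_group W adj)"
    using group.subgroup_imp_group[OF group_BijGroup subgroup_graph_aut] graph_aut_group_eq by metis
  moreover have "(\<lambda>f. f) \<in> hom (graph_aut_group W adj) (BijGroup W)"
    by (auto simp: hom_def graph_aut_group_def BijGroup_def)
  ultimately show ?thesis
    by (simp add: group_action_def group_hom_def group_hom_axioms_def group_BijGroup)
qed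

text \<open>Orbits are counted by representatives: \<open>cover\<close> makes the map from indices
  to orbits surjective, \<open>distinct\<close> makes it injective.\<close>

lemma has_rankI:
  assumes trans: "\<And>x y. x \<in> W \<Longrightarrow> y \<in> W \<Longrightarrow> \<exists>f. graph_aut W adj f \<and> f x = y"
    and rep: "\<And>i. i < r \<Longrightarrow> rep i \<in> W \<times> W"
    and cover: "\<And>x y. x \<in> W \<Longrightarrow> y \<in> W \<Longrightarrow>
      \<exists>i<r. \<exists>f. graph_aut W adj f \<and> map_prod f f (rep i) = (x, y)"
    and distinct: "\<And>i j f. i < r \<Longrightarrow> j < r \<Longrightarrow> graph_aut W adj f \<Longrightarrow>
      map_prod f f (rep i) = rep j \<Longrightarrow> i = j"
  shows "has_rank W adj r"
proof -
  let ?G = "graph_aut_group W adj"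
  have "transitive_action ?G W (\<lambda>f. f)"
  proof (intro transitive_action.intro group_action_graph_aut transitive_action_axioms.intro)
    fix x y assume "x \<in> W" "y \<in> W"
    then obtain f where "graph_aut W adj f" "f x = y" using trans by blast
    then show "\<exists>g\<in>carrier ?G. g x = y"
      using \<open>x \<in> W\<close> by (intro bexI[OF _ graph_aut_restrict]) auto
  qed
  moreover have "card (orbits ?G (W \<times> W) (\<lambda>f (x, y). (f x, f y))) = r"
  proof -
    let ?O = "\<lambda>z. orbit ?G (\<lambda>f (x, y). (f x, f y)) z"
    have orb: "w \<in> ?O z \<longleftrightarrow> (\<exists>f. graph_aut W adj f \<and> map_prod f f z = w)"
      if z: "z \<in> W \<times> W" for w z
    proof
      show "\<exists>f. graph_aut W adj f \<and> map_prod f f z = w" if "w \<in> ?O z"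
        using that by (auto simp: orbit_def carrier_graph_aut_group map_prod_def)
      show "w \<in> ?O z" if "\<exists>f. graph_aut W adj f \<and> map_prod f f z = w"
      proof -
        obtain f where f: "graph_aut W adj f" "map_prod f f z = w"
          using \<open>\<exists>f. graph_aut W adj f \<and> map_prod f f z = w\<close> by blast
        show ?thesis unfolding orbit_def
          using f z graph_aut_restrict[OF f(1)]
          by (intro CollectI exI[of _ "restrict f W"]) auto
      qed
    qed
    have orb_eq: "?O z = ?O w" if z: "z \<in> W \<times> W" and w: "w \<in> ?O z" for z w
    proof -
      obtain f where f: "graph_aut W adj f" "map_prod f f z = w" using orb[OF z] w by blast
      have wW: "w \<in> W \<times> W" using f z by (auto simp: graph_aut_in)
      have inv_fw: "map_prod (inv_into W f) (inv_into W f) w = z"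
        using f z by (auto simp: graph_aut_def bij_betw_def)
      show ?thesis
      proof (rule Set.set_eqI)
        fix u
        have "u \<in> ?O w" if "graph_aut W adj h" "map_prod h h z = u" for h
          unfolding orb[OF wW] using that graph_aut_comp[OF graph_aut_inv[OF f(1)] that(1)] inv_fw
          by (intro exI[of _ "h \<circ> inv_into W f"]) (auto simp flip: map_prod.comp)
        moreover have "u \<in> ?O z" if "graph_aut W adj h" "map_prod h h w = u" for h
          unfolding orb[OF z] using that graph_aut_comp[OF f(1) that(1)] f(2)
          by (intro exI[of _ "h \<circ> f"]) (auto simp flip: map_prod.comp)
        ultimately show "u \<in> ?O z \<longleftrightarrow> u \<in> ?O w" using orb[OF z] orb[OF wW] by blast
      qed
    qed
    have refl: "z \<in> ?O z" if "z \<in> W \<times> W" for z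
      unfolding orb[OF that] by (rule exI[of _ id]) (auto simp: graph_aut_def map_prod.id)
    have "bij_betw (\<lambda>i. ?O (rep i)) {..<r} (orbits ?G (W \<times> W) (\<lambda>f (x, y). (f x, f y)))"
    proof (rule bij_betw_imageI)
      show "inj_on (\<lambda>i. ?O (rep i)) {..<r}"
      proof (rule inj_onI)
        fix i j assume ij: "i \<in> {..<r}" "j \<in> {..<r}" and eq: "?O (rep i) = ?O (rep j)"
        have "rep j \<in> ?O (rep i)" unfolding eq using refl rep ij by blast
        then obtain f where "graph_aut W adj f" "map_prod f f (rep i) = rep j"
          using orb[OF rep, of i] ij by blast
        then show "i = j" using distinct ij by blast
      qed
      show "(\<lambda>i. ?O (rep i)) ` {..<r} = orbits ?G (W \<times> W) (\<lambda>f (x, y). (f x, f y))"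
      proof (intro equalityI subsetI)
        fix S assume "S \<in> orbits ?G (W \<times> W) (\<lambda>f (x, y). (f x, f y))"
        then obtain x y where xy: "x \<in> W" "y \<in> W" and S: "S = ?O (x, y)"
          unfolding orbits_def by blast
        obtain i f where i: "i < r" and "graph_aut W adj f" "map_prod f f (rep i) = (x, y)"
          using cover[OF xy] by blast
        then have "(x, y) \<in> ?O (rep i)" using orb[OF rep[OF i]] by blast
        then show "S \<in> (\<lambda>i. ?O (rep i)) ` {..<r}" using orb_eq[OF rep[OF i]] i S by blast
      next
        fix S assume "S \<in> (\<lambda>i. ?O (rep i)) ` {..<r}"
        then show "S \<in> orbits ?G (W \<times> W) (\<lambda>f (x, y). (f x, f y))"
          unfolding orbits_def using rep by blast
      qed
    qed
    then show ?thesis using bij_betw_same_card by fastforce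
  qed
  ultimately show ?thesis by (simp add: has_rank_def)
qed

section \<open>Symmetric matrices of order three\<close>

definition dot :: "'a::comm_ring_1^3 \<Rightarrow> 'a^3 \<Rightarrow> 'a" where
  "dot x y = x$1 * y$1 + x$2 * y$2 + x$3 * y$3"

lemma dot_add_left: "dot (x + x') y = dot x y + dot x' y"
  and dot_add_right: "dot x (y + y') = dot x y + dot x y'"
  and dot_diff_left: "dot (x - x') y = dot x y - dot x' y"
  and dot_diff_right: "dot x (y - y') = dot x y - dot x y'"
  and dot_scale_left: "dot (c *s x) y = c * dot x y"
  and dot_scale_right: "dot x (c *s y) = c * dot x y"
  and dot_zero_left [simp]: "dot 0 y = 0"
  and dot_zero_right [simp]: "dot x 0 = 0"
  by (simp_all add: dot_def algebra_simps)

lemma dot_commute: "dot x y = dot y x"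
  by (simp add: dot_def mult.commute)

lemma dot_axis: "dot (axis i 1) (axis j 1) = of_bool (i = j)"
  using exhaust_3[of i] exhaust_3[of j] by (auto simp: dot_def axis_def)

lemma dot_matrix_left: "dot (A *v x) y = dot x (transpose A *v y)"
  by (simp add: dot_def matrix_vector_mult_def sum_3 transpose_def algebra_simps)

lemma dot_eq_0: "x = 0" if "\<And>y. dot x y = 0"
  using that[of "axis 1 1"] that[of "axis 2 1"] that[of "axis 3 1"]
  by (simp add: dot_def axis_def vec_eq_iff forall_3)

lemma mat3_eq_iff: "A = B \<longleftrightarrow> (\<forall>i j. A $ i $ j = (B $ i $ j :: 'a))" for A B :: "'a^3^3"
  by (simp add: vec_eq_iff)

lemma det_nonzero_iff_ker: "det A \<noteq> 0 \<longleftrightarrow> (\<forall>x. A *v x = 0 \<longrightarrow> x = 0)"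
  for A :: "'a::field^3^3"
  by (metis invertible_det_nz invertible_left_inverse matrix_left_invertible_ker)

lemma matrix_axis: "(M *v axis j 1)$i = M$i$j" for M :: "'a::comm_ring_1^3^3"
  using exhaust_3[of j] by (auto simp: matrix_vector_mult_def sum_3 axis_def)

lemma columns_vec: "transpose (vector [x, y, w]) *v z = z$1 *s x + z$2 *s y + z$3 *s w"
  for z :: "'a::comm_ring_1^3"
  by (simp add: transpose_def matrix_vector_mult_def sum_3 vec_eq_iff forall_3 mult.commute)

definition Sym :: "('a::comm_ring_1^3^3) set" where
  "Sym = {S. transpose S = S}"

lemma Sym_dot: "S \<in> Sym \<Longrightarrow> dot (S *v x) y = dot x (S *v y)"
  by (simp add: dot_matrix_left Sym_def)

lemma SymI_dot:
  assumes "\<And>x y. dot (S *v x) y = dot x (S *v y)"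
  shows "S \<in> Sym"
proof -
  have "S *v x = transpose S *v x" for x
  proof -
    have "dot (S *v x - transpose S *v x) y = 0" for y
      using assms[of x y] dot_matrix_left[of "transpose S" x y] by (simp add: dot_diff_left)
    then show ?thesis using dot_eq_0 by fastforce
  qed
  then show ?thesis unfolding Sym_def using matrix_eq[of "transpose S" S] by simp
qed

lemma Sym_0: "0 \<in> Sym"
  and Sym_add: "S \<in> Sym \<Longrightarrow> T \<in> Sym \<Longrightarrow> S + T \<in> Sym"
  and Sym_diff: "S \<in> Sym \<Longrightarrow> T \<in> Sym \<Longrightarrow> S - T \<in> Sym"
  by (simp_all add: Sym_def transpose_def mat3_eq_iff)

lemma Sym_uminus: "S \<in> Sym \<Longrightarrow> - S \<in> Sym"
  using Sym_diff[OF Sym_0, of S] by simp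

lemma Sym_congruence: "S \<in> Sym \<Longrightarrow> transpose G ** S ** G \<in> Sym"
  by (simp add: Sym_def matrix_transpose_mul matrix_mul_assoc)

text \<open>The entries are grouped so that the first triple is the leading \<open>2 \<times> 2\<close> block.\<close>

fun sym_mat :: "('a \<times> 'a \<times> 'a) \<times> ('a \<times> 'a \<times> 'a) \<Rightarrow> 'a::comm_ring_1^3^3" where
  "sym_mat ((a, b, d), (c, e, f)) = vector [vector [a, d, e], vector [d, b, f], vector [e, f, c]]"

lemma bij_sym_mat: "bij_betw sym_mat UNIV Sym"
proof (rule bij_betwI')
  fix z w :: "('a \<times> 'a \<times> 'a) \<times> ('a \<times> 'a \<times> 'a)"
  obtain a b d c e f where z: "z = ((a, b, d), (c, e, f))" by (metis prod_cases3 surj_pair)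
  obtain a' b' d' c' e' f' where w: "w = ((a', b', d'), (c', e', f'))"
    by (metis prod_cases3 surj_pair)
  show "sym_mat z = sym_mat w \<longleftrightarrow> z = w"
    unfolding z w by (auto simp: vec_eq_iff forall_3)
  show "sym_mat z \<in> Sym"
    unfolding z by (simp add: Sym_def transpose_def mat3_eq_iff forall_3)
next
  fix S :: "'a^3^3" assume "S \<in> Sym"
  then have "S $ i $ j = S $ j $ i" for i j
    unfolding Sym_def transpose_def by (metis (mono_tags) mem_Collect_eq vec_lambda_beta)
  then have "S = sym_mat ((S$1$1, S$2$2, S$1$2), (S$3$3, S$1$3, S$2$3))"
    by (simp add: mat3_eq_iff forall_3)
  then show "\<exists>z\<in>UNIV. S = sym_mat z" by blast
qed

lemma card_Sym_Collect: "card {S\<in>Sym. P S} = card {z. P (sym_mat z)}"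
proof -
  have inj: "inj sym_mat" and range: "range sym_mat = Sym" using bij_sym_mat by (auto simp only: bij_betw_def)
  have "{S\<in>Sym. P S} = sym_mat ` {z. P (sym_mat z)}" unfolding range[symmetric] by blast
  then show ?thesis by (simp only: card_image inj_on_subset[OF inj subset_UNIV])
qed

lemma card_Sym: "card (Sym :: ('a::{comm_ring_1,finite}^3^3) set) = CARD('a) ^ 6"
  using bij_betw_same_card[OF bij_sym_mat[where 'a='a]]
  by (simp add: power_numeral_reduce)

section \<open>Nonsingular symmetric matrices with prescribed leading block\<close>

fun minor :: "nat \<Rightarrow> 'a \<times> 'a \<times> 'a \<Rightarrow> 'a::comm_ring_1" where
  "minor r (a, b, d) = (if r = 1 then a else a * b - d * d)"

lemma det_sym_mat: "det (sym_mat ((a, b, d), (c, e, f))) =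
  c * (a * b - d * d) - (a * f * f + b * e * e - 2 * d * e * f)"
  by (simp add: det_3 algebra_simps)

lemma card_diff_singleton: "card {x::'a::finite. x \<noteq> c} = CARD('a) - 1"
proof -
  have "{x. x \<noteq> c} = UNIV - {c}" by blast
  then show ?thesis by (simp add: card_Diff_singleton)
qed

text \<open>The determinant is \<open>c * (a * b - d * d)\<close> minus a binary quadratic form in
  \<open>(e, f)\<close>. If the block is nonsingular, exactly one \<open>c\<close> is excluded for
  each \<open>(e, f)\<close>. If it has rank one, the quadratic form is a nonzero multiple of the
  square of a nonzero linear form; then \<open>c\<close> is free and the q zeros of the linear form
  are excluded. Both cases leave (q-1) q^2 choices.\<close>

lemma card_det_fiber:
  fixes z :: "'a::{field,finite} \<times> 'a \<times> 'a"
  shows "card {w. det (sym_mat (z, w)) \<noteq> 0} = (if z = 0 then 0 else (CARD('a) - 1) * CARD('a)^2)"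
proof -
  obtain a b d where z: "z = (a, b, d)" by (metis prod_cases3)
  let ?q = "CARD('a)" and ?m = "a * b - d * d"
  have eq: "{w. det (sym_mat (z, w)) \<noteq> 0} =
    {(c, e, f). c * ?m \<noteq> a * f * f + b * e * e - 2 * d * e * f}"
    unfolding z by (auto simp del: sym_mat.simps simp: det_sym_mat)
  \<comment> \<open>Fibres over the last two coordinates. In the singular cases the coordinates are
    permuted so that the constrained one comes first.\<close>
  have prod: "card {(c::'a, e::'a, f::'a). P c e f} = n * ?q * ?q"
    if "\<And>e f. card {c. P c e f} = n" for P n
  proof -
    have "bij_betw (\<lambda>((e, f), c). (c, e, f)) (SIGMA (e, f):UNIV. {c. P c e f}) {(c, e, f). P c e f}"
      by (rule bij_betwI[of _ _ _ "\<lambda>(c, e, f). ((e, f), c)"]) auto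
    then have "card {(c, e, f). P c e f} = card (SIGMA (e, f):UNIV. {c. P c e f})"
      using bij_betw_same_card by fastforce
    also have "\<dots> = (\<Sum>(e, f)\<in>UNIV. card {c. P c e f})"
      by (simp add: case_prod_unfold)
    also have "\<dots> = n * ?q * ?q" using that by (simp add: case_prod_unfold)
    finally show ?thesis .
  qed
  consider "?m \<noteq> 0" | "?m = 0" "a \<noteq> 0" | "?m = 0" "a = 0" "b \<noteq> 0" | "z = 0"
    unfolding z zero_prod_def by (cases "a = 0"; cases "b = 0"; cases "d = 0") auto
  then show ?thesis
  proof cases
    case 1
    have "{c. c * ?m \<noteq> t} = {c. c \<noteq> t / ?m}" for t using 1 by (auto simp: field_simps)
    moreover have "z \<noteq> 0" using 1 z by (auto simp: zero_prod_def)
    ultimately show ?thesis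
      unfolding eq by (subst prod[where n = "?q - 1"]) (simp_all add: card_diff_singleton power2_eq_square)
  next
    case 2
    \<comment> \<open>For \<open>?m = 0\<close> this exhibits the quadratic form, multiplied by
      \<open>a\<close>, as the square of a linear form.\<close>
    have "a * (a * f * f + b * e * e - 2 * d * e * f) = (a * f - d * e) * (a * f - d * e) + ?m * (e * e)"
      for e f by (simp add: algebra_simps)
    then have key: "a * f * f + b * e * e - 2 * d * e * f = 0 \<longleftrightarrow> a * f - d * e = 0" for e f
      using 2 by (metis add.right_neutral mult_eq_0_iff)
    have "c * ?m \<noteq> a * f * f + b * e * e - 2 * d * e * f \<longleftrightarrow> f \<noteq> d * e / a" for c e f
    proof -
      have "f = d * e / a \<longleftrightarrow> a * f - d * e = 0" using 2(2) by (simp add: nonzero_eq_divide_eq mult.commute)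
      then show ?thesis using key[of f e] 2(1) by (metis mult_zero_right)
    qed
    then have "{(c, e, f). c * ?m \<noteq> a * f * f + b * e * e - 2 * d * e * f} =
        {(c::'a, e, f). f \<noteq> d * e / a}"
      by simp
    moreover have "bij_betw (\<lambda>(c, e, f). (f, e, c)) {(c::'a, e, f). f \<noteq> d * e / a}
        {(c, e, f::'a). c \<noteq> d * e / a}"
      by (rule bij_betwI[of _ _ _ "\<lambda>(c, e, f). (f, e, c)"]) auto
    ultimately have "card {w. det (sym_mat (z, w)) \<noteq> 0} = card {(c, e, f::'a). c \<noteq> d * e / a}"
      unfolding eq using bij_betw_same_card by fastforce
    also have "\<dots> = (?q - 1) * ?q * ?q" by (rule prod) (simp add: card_diff_singleton)
    finally show ?thesis using z 2 by (auto simp: power2_eq_square zero_prod_def)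
  next
    case 3
    then have "d = 0" by simp
    then have "{(c, e, f). c * ?m \<noteq> a * f * f + b * e * e - 2 * d * e * f} =
        {(c::'a, e, f::'a). e \<noteq> 0}"
      using 3 by auto
    moreover have "bij_betw (\<lambda>(c, e, f). (e, c, f)) {(c::'a, e::'a, f::'a). e \<noteq> 0}
        {(c, e, f). c \<noteq> 0}"
      by (rule bij_betwI[of _ _ _ "\<lambda>(c, e, f). (e, c, f)"]) auto
    ultimately have "card {w. det (sym_mat (z, w)) \<noteq> 0} = card {(c::'a, e::'a, f::'a). c \<noteq> 0}"
      unfolding eq using bij_betw_same_card by fastforce
    also have "\<dots> = (?q - 1) * ?q * ?q" by (rule prod) (simp add: card_diff_singleton)
    finally show ?thesis using z 3 by (auto simp: power2_eq_square zero_prod_def)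
  next
    case 4
    then show ?thesis unfolding eq using z by (auto simp: zero_prod_def)
  qed
qed

lemma card_det_nonzero_block:
  "card {S\<in>Sym. det S \<noteq> 0 \<and> P (S$1$1, S$2$2, S$1$2)} =
    card {z. z \<noteq> 0 \<and> P z} * ((CARD('a) - 1) * CARD('a)^2)"
  for P :: "'a::{field,finite} \<times> 'a \<times> 'a \<Rightarrow> bool"
proof -
  have "card {S\<in>Sym. det S \<noteq> 0 \<and> P (S$1$1, S$2$2, S$1$2)} =
      card {x. det (sym_mat x) \<noteq> 0 \<and> P (sym_mat x$1$1, sym_mat x$2$2, sym_mat x$1$2)}"
    by (rule card_Sym_Collect)
  also have "{x. det (sym_mat x) \<noteq> 0 \<and> P (sym_mat x$1$1, sym_mat x$2$2, sym_mat x$1$2)} =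
      (SIGMA z:{z. P z}. {w. det (sym_mat (z, w)) \<noteq> 0})"
    by (auto simp del: sym_mat.simps) (simp_all)
  also have "card \<dots> = (\<Sum>z\<in>{z. P z}. if z = 0 then 0 else (CARD('a) - 1) * CARD('a)^2)"
    by (simp del: sym_mat.simps add: card_det_fiber)
  also have "\<dots> = (\<Sum>z\<in>{z. z \<noteq> 0 \<and> P z}. (CARD('a) - 1) * CARD('a)^2)"
    by (rule sum.mono_neutral_cong_right) auto
  finally show ?thesis by simp
qed

lemma card_block:
  "card {S\<in>Sym. P (S$1$1, S$2$2, S$1$2)} = card {z. P z} * CARD('a)^3"
  for P :: "'a::{field,finite} \<times> 'a \<times> 'a \<Rightarrow> bool"
proof -
  have "card {S\<in>Sym. P (S$1$1, S$2$2, S$1$2)} =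
      card {x. P (sym_mat x$1$1, sym_mat x$2$2, sym_mat x$1$2)}"
    by (rule card_Sym_Collect)
  also have "{x. P (sym_mat x$1$1, sym_mat x$2$2, sym_mat x$1$2)} = {z. P z} \<times> UNIV"
    by auto
  finally show ?thesis by (simp add: card_cartesian_product power_numeral_reduce)
qed

lemma card_det_nonzero:
  "card {S\<in>Sym. det (S::'a::{field,finite}^3^3) \<noteq> 0} = CARD('a)^2 * (CARD('a)^3 - 1) * (CARD('a) - 1)"
proof -
  have "card {z::'a\<times>'a\<times>'a. z \<noteq> 0} = CARD('a)^3 - 1"
    by (simp add: card_diff_singleton power_numeral_reduce)
  then show ?thesis using card_det_nonzero_block[of "\<lambda>_ :: 'a \<times> 'a \<times> 'a. True"] by simp
qed

section \<open>Quadratic forms in three variables over a finite field\<close>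

lemma card_range_square: "CARD('a) + 1 \<le> 2 * card (range (\<lambda>x::'a::{field,finite}. x * x))"
proof -
  let ?R = "range (\<lambda>x::'a. x * x)"
  have zero: "0 \<in> ?R" by (rule image_eqI[of _ _ 0]) simp_all
  have fib: "card {x. x * x = y} \<le> 2" if y: "y \<in> ?R" for y :: 'a
  proof -
    obtain w where "y = w * w" using y by blast
    then have "{x. x * x = y} \<subseteq> {w, - w}" by (auto simp: square_eq_iff)
    then have "card {x. x * x = y} \<le> card {w, - w}" by (intro card_mono) auto
    also have "\<dots> \<le> 2" by (simp add: card_insert_if)
    finally show ?thesis .
  qed
  have "CARD('a) = (\<Sum>y\<in>?R. card {x. x * x = y})"
    using sum.image_gen[of "UNIV :: 'a set" "\<lambda>_. 1::nat" "\<lambda>x. x * x"] by simp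
  \<comment> \<open>Zero has a single square root, every other square at most two; splitting off
    zero yields the extra one in the bound.\<close>
  also have "\<dots> = card {x::'a. x * x = 0} + (\<Sum>y\<in>?R - {0}. card {x. x * x = y})"
    using zero by (intro sum.remove) auto
  also have "\<dots> \<le> 1 + (\<Sum>y\<in>?R - {0}. 2)"
    using fib by (intro add_mono sum_mono) auto
  also have "\<dots> = 1 + 2 * (card ?R - 1)" using zero by (simp add: card_Diff_singleton)
  finally show ?thesis using zero card_gt_0_iff[of ?R] by fastforce
qed

text \<open>The values \<open>m * (X * X)\<close> and the values \<open>n - Y * Y\<close> each fill
  more than half of the field, so they have an element in common.\<close>

lemma two_squares_represent:
  fixes m n :: "'a::{field,finite}"
  assumes "m \<noteq> 0"
  obtains X Y where "m * (X * X) + Y * Y = n"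
proof -
  let ?R = "range (\<lambda>x::'a. x * x)"
  let ?S = "(\<lambda>x. m * x) ` ?R" and ?T = "(\<lambda>y. n - y) ` ?R"
  have "card ?S = card ?R" "card ?T = card ?R"
    using assms by (auto intro!: card_image simp: inj_on_def)
  then have "card (?S \<union> ?T) < card ?S + card ?T"
    using card_range_square[where 'a='a] card_mono[of UNIV "?S \<union> ?T"] by simp
  then have "?S \<inter> ?T \<noteq> {}" using card_Un_disjoint[OF finite finite, of ?S ?T] by linarith
  then obtain x y where "m * (x * x) = n - y * y" by blast
  then show ?thesis using that[of x y] by (simp add: algebra_simps)
qed

lemma Sym_entries:
  assumes "S \<in> Sym"
  shows "S$2$1 = S$1$2" "S$3$1 = S$1$3" "S$3$2 = S$2$3"
  using assms unfolding Sym_def transpose_def by (metis (mono_tags) mem_Collect_eq vec_lambda_beta)+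

text \<open>An instance of Chevalley's theorem. If the leading entry or the leading minor vanishes,
  a zero with third coordinate 0 is written down. Otherwise the third coordinate is set to 1 and two
  squares have to represent a given constant.\<close>

lemma isotropic_vector:
  fixes A :: "'a::{field,finite}^3^3"
  assumes "A \<in> Sym"
  obtains v where "v \<noteq> 0" "dot v (A *v v) = 0"
proof -
  define a b c d e f where "a = A$1$1" and "b = A$2$2" and "c = A$3$3" and "d = A$1$2"
    and "e = A$1$3" and "f = A$2$3"
  let ?Q = "\<lambda>x y z. a*x*x + b*y*y + c*z*z + 2*d*x*y + 2*e*x*z + 2*f*y*z"
  have form: "dot v (A *v v) = ?Q (v$1) (v$2) (v$3)" for v
    using Sym_entries[OF assms]
    by (simp add: dot_def matrix_vector_mult_def sum_3 a_def b_def c_def d_def e_def f_def algebra_simps)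
  have vec: "\<exists>v. v \<noteq> 0 \<and> dot v (A *v v) = 0" if "?Q x y z = 0" "x \<noteq> 0 \<or> y \<noteq> 0 \<or> z \<noteq> 0" for x y z
    using that by (intro exI[of _ "vector [x, y, z]"]) (auto simp: form vec_eq_iff forall_3)
  let ?m = "a * b - d * d"
  have "\<exists>v. v \<noteq> 0 \<and> dot v (A *v v) = 0"
  proof (cases "a = 0 \<or> ?m = 0")
    case True
    then show ?thesis
    proof
      assume "a = 0" then show ?thesis by (intro vec[of 1 0 0]) simp_all
    next
      assume m: "?m = 0"
      show ?thesis
      proof (cases "a = 0")
        case True then show ?thesis by (intro vec[of 1 0 0]) simp_all
      next
        case False
        have "?Q (- d) a 0 = a * ?m" by (simp add: algebra_simps)
        then show ?thesis using m False by (intro vec[of "- d" a 0]) simp_all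
      qed
    qed
  next
    case False
    \<comment> \<open>Completing the square twice: \<open>a m Q = m (a x + d y + e z)\<^sup>2 + (m y + g z)\<^sup>2 + h z\<^sup>2\<close>.\<close>
    define g h where "g = a * f - d * e" and "h = ?m * (a * c - e * e) - g * g"
    obtain X Y where XY: "?m * (X * X) + Y * Y = - h"
      using two_squares_represent[of ?m "- h"] False by blast
    define y x where "y = (Y - g) / ?m" and "x = (X - d * y - e) / a"
    have Y: "Y = ?m * y + g" and X: "X = a * x + d * y + e"
      using False by (simp_all add: y_def x_def)
    have "a * ?m * ?Q x y 1 = ?m * (X * X) + Y * Y + h"
      unfolding X Y h_def g_def by (simp add: algebra_simps)
    then have "?Q x y 1 = 0" using XY False by simp
    then show ?thesis by (intro vec[of x y 1]) simp_all
  qed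
  then show ?thesis using that by blast
qed

lemma square_root_char_2:
  fixes x :: "'a::{field,finite}"
  assumes "(2::'a) = 0"
  obtains r where "r * r = x"
proof -
  have "inj (\<lambda>x::'a. x * x)"
  proof (rule injI)
    fix x y :: 'a assume "x * x = y * y"
    then have "x = y \<or> x = - y" by (simp add: square_eq_iff)
    moreover have "- y = y" using assms by (metis add_eq_0_iff mult_2 mult_zero_left)
    ultimately show "x = y" by auto
  qed
  then have "surj (\<lambda>x::'a. x * x)" by (simp add: finite_UNIV_inj_surj)
  then obtain r where "x = r * r" by (rule surjE)
  then show ?thesis using that[of r] by simp
qed

lemma congruence_entry:
  fixes A :: "'a::field^3^3"
  shows "(transpose G ** A ** G)$i$j = dot (column i G) (A *v column j G)"
  by (simp add: dot_def matrix_matrix_mult_def matrix_vector_mult_def transpose_def column_def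
      sum_3 algebra_simps)

text \<open>An isotropic vector splits off a hyperbolic plane, leaving one vector \<open>u\<close>
  with value \<open>c\<close>. A hyperbolic plane is isometric to all its nonzero multiples, so it
  can be scaled by the same \<open>c\<close>, and a single scalar describes the whole form.\<close>

lemma Sym_congruent_normal_form:
  fixes A :: "'a::{field,finite}^3^3"
  assumes A: "A \<in> Sym" "det A \<noteq> 0"
  obtains G c where "transpose G ** A ** G = sym_mat ((0, 0, c), (c, 0, 0))" "c \<noteq> 0" "det G \<noteq> 0"
proof -
  let ?B = "\<lambda>x y. dot x (A *v y)"
  have Bsym: "?B x y = ?B y x" for x y
    using Sym_dot[OF A(1)] by (metis dot_commute)
  have nondeg: "y = 0" if "\<And>x. ?B x y = 0" for y
  proof -
    have "A *v y = 0" by (rule dot_eq_0) (use that in \<open>simp add: dot_commute\<close>)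
    then show ?thesis using A(2) det_nonzero_iff_ker by blast
  qed
  note bil = dot_add_left dot_add_right dot_diff_left dot_diff_right dot_scale_left dot_scale_right
    matrix_vector_right_distrib matrix_vector_mult_diff_distrib vector_scalar_commute
  obtain v where v: "v \<noteq> 0" "?B v v = 0" using isotropic_vector[OF A(1)] by blast
  obtain w0 where w0: "?B w0 v \<noteq> 0" using nondeg v by blast
  define w where "w = (1 / ?B w0 v) *s w0"
  have vw: "?B v w = 1" using w0 Bsym[of v w] by (simp add: w_def bil)
  obtain u where u: "u \<noteq> 0" "?B u v = 0" "?B u w = 0"
  proof -
    \<comment> \<open>Two linear conditions on three coordinates: the zero row makes the matrix
      singular, so a nonzero solution \<open>u\<close> exists.\<close>
    define M :: "'a^3^3" where "M = vector [A *v v, A *v w, 0]"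
    have "det M = 0" by (simp add: det_3 M_def)
    then obtain u where "u \<noteq> 0" "M *v u = 0" using det_nonzero_iff_ker by blast
    moreover have "(M *v u)$1 = ?B u v" "(M *v u)$2 = ?B u w"
      by (simp_all add: M_def matrix_vector_mult_def sum_3 dot_def mult.commute)
    ultimately show ?thesis using that by simp
  qed
  define c where "c = ?B u u"
  \<comment> \<open>Otherwise \<open>u\<close> would be orthogonal to the basis \<open>v\<close>,
    \<open>w\<close>, \<open>u\<close> and lie in the radical.\<close>
  have "c \<noteq> 0"
  proof
    assume "c = 0"
    define M :: "'a^3^3" where "M = transpose (vector [v, w, u])"
    have M: "M *v z = z$1 *s v + z$2 *s w + z$3 *s u" for z
      unfolding M_def by (rule columns_vec)
    have "z = 0" if "M *v z = 0" for z
    proof -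
      have "?B v (M *v z) = 0" "?B w (M *v z) = 0" using that by simp_all
      then have "z$2 = 0" "z$1 + z$2 * ?B w w = 0"
        using v(2) vw u Bsym by (simp_all add: M bil)
      moreover from this have "z$3 = 0" using \<open>M *v z = 0\<close> u(1) by (simp add: M)
      ultimately show "z = 0" by (simp add: vec_eq_iff forall_3)
    qed
    then have "invertible M" using det_nonzero_iff_ker invertible_det_nz by blast
    then obtain N where N: "M ** N = mat 1" unfolding invertible_def by blast
    have "?B x u = 0" for x
    proof -
      have "x = M *v (N *v x)" by (simp add: matrix_vector_mul_assoc N)
      moreover have "?B (M *v z) u = 0" for z
        using u \<open>c = 0\<close> Bsym by (simp add: M bil c_def)
      ultimately show ?thesis by metis
    qed
    then show False using nondeg u(1) by blast
  qed
  \<comment> \<open>This equation makes the corrected \<open>w'\<close> isotropic. In odd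
    characteristic a multiple of \<open>v\<close> is enough. In characteristic two the term
    \<open>2 * r\<close> vanishes and a multiple of \<open>u\<close> is used, which then requires
    correcting \<open>u\<close> as well.\<close>
  obtain t r where tr: "?B w w + t * t * c + 2 * r = 0"
  proof (cases "(2::'a) = 0")
    case True
    then obtain t where "t * t = - ?B w w / c" using square_root_char_2 by blast
    then show ?thesis using that[of t 0] \<open>c \<noteq> 0\<close> by simp
  next
    case False
    then show ?thesis using that[of 0 "- ?B w w / 2"] by simp
  qed
  define v' w' u' where "v' = c *s v" and "w' = w + t *s u + r *s v" and "u' = u - (t * c) *s v"
  have gram: "?B v' v' = 0" "?B v' w' = c" "?B v' u' = 0" "?B w' w' = 0" "?B w' u' = 0" "?B u' u' = c"
    using v(2) vw u Bsym[of w v] Bsym[of v u] Bsym[of w u] tr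
    by (simp_all add: v'_def w'_def u'_def bil c_def algebra_simps)
  define G :: "'a^3^3" where "G = transpose (vector [v', w', u'])"
  have col: "column 1 G = v'" "column 2 G = w'" "column 3 G = u'"
    by (simp_all add: G_def column_def transpose_def vec_eq_iff)
  have GAG: "transpose G ** A ** G = sym_mat ((0, 0, c), (c, 0, 0))"
    using gram Bsym[of w' v'] Bsym[of u' v'] Bsym[of u' w']
    by (simp add: mat3_eq_iff forall_3 congruence_entry col)
  have "det (sym_mat ((0, 0, c), (c, 0, 0))) \<noteq> 0" using \<open>c \<noteq> 0\<close> by (simp only: det_sym_mat) simp
  then have "det G \<noteq> 0" unfolding GAG[symmetric] by (auto simp: det_mul)
  then show ?thesis using that GAG \<open>c \<noteq> 0\<close> by blast
qed

text \<open>For nonsingular symmetric \<open>A\<close> this is \<lambda>': it counts the graphs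
  disjoint from the graphs of 0 and \<open>A\<close>, that is, the planes disjoint from three
  pairwise disjoint planes.\<close>

definition common_nonsingular :: "'a::{field,finite}^3^3 \<Rightarrow> nat" where
  "common_nonsingular A = card {S\<in>Sym. det S \<noteq> 0 \<and> det (S - A) \<noteq> 0}"

lemma inverse_matrices:
  fixes G :: "'a::field^'n^'n"
  assumes "det G \<noteq> 0"
  obtains H where "G ** H = mat 1" "H ** G = mat 1" "det H \<noteq> 0"
proof -
  obtain H where H: "G ** H = mat 1" "H ** G = mat 1"
    using assms invertible_det_nz unfolding invertible_def by blast
  have "det G * det H = 1" using H(1) det_mul[of G H] by simp
  then have "det H \<noteq> 0" by auto
  with H that show ?thesis by blast
qed

lemma congruence_cancel:
  fixes S :: "'a::field^3^3"
  assumes "G ** H = mat 1"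
  shows "transpose H ** (transpose G ** S ** G) ** H = S"
proof -
  have "transpose H ** (transpose G ** S ** G) ** H = (transpose H ** transpose G) ** S ** (G ** H)"
    by (simp add: matrix_mul_assoc)
  also have "transpose H ** transpose G = mat 1"
    using assms by (metis matrix_transpose_mul transpose_mat)
  finally show ?thesis using assms by simp
qed

text \<open>Such a map \<open>h\<close> carries the matrices counted for \<open>A\<close>
  injectively to matrices counted for \<open>h A\<close>. Used for a congruence or a scaling and for
  its inverse, it gives equality.\<close>

lemma common_nonsingular_le:
  assumes "\<And>S. S \<in> Sym \<Longrightarrow> h S \<in> Sym" "\<And>S. g (h S) = S"
    "\<And>S. det S \<noteq> 0 \<Longrightarrow> det (h S) \<noteq> 0" "\<And>S. h (S - A) = h S - h A"
  shows "common_nonsingular A \<le> common_nonsingular (h A)"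
  unfolding common_nonsingular_def
proof (rule card_inj_on_le[of h])
  show "inj_on h {S \<in> Sym. det S \<noteq> 0 \<and> det (S - A) \<noteq> 0}"
    by (rule inj_on_inverseI[where g = g]) (rule assms(2))
  show "h ` {S \<in> Sym. det S \<noteq> 0 \<and> det (S - A) \<noteq> 0} \<subseteq>
      {S \<in> Sym. det S \<noteq> 0 \<and> det (S - h A) \<noteq> 0}"
    using assms(1,3) by (auto simp flip: assms(4))
qed simp

lemma matrix_mul_diff: "G ** (S - T) ** H = G ** S ** H - G ** T ** H"
  for G S T H :: "'a::field^3^3"
  by (simp add: matrix_matrix_mult_def vec_eq_iff sum_3 algebra_simps)

lemma common_nonsingular_congruence:
  fixes A :: "'a::{field,finite}^3^3"
  assumes "det G \<noteq> 0"
  shows "common_nonsingular (transpose G ** A ** G) = common_nonsingular A"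
proof (rule antisym)
  obtain H where H: "G ** H = mat 1" "H ** G = mat 1" "det H \<noteq> 0"
    using inverse_matrices[OF assms] by blast
  show "common_nonsingular A \<le> common_nonsingular (transpose G ** A ** G)"
    by (rule common_nonsingular_le[where h = "\<lambda>S. transpose G ** S ** G" and
      g = "\<lambda>S. transpose H ** S ** H"])
      (use assms H in \<open>simp_all add: Sym_congruence congruence_cancel det_mul matrix_mul_diff\<close>)
  have "common_nonsingular (transpose G ** A ** G) \<le>
      common_nonsingular (transpose H ** (transpose G ** A ** G) ** H)"
    by (rule common_nonsingular_le[where h = "\<lambda>S. transpose H ** S ** H" and
      g = "\<lambda>S. transpose G ** S ** G"])
      (use assms H in \<open>simp_all add: Sym_congruence congruence_cancel det_mul matrix_mul_diff\<close>)
  then show "common_nonsingular (transpose G ** A ** G) \<le> common_nonsingular A"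
    by (simp add: congruence_cancel H(1))
qed

lemma mat_mult_entry: "(mat c ** S)$i$j = c * S$i$j" for S :: "'a::field^3^3"
  using exhaust_3[of i] by (auto simp: matrix_matrix_mult_def mat_def sum_3)

lemma common_nonsingular_scale:
  fixes A :: "'a::{field,finite}^3^3"
  assumes "c \<noteq> 0"
  shows "common_nonsingular (mat c ** A) = common_nonsingular A"
proof (rule antisym)
  have det: "det (mat c :: 'a^3^3) \<noteq> 0" if "c \<noteq> 0" for c
    using that by (simp add: det_3 mat_def)
  have le: "common_nonsingular A \<le> common_nonsingular (mat c ** A)" if c: "c \<noteq> 0"
    for c and A :: "'a^3^3"
    by (rule common_nonsingular_le[where h = "\<lambda>S. mat c ** S" and g = "\<lambda>S. mat (inverse c) ** S"])
      (use c in \<open>auto simp: det_mul det Sym_def transpose_def mat3_eq_iff mat_mult_entry right_diff_distrib\<close>)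
  show "common_nonsingular A \<le> common_nonsingular (mat c ** A)" by (rule le[OF assms])
  have "mat (inverse c) ** (mat c ** A) = A"
    using assms by (simp add: mat3_eq_iff mat_mult_entry)
  then show "common_nonsingular (mat c ** A) \<le> common_nonsingular A"
    using le[of "inverse c" "mat c ** A"] assms by simp
qed

lemma common_nonsingular_const:
  fixes A :: "'a::{field,finite}^3^3"
  assumes "A \<in> Sym" "det A \<noteq> 0"
  shows "common_nonsingular A = common_nonsingular (sym_mat ((0, 0, 1), (1, 0, 0::'a)))"
proof -
  obtain G c where G: "transpose G ** A ** G = sym_mat ((0, 0, c), (c, 0, 0))" "c \<noteq> 0" "det G \<noteq> 0"
    using Sym_congruent_normal_form[OF assms] by blast
  have "sym_mat ((0, 0, c), (c, 0, 0)) = mat c ** sym_mat ((0, 0, 1), (1, 0, 0))"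
    by (simp add: mat3_eq_iff forall_3 mat_mult_entry)
  then show ?thesis
    using common_nonsingular_congruence[OF G(3), of A]
    by (simp del: sym_mat.simps add: G(1) common_nonsingular_scale[OF G(2)])
qed

section \<open>Symmetric matrices of arbitrary rank up to congruence\<close>

definition proj :: "nat \<Rightarrow> 'a::comm_ring_1^3^3" where
  "proj r = sym_mat ((of_bool (1 \<le> r), of_bool (2 \<le> r), 0), (of_bool (3 \<le> r), 0, 0))"

lemma sym_mat_vec: "sym_mat ((a, b, d), (c, e, f)) *v x = vector [a * x$1 + d * x$2 + e * x$3,
    d * x$1 + b * x$2 + f * x$3, e * x$1 + f * x$2 + c * x$3]"
  by (simp add: matrix_vector_mult_def sum_3 vec_eq_iff forall_3)

lemma Sym_sym_mat: "sym_mat z \<in> Sym"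
  using bij_sym_mat by (auto simp: bij_betw_def)

lemma Sym_proj: "proj r \<in> Sym"
  by (simp only: proj_def Sym_sym_mat)

lemma proj_vec: "proj r *v z =
    vector [of_bool (1 \<le> r) * z$1, of_bool (2 \<le> r) * z$2, of_bool (3 \<le> r) * z$3]"
  for z :: "'a::comm_ring_1^3"
  by (simp add: proj_def matrix_vector_mult_def sum_3 vec_eq_iff forall_3)

lemma complete_to_basis:
  fixes v :: "'a::field^3"
  assumes "v \<noteq> 0"
  obtains G where "det G \<noteq> 0" "column 3 G = v"
proof -
  define G :: "'a^3 \<Rightarrow> 'a^3 \<Rightarrow> 'a^3^3" where "G x y = transpose (vector [x, y, v])" for x y
  have col: "column 3 (G x y) = v" for x y
    by (simp add: G_def column_def transpose_def vec_eq_iff)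
  have "det (G (axis 1 1) (axis 2 1)) = v$3" "det (G (axis 1 1) (axis 3 1)) = - v$2"
    "det (G (axis 2 1) (axis 3 1)) = v$1"
    by (simp_all add: G_def det_3 transpose_def axis_def)
  moreover have "v$1 \<noteq> 0 \<or> v$2 \<noteq> 0 \<or> v$3 \<noteq> 0"
    using assms by (simp add: vec_eq_iff forall_3)
  ultimately show ?thesis using that col by (metis neg_equal_0_iff_equal)
qed

text \<open>With a kernel vector as last basis vector the last column vanishes, and by symmetry so
  does the last row.\<close>

lemma singular_Sym_reduce:
  fixes T :: "'a::field^3^3"
  assumes "T \<in> Sym" "det T = 0"
  obtains G z where "det G \<noteq> 0" "transpose G ** T ** G = sym_mat (z, 0)"
proof -
  obtain v where v: "v \<noteq> 0" "T *v v = 0" using assms(2) det_nonzero_iff_ker by blast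
  obtain G where G: "det G \<noteq> 0" "column 3 G = v" using complete_to_basis[OF v(1)] by blast
  let ?T = "transpose G ** T ** G"
  have S: "?T \<in> Sym" by (rule Sym_congruence[OF assms(1)])
  have 3: "?T$i$3 = 0" for i by (simp add: congruence_entry G(2) v(2))
  have "?T = sym_mat ((?T$1$1, ?T$2$2, ?T$1$2), (0, 0, 0))"
    using 3 Sym_entries[OF S] by (simp add: mat3_eq_iff forall_3)
  then show ?thesis using that G(1) by (metis zero_prod_def)
qed

text \<open>The two equations say that the transformed matrix is supported on a leading block of
  size \<open>r\<close> and that the leading block of the symmetric matrix \<open>S\<close> inverts
  it. This replaces diagonalisation, and it is exactly what allows a shear along \<open>S\<close> to
  move a plane into standard position.\<close>

lemma Sym_normal_form:
  fixes T :: "'a::field^3^3"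
  assumes "T \<in> Sym"
  obtains G S r where "det G \<noteq> 0" "S \<in> Sym" "r \<le> 3"
    "proj r ** S ** (transpose G ** T ** G) = proj r"
    "proj r ** (transpose G ** T ** G) = transpose G ** T ** G"
proof (cases "det T = 0")
  case False
  then obtain S where S: "T ** S = mat 1" "S ** T = mat 1" using inverse_matrices by blast
  have "transpose S = S"
    using S assms unfolding Sym_def
    by (metis (mono_tags, lifting) matrix_mul_assoc matrix_mul_lid matrix_mul_rid
        matrix_transpose_mul mem_Collect_eq transpose_mat)
  moreover have "proj 3 = (mat 1 :: 'a^3^3)"
    by (simp add: proj_def mat3_eq_iff forall_3 mat_def)
  ultimately show ?thesis using that[of "mat 1" S 3] S by (simp add: Sym_def transpose_mat)
next
  case True
  obtain G z where G: "det G \<noteq> 0" "transpose G ** T ** G = sym_mat (z, 0)"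
    using singular_Sym_reduce[OF assms True] by blast
  obtain a b d where z: "z = (a, b, d)" by (metis prod_cases3)
  let ?m = "a * b - d * d"
  have zero: "(0 :: 'a \<times> 'a \<times> 'a) = (0, 0, 0)" by (simp add: zero_prod_def)
  note calc = proj_def matrix_matrix_mult_def mat3_eq_iff forall_3 sum_3
  show ?thesis
  proof (cases "?m = 0")
    case False
    define S where "S = sym_mat ((b / ?m, a / ?m, - d / ?m), (0, 0, 0))"
    have "b / ?m * a + - d / ?m * d = 1" "b / ?m * d + - d / ?m * b = 0"
      "- d / ?m * a + a / ?m * d = 0" "- d / ?m * d + a / ?m * b = 1"
      using False by (simp_all add: divide_simps)
    then show ?thesis using that[of G S 2] G unfolding z
      by (simp add: zero S_def Sym_sym_mat[of "((b / ?m, a / ?m, - d / ?m), (0, 0, 0))", simplified] calc)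
  next
    case m: True
    \<comment> \<open>A block of rank at most one can be diagonalised: the first two basis vectors
      are exchanged if \<open>a = 0\<close>, otherwise \<open>d\<close> is cleared by a column
      operation.\<close>
    obtain H t where H: "det H \<noteq> 0" "transpose H ** sym_mat (z, 0) ** H = sym_mat ((t, 0, 0), (0, 0, 0))"
    proof (cases "a = 0")
      case True
      then have "d = 0" using m by simp
      define H :: "'a^3^3" where "H = vector [vector [0, 1, 0], vector [1, 0, 0], vector [0, 0, 1]]"
      show ?thesis
        by (rule that[of H b])
          (simp_all add: z zero True \<open>d = 0\<close> H_def det_3 congruence_entry calc(3,4) column_def
            dot_def matrix_vector_mult_def sum_3)
    next
      case False
      define H :: "'a^3^3" where "H = vector [vector [1, - d / a, 0], vector [0, 1, 0], vector [0, 0, 1]]"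
      have "b = d * d / a" using m False by (simp add: field_simps)
      then show ?thesis
        by (intro that[of H a])
          (simp_all add: z zero False H_def det_3 congruence_entry calc(3,4) column_def
            dot_def matrix_vector_mult_def sum_3 field_simps)
    qed
    have GH: "det (G ** H) \<noteq> 0" using G H by (simp add: det_mul)
    have "transpose (G ** H) ** T ** (G ** H) = transpose H ** (transpose G ** T ** G) ** H"
      by (simp add: matrix_transpose_mul matrix_mul_assoc)
    then have eq: "transpose (G ** H) ** T ** (G ** H) = sym_mat ((t, 0, 0), (0, 0, 0))"
      using G H by simp
    define K where "K = G ** H"
    note K = GH[folded K_def] eq[folded K_def]
    show ?thesis
    proof (cases "t = 0")
      case True
      show ?thesis
        by (rule that[of K 0 0, unfolded K(2)]) (simp_all add: K(1) Sym_0 True calc)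
    next
      case False
      show ?thesis
        by (rule that[of K "sym_mat ((1 / t, 0, 0), (0, 0, 0))" 1, unfolded K(2)])
          (use False Sym_sym_mat[of "((1 / t, 0, 0), (0, 0, 0))"] in \<open>simp_all add: K(1) calc\<close>)
    qed
  qed
qed

section \<open>Frames and Lagrangian planes\<close>

locale symplectic_space6 = vector_space scale
  for scale :: "'a::{field,finite} \<Rightarrow> 'b::ab_group_add \<Rightarrow> 'b" +
  fixes B :: "'b \<Rightarrow> 'b \<Rightarrow> 'a"
  assumes dim6: "dim (UNIV :: 'b set) = 6"
    and form: "symplectic_form scale B"
    and nondeg: "nondegenerate B"
begin

lemma B_linear_right: "Vector_Spaces.linear scale (*) (\<lambda>y. B x y)"
  and B_linear_left: "Vector_Spaces.linear scale (*) (\<lambda>x. B x y)"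
  and B_alt [simp]: "B x x = 0"
  using form unfolding symplectic_form_def by blast+

lemma B_add_right: "B x (y + z) = B x y + B x z"
  and B_scale_right: "B x (scale c y) = c * B x y"
  using B_linear_right[of x]
  unfolding Vector_Spaces.linear_def module_hom_def module_hom_axioms_def by blast+

lemma B_add_left: "B (x + z) y = B x y + B z y"
  and B_scale_left: "B (scale c x) y = c * B x y"
  using B_linear_left[of y]
  unfolding Vector_Spaces.linear_def module_hom_def module_hom_axioms_def by blast+

lemma B_zero_right [simp]: "B x 0 = 0"
  using B_scale_right[of x 0 0] by simp

lemma B_zero_left [simp]: "B 0 x = 0"
  using B_scale_left[of 0 0 x] by simp

lemma B_skew: "B x y = - B y x"
proof -
  have "B (x + y) (x + y) = 0" by (rule B_alt)
  then have "B x y + B y x = 0" unfolding B_add_left B_add_right by (simp add: add.commute)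
  then show ?thesis by (simp add: eq_neg_iff_add_eq_0)
qed

lemma B_minus_right: "B x (- y) = - B x y"
  using B_scale_right[of x "-1" y] by simp

lemma B_minus_left: "B (- x) y = - B x y"
  using B_scale_left[of "-1" x y] by simp

lemmas B_bilinear = B_add_left B_add_right B_scale_left B_scale_right B_minus_left B_minus_right

section \<open>Subspaces and their cardinalities\<close>

lemma span_insert_image: "span (insert b S) = (\<lambda>(k, v). scale k b + v) ` (UNIV \<times> span S)"
proof -
  have "x \<in> (\<lambda>(k, v). scale k b + v) ` (UNIV \<times> span S)" if "x - scale k b \<in> span S" for x k
    using that by (intro image_eqI[of _ _ "(k, x - scale k b)"]) auto
  moreover have "scale k b + v - scale k b \<in> span S" if "v \<in> span S" for v k
    using that by simp
  ultimately show ?thesis unfolding span_insert by fast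
qed

lemma card_span:
  assumes "finite S" "independent S"
  shows "finite (span S) \<and> card (span S) = CARD('a) ^ card S"
  using assms
proof (induction S)
  case empty
  then show ?case by simp
next
  case (insert b S)
  then have ind: "independent S" and b: "b \<notin> span S"
    by (auto simp: independent_insert)
  have inj: "inj_on (\<lambda>(k, v). scale k b + v) (UNIV \<times> span S)"
  proof (rule inj_onI, clarify)
    fix k v l w assume vw: "v \<in> span S" "w \<in> span S" "scale k b + v = scale l b + w"
    have "scale k b = scale l b + w - v" using vw(3) by (simp add: eq_diff_eq)
    then have "scale (k - l) b = w - v" by (simp add: scale_left_diff_distrib)
    then have "scale (k - l) b \<in> span S" using vw span_diff by metis
    then have "k = l"
      using b by (metis left_inverse right_minus_eq scale_one scale_scale span_scale)
    then show "k = l \<and> v = w" using vw by simp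
  qed
  show ?case
    using insert.IH[OF ind] insert.hyps
    by (simp add: span_insert_image card_image[OF inj] card_cartesian_product)
qed

lemma card_subspace:
  assumes "subspace U" "dim U > 0"
  shows "finite U" "card U = CARD('a) ^ dim U"
proof -
  obtain S where S: "S \<subseteq> U" "independent S" "U \<subseteq> span S" "card S = dim U"
    using basis_exists by blast
  then have "U = span S" using assms(1) span_minimal by blast
  moreover have "finite S" using S(4) assms(2) card_ge_0_finite by force
  ultimately show "finite U" "card U = CARD('a) ^ dim U" using card_span S by auto
qed

lemma finite_V: "finite (UNIV :: 'b set)" and card_V: "card (UNIV :: 'b set) = CARD('a) ^ 6"
  using card_subspace[OF subspace_UNIV] dim6 by auto

lemma card_gt_1: "CARD('a) > 1"
proof -
  have "card {0, 1::'a} \<le> CARD('a)" by (rule card_mono) simp_all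
  then show ?thesis by simp
qed

text \<open>Planes are recognised by their number of elements, so that inclusions of planes become
  equalities and injections become bijections by counting.\<close>

lemma dim_eq_3_iff:
  assumes "subspace U"
  shows "dim U = 3 \<longleftrightarrow> card U = CARD('a) ^ 3"
proof
  show "card U = CARD('a) ^ 3" if "dim U = 3" using card_subspace[OF assms] that by simp
  assume c: "card U = CARD('a) ^ 3"
  obtain S where S: "S \<subseteq> U" "independent S" "U \<subseteq> span S" "card S = dim U"
    using basis_exists by blast
  have "finite S" using finite_V by (rule finite_subset[rotated]) simp
  moreover have "U = span S" using S(1,3) assms span_minimal by blast
  ultimately have "CARD('a) ^ dim U = CARD('a) ^ 3" using card_span S c by metis
  then show "dim U = 3" using card_gt_1 by (metis power_inject_exp)
qed

abbreviation W :: "'b set set" where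
  "W \<equiv> isotropic_planes scale B"

abbreviation disj :: "'b set \<Rightarrow> 'b set \<Rightarrow> bool" where
  "disj \<equiv> disjoint_subspaces"

lemma W_iff: "U \<in> W \<longleftrightarrow> subspace U \<and> card U = CARD('a) ^ 3 \<and> (\<forall>x\<in>U. \<forall>y\<in>U. B x y = 0)"
  unfolding isotropic_planes_def using dim_eq_3_iff by auto

text \<open>A symplectic basis, presented as the isometry from coordinate pairs: \<open>x\<close>
  holds the coordinates along e_1, e_2, e_3 and \<open>y\<close> those along f_1, f_2, f_3.
  Bijectivity follows, since the standard form is nondegenerate and the dimensions agree.\<close>

definition frame :: "('a^3 \<Rightarrow> 'a^3 \<Rightarrow> 'b) \<Rightarrow> bool" where
  "frame P \<longleftrightarrow> (\<forall>x y x' y'. P (x + x') (y + y') = P x y + P x' y') \<and>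
     (\<forall>c x y. P (c *s x) (c *s y) = scale c (P x y)) \<and>
     (\<forall>x y x' y'. B (P x y) (P x' y') = dot x y' - dot y x')"

text \<open>Symplectic Gram-Schmidt. The invariant \<open>proj\<close> says that the span of
  \<open>L\<close> together with its orthogonal space fills everything. The bound on
  \<open>card L\<close> gives a vector outside the span; its orthogonal correction is
  \<open>e\<close>, and nondegeneracy provides the partner \<open>f\<close>.\<close>

lemma hyperbolic_extend:
  assumes "finite L" "card L < 6" and proj: "\<And>v. \<exists>u\<in>span L. \<forall>l\<in>L. B (v + u) l = 0"
  obtains e f where "B e f = 1" "\<forall>l\<in>L. B e l = 0" "\<forall>l\<in>L. B f l = 0"
    "\<And>v. \<exists>u\<in>span (L \<union> {e, f}). \<forall>l\<in>L \<union> {e, f}. B (v + u) l = 0"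
proof -
  have "span L \<noteq> UNIV"
    using dim_le_card[of UNIV L] assms(1,2) dim6 by auto
  then obtain v where v: "v \<notin> span L" by blast
  obtain u where u: "u \<in> span L" "\<forall>l\<in>L. B (v + u) l = 0" using proj by blast
  define e where "e = v + u"
  have eL: "\<forall>l\<in>L. B e l = 0" using u by (simp add: e_def)
  have "e \<noteq> 0" using v u(1) by (metis add_eq_0_iff2 e_def span_neg)
  then obtain w where w: "B e w \<noteq> 0" using nondeg unfolding nondegenerate_def by blast
  obtain u' where u': "u' \<in> span L" "\<forall>l\<in>L. B (w + u') l = 0" using proj by blast
  have orth: "B x s = 0" if "s \<in> span L" "\<forall>l\<in>L. B x l = 0" for x s
    using that(1) by (induction s rule: span_induct_alt) (use that(2) in \<open>auto simp: B_bilinear\<close>)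
  have w': "B e (w + u') = B e w" using orth[OF u'(1) eL] by (simp add: B_add_right)
  define f where "f = scale (1 / B e w) (w + u')"
  have fL: "\<forall>l\<in>L. B f l = 0" using u'(2) by (simp add: f_def B_scale_left)
  have ef: "B e f = 1" using w w' by (simp add: f_def B_scale_right)
  show ?thesis
  proof (rule that[OF ef eL fL])
    fix v
    obtain u where u: "u \<in> span L" "\<forall>l\<in>L. B (v + u) l = 0" using proj by blast
    \<comment> \<open>The multiples of \<open>f\<close> and \<open>e\<close> cancel the values of
      \<open>v + u\<close> against \<open>e\<close> and \<open>f\<close>, and leave those against
      \<open>L\<close> at zero.\<close>
    define z where "z = u + (scale (B (v + u) e) f - scale (B (v + u) f) e)"
    have "span L \<subseteq> span (L \<union> {e, f})" by (rule span_mono) blast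
    then have "z \<in> span (L \<union> {e, f})"
      using u(1) unfolding z_def
      by (intro span_add span_diff span_scale) (auto intro: span_base)
    moreover have "B (v + z) l = 0" if "l \<in> L \<union> {e, f}" for l
    proof -
      have vz: "v + z = (v + u) + scale (B (v + u) e) f + scale (- B (v + u) f) e"
        by (simp add: z_def)
      show ?thesis using that u(2) eL fL ef B_skew[of f e] unfolding vz by (auto simp: B_add_left B_scale_left)
    qed
    ultimately show "\<exists>u\<in>span (L \<union> {e, f}). \<forall>l\<in>L \<union> {e, f}. B (v + u) l = 0" by blast
  qed
qed

lemma ex_frame: "\<exists>P. frame P"
proof -
  obtain e1 f1 where 1: "B e1 f1 = 1"
    "\<And>v. \<exists>u\<in>span {e1, f1}. \<forall>l\<in>{e1, f1}. B (v + u) l = 0"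
    by (rule hyperbolic_extend[of "{}"]) auto
  have c1: "card {e1, f1} < 6" by (simp add: card_insert_if)
  obtain e2 f2 where 2: "B e2 f2 = 1" "\<forall>l\<in>{e1, f1}. B e2 l = 0" "\<forall>l\<in>{e1, f1}. B f2 l = 0"
    "\<And>v. \<exists>u\<in>span ({e1, f1} \<union> {e2, f2}). \<forall>l\<in>{e1, f1} \<union> {e2, f2}. B (v + u) l = 0"
    by (rule hyperbolic_extend[OF _ c1 1(2)]) auto
  have c2: "card ({e1, f1} \<union> {e2, f2}) < 6" by (simp add: card_insert_if)
  obtain e3 f3 where 3: "B e3 f3 = 1" "\<forall>l\<in>{e1, f1} \<union> {e2, f2}. B e3 l = 0"
    "\<forall>l\<in>{e1, f1} \<union> {e2, f2}. B f3 l = 0"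
    by (rule hyperbolic_extend[OF _ c2 2(4)]) auto
  define P where "P x y = scale (x$1) e1 + scale (x$2) e2 + scale (x$3) e3 +
    (scale (y$1) f1 + scale (y$2) f2 + scale (y$3) f3)" for x y :: "'a^3"
  have gram: "B e2 e1 = 0" "B e3 e1 = 0" "B e3 e2 = 0" "B f2 f1 = 0" "B f3 f1 = 0" "B f3 f2 = 0"
    "B f2 e1 = 0" "B f3 e1 = 0" "B e2 f1 = 0" "B f3 e2 = 0" "B e3 f1 = 0" "B e3 f2 = 0"
    using 2(2,3) 3(2,3) by simp_all
  have gram': "B e1 e2 = 0" "B e1 e3 = 0" "B e2 e3 = 0" "B f1 f2 = 0" "B f1 f3 = 0" "B f2 f3 = 0"
    "B e1 f2 = 0" "B e1 f3 = 0" "B f1 e2 = 0" "B e2 f3 = 0" "B f1 e3 = 0" "B f2 e3 = 0"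
    "B f1 e1 = -1" "B f2 e2 = -1" "B f3 e3 = -1"
    using gram 1(1) 2(1) 3(1) B_skew[of e1 e2] B_skew[of e1 e3] B_skew[of e2 e3]
      B_skew[of f1 f2] B_skew[of f1 f3] B_skew[of f2 f3] B_skew[of e1 f2] B_skew[of e1 f3]
      B_skew[of f1 e2] B_skew[of e2 f3] B_skew[of f1 e3] B_skew[of f2 e3]
      B_skew[of f1 e1] B_skew[of f2 e2] B_skew[of f3 e3]
    by (simp_all only: minus_zero)
  have "frame P"
    unfolding frame_def
  proof (intro conjI allI)
    fix x y x' y' :: "'a^3" and c
    show "P (x + x') (y + y') = P x y + P x' y'"
      by (simp add: P_def scale_left_distrib algebra_simps)
    show "P (c *s x) (c *s y) = scale c (P x y)"
      by (simp add: P_def scale_right_distrib)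
    show "B (P x y) (P x' y') = dot x y' - dot y x'"
      by (simp add: P_def B_bilinear gram gram' 1(1) 2(1) 3(1) dot_def)
  qed
  then show ?thesis by blast
qed

end

text \<open>The columns of the 6x3 matrix with blocks \<open>A\<close>, \<open>C\<close> form a
  basis of a totally isotropic plane: the first clause says that \<open>transpose A ** C\<close> is
  symmetric, the second that the columns are independent.\<close>

definition lagrangian :: "'a::field^3^3 \<Rightarrow> 'a^3^3 \<Rightarrow> bool" where
  "lagrangian A C \<longleftrightarrow> (\<forall>z w. dot (A *v z) (C *v w) = dot (C *v z) (A *v w)) \<and>
     (\<forall>z. A *v z = 0 \<longrightarrow> C *v z = 0 \<longrightarrow> z = 0)"

lemma lagrangian_graph: "S \<in> Sym \<Longrightarrow> lagrangian S (mat 1)"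
  and lagrangian_cograph: "S \<in> Sym \<Longrightarrow> lagrangian (mat 1) S"
  using Sym_dot[of S] by (auto simp: lagrangian_def)

context symplectic_space6
begin

lemma W_subspace: "U \<in> W \<Longrightarrow> subspace U"
  and W_card: "U \<in> W \<Longrightarrow> card U = CARD('a) ^ 3"
  and W_isotropic: "U \<in> W \<Longrightarrow> x \<in> U \<Longrightarrow> y \<in> U \<Longrightarrow> B x y = 0"
  by (auto simp: W_iff)

lemma W_zero: "U \<in> W \<Longrightarrow> 0 \<in> U"
  using W_subspace subspace_0 by blast

lemma finite_subset_V: "finite (U :: 'b set)"
  using finite_V by (rule finite_subset[rotated]) simp

lemma W_eqI: "U \<in> W \<Longrightarrow> U' \<in> W \<Longrightarrow> U \<subseteq> U' \<Longrightarrow> U = U'"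
  using card_subset_eq[OF finite_subset_V] W_card by metis

context
  fixes P assumes P: "frame P"
begin

lemma frame_add: "P (x + x') (y + y') = P x y + P x' y'"
  and frame_scale: "P (c *s x) (c *s y) = scale c (P x y)"
  and frame_form: "B (P x y) (P x' y') = dot x y' - dot y x'"
  using P unfolding frame_def by blast+

lemma frame_zero [simp]: "P 0 0 = 0"
  using frame_scale[of 0 0 0] by simp

lemma frame_minus: "P (- x) (- y) = - P x y"
  using frame_add[of x "- x" y "- y"] by (simp add: eq_neg_iff_add_eq_0 add.commute)

lemma frame_diff: "P (x - x') (y - y') = P x y - P x' y'"
  using frame_add[of x "- x'" y "- y'"] by (simp add: frame_minus)

lemma frame_eq_0_iff: "P x y = 0 \<longleftrightarrow> x = 0 \<and> y = 0"
proof
  assume 0: "P x y = 0"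
  have "dot x y' = 0" for y' using frame_form[of x y 0 y'] 0 by simp
  moreover have "dot y x' = 0" for x' using frame_form[of x y x' 0] 0 by simp
  ultimately show "x = 0 \<and> y = 0" using dot_eq_0 by blast
qed simp

lemma frame_eq_iff: "P x y = P x' y' \<longleftrightarrow> x = x' \<and> y = y'"
  using frame_eq_0_iff[of "x - x'" "y - y'"] by (simp add: frame_diff)

lemma frame_bij: "bij (\<lambda>(x, y). P x y)"
proof -
  have inj: "inj (\<lambda>(x, y). P x y)" by (auto simp: inj_def frame_eq_iff)
  have "card (range (\<lambda>(x, y). P x y)) = card (UNIV :: 'b set)"
    by (simp add: card_image[OF inj] card_V power_numeral_reduce)
  then have "range (\<lambda>(x, y). P x y) = UNIV"
    by (intro card_subset_eq finite_V) auto
  with inj show ?thesis by (simp add: bij_def)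
qed

lemma frame_surj: obtains x y where "v = P x y"
  using frame_bij by (metis bij_pointE case_prod_conv surj_pair)

end

definition plane :: "('a^3 \<Rightarrow> 'a^3 \<Rightarrow> 'b) \<Rightarrow> 'a^3^3 \<Rightarrow> 'a^3^3 \<Rightarrow> 'b set" where
  "plane P A C = range (\<lambda>z. P (A *v z) (C *v z))"

lemma plane_in_W:
  assumes P: "frame P" and L: "lagrangian A C"
  shows "plane P A C \<in> W"
proof -
  have "subspace (plane P A C)"
  proof (rule subspaceI)
    show "0 \<in> plane P A C"
      unfolding plane_def by (rule image_eqI[of _ _ 0]) (simp_all add: frame_zero[OF P])
    show "x + y \<in> plane P A C" if xy: "x \<in> plane P A C" "y \<in> plane P A C" for x y
    proof -
      obtain z w where "x = P (A *v z) (C *v z)" "y = P (A *v w) (C *v w)"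
        using xy unfolding plane_def by blast
      then have "x + y = P (A *v (z + w)) (C *v (z + w))"
        by (simp add: frame_add[OF P] matrix_vector_right_distrib)
      then show ?thesis unfolding plane_def by blast
    qed
    show "scale c x \<in> plane P A C" if x: "x \<in> plane P A C" for c x
    proof -
      obtain z where "x = P (A *v z) (C *v z)" using x unfolding plane_def by blast
      then have "scale c x = P (A *v (c *s z)) (C *v (c *s z))"
        by (simp add: frame_scale[OF P] vector_scalar_commute)
      then show ?thesis unfolding plane_def by blast
    qed
  qed
  moreover have "card (plane P A C) = CARD('a) ^ 3"
  proof -
    have "inj (\<lambda>z. P (A *v z) (C *v z))"
    proof (rule injI)
      fix z w assume "P (A *v z) (C *v z) = P (A *v w) (C *v w)"
      then have "A *v (z - w) = 0" "C *v (z - w) = 0"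
        by (simp_all add: frame_eq_iff[OF P] matrix_vector_mult_diff_distrib)
      then have "z - w = 0" using L unfolding lagrangian_def by blast
      then show "z = w" by simp
    qed
    then show ?thesis unfolding plane_def by (simp add: card_image)
  qed
  moreover have "B x y = 0" if xy: "x \<in> plane P A C" "y \<in> plane P A C" for x y
  proof -
    obtain z w where "x = P (A *v z) (C *v z)" "y = P (A *v w) (C *v w)"
      using xy unfolding plane_def by blast
    then show ?thesis using L by (simp add: frame_form[OF P] lagrangian_def)
  qed
  ultimately show ?thesis by (simp add: W_iff)
qed

section \<open>Symplectic changes of coordinates\<close>

lemma frame_transform:
  assumes P: "frame P"
    and form: "\<And>x y x' y'. dot (A *v x + C *v y) (D *v x' + E *v y') -
      dot (D *v x + E *v y) (A *v x' + C *v y') = dot x y' - dot y x'"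
  shows "frame (\<lambda>x y. P (A *v x + C *v y) (D *v x + E *v y))"
  unfolding frame_def
proof (intro conjI allI)
  fix x y x' y' :: "'a^3" and c
  have add: "A *v (x + x') + C *v (y + y') = (A *v x + C *v y) + (A *v x' + C *v y')"
    for A C :: "'a^3^3"
    by (simp add: matrix_vector_right_distrib)
  show "P (A *v (x + x') + C *v (y + y')) (D *v (x + x') + E *v (y + y')) =
      P (A *v x + C *v y) (D *v x + E *v y) + P (A *v x' + C *v y') (D *v x' + E *v y')"
    unfolding add by (rule frame_add[OF P])
  have scale: "A *v (c *s x) + C *v (c *s y) = c *s (A *v x + C *v y)" for A C :: "'a^3^3"
    by (simp add: vector_scalar_commute vector_add_ldistrib)
  show "P (A *v (c *s x) + C *v (c *s y)) (D *v (c *s x) + E *v (c *s y)) =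
      scale c (P (A *v x + C *v y) (D *v x + E *v y))"
    unfolding scale by (rule frame_scale[OF P])
  show "B (P (A *v x + C *v y) (D *v x + E *v y)) (P (A *v x' + C *v y') (D *v x' + E *v y')) =
      dot x y' - dot y x'"
    by (simp add: frame_form[OF P] form)
qed

lemma frame_shear_left:
  assumes "frame P" "S \<in> Sym"
  shows "frame (\<lambda>x y. P (x + S *v y) y)"
  using frame_transform[OF assms(1), of "mat 1" S 0 "mat 1"] Sym_dot[OF assms(2)]
  by (simp add: dot_add_left dot_add_right)

lemma frame_shear_right:
  assumes "frame P" "S \<in> Sym"
  shows "frame (\<lambda>x y. P x (y + S *v x))"
  using frame_transform[OF assms(1), of "mat 1" 0 S "mat 1"] Sym_dot[OF assms(2)]
  by (simp add: dot_add_left dot_add_right add.commute)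

lemma frame_rotate:
  assumes "frame P"
  shows "frame (\<lambda>x y. P (- y) x)"
proof -
  have "(- mat 1) *v y = - y" for y :: "'a^3"
    using matrix_vector_mult_diff_rdistrib[of 0 "mat 1" y] by simp
  then show ?thesis
    using frame_transform[OF assms, of 0 "- mat 1" "mat 1" 0] by (simp add: dot_def algebra_simps)
qed

lemma frame_congruence:
  assumes "frame P" "transpose G ** H = mat 1"
  shows "frame (\<lambda>x y. P (G *v x) (H *v y))"
proof -
  have "dot (G *v x) (H *v y) = dot x y" for x y
    using assms(2) by (simp add: dot_matrix_left matrix_vector_mul_assoc)
  moreover from this have "dot (H *v y) (G *v x) = dot y x" for x y by (metis dot_commute)
  ultimately show ?thesis using frame_transform[OF assms(1), of G 0 0 H] by simp
qed

text \<open>Two elements of \<open>U\<close> with nonzero components along \<open>g\<close> and \<open>h\<close> would not be orthogonal.\<close>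

lemma greedy_step:
  assumes U: "U \<in> W" and X: "\<And>v w. v \<in> X \<Longrightarrow> w \<in> X \<Longrightarrow> B v w = 0"
    and XU: "X \<inter> U \<subseteq> {0}"
    and gh: "B g h \<noteq> 0" "\<And>v. v \<in> X \<Longrightarrow> B v g = 0" "\<And>v. v \<in> X \<Longrightarrow> B v h = 0"
  obtains x where "x = g \<or> x = h" "\<And>v c. v \<in> X \<Longrightarrow> v + scale c x \<in> U \<Longrightarrow> v = 0 \<and> c = 0"
proof -
  have *: "c \<noteq> 0" if "v \<in> X" "v + scale c x \<in> U" "\<not> (v = 0 \<and> c = 0)" for v c x
    using that XU by auto
  have "(\<forall>v c. v \<in> X \<longrightarrow> v + scale c g \<in> U \<longrightarrow> v = 0 \<and> c = 0) \<or>
    (\<forall>v c. v \<in> X \<longrightarrow> v + scale c h \<in> U \<longrightarrow> v = 0 \<and> c = 0)"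
  proof (rule ccontr)
    assume "\<not> ?thesis"
    then obtain v c w d where vc: "v \<in> X" "v + scale c g \<in> U" "\<not> (v = 0 \<and> c = 0)"
      and wd: "w \<in> X" "w + scale d h \<in> U" "\<not> (w = 0 \<and> d = 0)" by blast
    have "B (v + scale c g) (w + scale d h) = c * d * B g h"
      using X[OF vc(1) wd(1)] gh(2)[OF wd(1)] gh(3)[OF vc(1)] B_skew[of g w] by (simp add: B_bilinear)
    then show False using W_isotropic[OF U vc(2) wd(2)] *[OF vc] *[OF wd] gh(1) by simp
  qed
  then show ?thesis using that by blast
qed

text \<open>One vector is taken from each of three mutually orthogonal pairs. At every stage the
  span of the chosen vectors is totally isotropic, orthogonal to the remaining pairs and disjoint
  from \<open>U\<close>, so the next choice is possible. The result is a complement of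
  \<open>U\<close>.\<close>

lemma greedy:
  fixes g h :: "3 \<Rightarrow> 'b"
  assumes U: "U \<in> W" and gh: "\<And>i. B (g i) (h i) \<noteq> 0"
    and orth: "\<And>i j. i \<noteq> j \<Longrightarrow> B (g i) (g j) = 0" "\<And>i j. i \<noteq> j \<Longrightarrow> B (g i) (h j) = 0"
      "\<And>i j. i \<noteq> j \<Longrightarrow> B (h i) (h j) = 0"
  obtains x where "\<forall>i. x i = g i \<or> x i = h i"
    "\<And>a b c. scale a (x 1) + scale b (x 2) + scale c (x 3) \<in> U \<Longrightarrow> a = 0 \<and> b = 0 \<and> c = 0"
proof -
  have orth': "B (h i) (g j) = 0" if "i \<noteq> j" for i j
    using B_skew[of "h i" "g j"] orth(2)[of j i] that by simp
  obtain x1 where x1: "x1 = (g 1) \<or> x1 = (h 1)" "\<And>c. scale c x1 \<in> U \<Longrightarrow> c = 0"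
    by (rule greedy_step[OF U, of "{0}" "g 1" "h 1"]) (use gh in auto)
  have o1: "B x1 (g 2) = 0" "B x1 (h 2) = 0" "B x1 (g 3) = 0" "B x1 (h 3) = 0"
    using x1(1) orth orth' by auto
  obtain x2 where x2: "x2 = (g 2) \<or> x2 = (h 2)"
    "\<And>v c. v \<in> range (\<lambda>a. scale a x1) \<Longrightarrow> v + scale c x2 \<in> U \<Longrightarrow> v = 0 \<and> c = 0"
  proof (rule greedy_step[OF U, of "range (\<lambda>a. scale a x1)" "g 2" "h 2"])
    show "range (\<lambda>a. scale a x1) \<inter> U \<subseteq> {0}" using x1(2) by auto
    show "B v (g 2) = 0" "B v (h 2) = 0" if "v \<in> range (\<lambda>a. scale a x1)" for v
      using that by (auto simp: B_scale_left o1)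
  qed (use gh in \<open>auto simp: B_scale_left B_scale_right\<close>)
  let ?X = "range (\<lambda>(a, b). scale a x1 + scale b x2)"
  have o2: "B x2 (g 3) = 0" "B x2 (h 3) = 0" using x2(1) orth orth' by auto
  have x12: "B x1 x2 = 0" "B x2 x1 = 0" using o1 x2(1) B_skew[of x2 x1] by auto
  obtain x3 where x3: "x3 = (g 3) \<or> x3 = (h 3)"
    "\<And>v c. v \<in> ?X \<Longrightarrow> v + scale c x3 \<in> U \<Longrightarrow> v = 0 \<and> c = 0"
  proof (rule greedy_step[OF U, of ?X "g 3" "h 3"])
    have "scale a x1 + scale b x2 = 0" if "scale a x1 + scale b x2 \<in> U" for a b
      using x2(2)[OF rangeI that] by simp
    then show "?X \<inter> U \<subseteq> {0}" by auto
    show "B v (g 3) = 0" "B v (h 3) = 0" if "v \<in> ?X" for v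
      using that by (auto simp: B_add_left B_scale_left o1 o2)
  qed (use gh in \<open>auto simp: B_add_left B_add_right B_scale_left B_scale_right x12\<close>)
  have "a = 0 \<and> b = 0 \<and> c = 0" if abc: "scale a x1 + scale b x2 + scale c x3 \<in> U" for a b c
  proof -
    have 3: "scale a x1 + scale b x2 = 0 \<and> c = 0"
      by (rule x3(2)) (use abc in auto)
    then have "scale a x1 + scale b x2 \<in> U" using W_zero[OF U] by simp
    then have 2: "scale a x1 = 0" "b = 0" using x2(2)[OF rangeI, of a b] by blast+
    have "scale a x1 \<in> U" unfolding 2(1) by (rule W_zero[OF U])
    then show ?thesis using x1(2) 2(2) 3 by blast
  qed
  moreover define x where "x i = (if i = 1 then x1 else if i = 2 then x2 else x3)" for i :: 3
  moreover have "\<forall>i. x i = g i \<or> x i = h i"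
  proof
    fix i show "x i = g i \<or> x i = h i"
      using x1(1) x2(1) x3(1) exhaust_3[of i] by (auto simp: x_def)
  qed
  ultimately show ?thesis using that[of x] by simp
qed

end

lemma vec3_sum: "x = x$1 *s axis 1 1 + x$2 *s axis 2 1 + x$3 *s axis 3 (1::'a)" for x :: "'a::field^3"
  by (simp add: vec_eq_iff forall_3 axis_def)

context symplectic_space6
begin

lemma frame_sum3:
  assumes P: "frame P"
  shows "P (a *s x1 + b *s x2 + c *s x3) (a *s y1 + b *s y2 + c *s y3) =
    scale a (P x1 y1) + scale b (P x2 y2) + scale c (P x3 y3)"
  by (simp add: frame_add[OF P] frame_scale[OF P])

text \<open>Greedy choice between \<open>f\<^sub>i\<close> and \<open>f\<^sub>i + e\<^sub>i\<close>.\<close>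

lemma ex_disjoint_graph:
  assumes P: "frame P" and U: "U \<in> W"
  obtains S where "S \<in> Sym" "plane P S (mat 1) \<inter> U = {0}"
proof -
  let ?a = "\<lambda>i. axis i 1 :: 'a^3"
  obtain x where x: "\<forall>i. x i = P 0 (?a i) \<or> x i = P (?a i) (?a i)"
    and ind: "\<And>a b c. scale a (x 1) + scale b (x 2) + scale c (x 3) \<in> U \<Longrightarrow> a = 0 \<and> b = 0 \<and> c = 0"
    by (rule greedy[OF U, of "\<lambda>i. P 0 (?a i)" "\<lambda>i. P (?a i) (?a i)"])
      (simp_all add: frame_form[OF P] dot_axis)
  have "\<exists>d. x i = P (d *s ?a i) (?a i)" for i
    using x[rule_format, of i] by (metis vector_smult_lzero vector_smult_lid)
  then obtain d where d: "x i = P (d i *s ?a i) (?a i)" for i by metis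
  define S where "S = sym_mat ((d 1, d 2, 0), (d 3, 0, 0))"
  have eq: "P (S *v z) z = scale (z$1) (x 1) + scale (z$2) (x 2) + scale (z$3) (x 3)" for z
  proof -
    have "S *v z = z$1 *s (d 1 *s ?a 1) + z$2 *s (d 2 *s ?a 2) + z$3 *s (d 3 *s ?a 3)"
      unfolding S_def sym_mat_vec by (simp add: vec_eq_iff forall_3 axis_def mult.commute)
    then have "P (S *v z) z = P (z$1 *s (d 1 *s ?a 1) + z$2 *s (d 2 *s ?a 2) + z$3 *s (d 3 *s ?a 3))
      (z$1 *s ?a 1 + z$2 *s ?a 2 + z$3 *s ?a 3)" using vec3_sum[of z] by simp
    then show ?thesis by (simp only: frame_sum3[OF P] d)
  qed
  have "plane P S (mat 1) \<inter> U = {0}"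
  proof (intro equalityI subsetI)
    fix u assume "u \<in> plane P S (mat 1) \<inter> U"
    then obtain z where z: "u = P (S *v z) z" "u \<in> U" by (auto simp: plane_def)
    then have "z$1 = 0 \<and> z$2 = 0 \<and> z$3 = 0" using eq ind by metis
    then show "u \<in> {0}" using z eq by simp
  next
    fix u :: 'b assume "u \<in> {0}"
    moreover have "0 \<in> plane P S (mat 1)"
      unfolding plane_def by (rule image_eqI[of _ _ 0]) (simp_all add: frame_zero[OF P])
    ultimately show "u \<in> plane P S (mat 1) \<inter> U" using W_zero[OF U] by simp
  qed
  then show ?thesis using that[of S] by (simp only: S_def Sym_sym_mat)
qed

text \<open>Disjointness from the plane of the \<open>y\<close> coordinates makes the projection of
  \<open>U\<close> to the \<open>x\<close> coordinates injective, hence bijective by counting. So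
  \<open>U\<close> is the graph of a linear map, and isotropy makes the matrix of this map
  symmetric.\<close>

lemma ex_cograph:
  assumes P: "frame P" and U: "U \<in> W" and disj: "plane P 0 (mat 1) \<inter> U = {0}"
  obtains T where "T \<in> Sym" "U = plane P (mat 1) T"
proof -
  note sub = W_subspace[OF U]
  have inj: "y = y'" if "P x y \<in> U" "P x y' \<in> U" for x y y'
  proof -
    have "P 0 (y - y') \<in> U"
      using subspace_diff[OF sub that] frame_diff[OF P, of x x y y'] by simp
    moreover have "P 0 (y - y') \<in> plane P 0 (mat 1)" by (auto simp: plane_def)
    ultimately have "P 0 (y - y') = 0" using disj by blast
    then show ?thesis by (simp add: frame_eq_0_iff[OF P])
  qed
  define pr where "pr u = (THE x. \<exists>y. u = P x y)" for u
  have pr: "pr (P x y) = x" for x y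
    unfolding pr_def by (rule the_equality) (auto simp: frame_eq_iff[OF P])
  have "inj_on pr U"
  proof (rule inj_onI)
    fix u w assume uw: "u \<in> U" "w \<in> U" "pr u = pr w"
    obtain x y where u: "u = P x y" using frame_surj[OF P] by blast
    obtain x' y' where w: "w = P x' y'" using frame_surj[OF P] by blast
    show "u = w" using uw inj[of x y y'] unfolding u w pr by blast
  qed
  then have "card (pr ` U) = CARD('a^3)" by (simp add: card_image W_card[OF U])
  then have "pr ` U = UNIV" by (intro card_subset_eq) simp_all
  then have "\<exists>y. P x y \<in> U" for x
  proof -
    obtain u where "u \<in> U" "pr u = x" using \<open>pr ` U = UNIV\<close> by (metis UNIV_I imageE)
    moreover obtain x' y' where "u = P x' y'" using frame_surj[OF P] by blast
    ultimately show ?thesis using pr by auto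
  qed
  \<comment> \<open>\<open>t\<close> is chosen pointwise. The matrix uses only its values on the
    basis vectors, and closure of \<open>U\<close> under linear combinations does the rest.\<close>
  then obtain t where t: "P x (t x) \<in> U" for x by metis
  define T :: "'a^3^3" where "T = transpose (vector [t (axis 1 1), t (axis 2 1), t (axis 3 1)])"
  have T: "T *v z = z$1 *s t (axis 1 1) + z$2 *s t (axis 2 1) + z$3 *s t (axis 3 1)" for z
    unfolding T_def by (rule columns_vec)
  have TU: "P z (T *v z) \<in> U" for z
  proof -
    have "P z (T *v z) = P (z$1 *s axis 1 1 + z$2 *s axis 2 1 + z$3 *s axis 3 1)
      (z$1 *s t (axis 1 1) + z$2 *s t (axis 2 1) + z$3 *s t (axis 3 1))"
      using vec3_sum[of z] by (simp add: T)
    then show ?thesis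
      using t by (auto simp: frame_sum3[OF P] intro!: subspace_add[OF sub] subspace_scale[OF sub])
  qed
  have "T \<in> Sym"
  proof (rule SymI_dot)
    fix x y show "dot (T *v x) y = dot x (T *v y)"
      using W_isotropic[OF U TU[of x] TU[of y]] by (simp add: frame_form[OF P])
  qed
  moreover have "plane P (mat 1) T = U"
    by (rule W_eqI[OF plane_in_W[OF P lagrangian_cograph[OF \<open>T \<in> Sym\<close>]] U])
      (use TU in \<open>auto simp: plane_def\<close>)
  ultimately show ?thesis using that by blast
qed

section \<open>Normal form of a pair of planes\<close>

lemma plane_shear_left: "plane (\<lambda>x y. P (x + S *v y) y) A C = plane P (A + S ** C) C"
  by (simp add: plane_def matrix_vector_mult_add_rdistrib matrix_vector_mul_assoc)

lemma plane_shear_right: "plane (\<lambda>x y. P x (y + S *v x)) A C = plane P A (C + S ** A)"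
  by (simp add: plane_def matrix_vector_mult_add_rdistrib matrix_vector_mul_assoc)

lemma plane_congruence: "plane (\<lambda>x y. P (G *v x) (H *v y)) A C = plane P (G ** A) (H ** C)"
  by (simp add: plane_def matrix_vector_mul_assoc)

lemma plane_reparametrize:
  assumes "G ** H = mat 1"
  shows "plane P (A ** G) (C ** G) = plane P A C"
proof -
  have "P ((A ** G) *v w) ((C ** G) *v w) \<in> range (\<lambda>z. P (A *v z) (C *v z))" for w
    by (rule image_eqI[of _ _ "G *v w"]) (simp_all add: matrix_vector_mul_assoc)
  moreover have "P (A *v z) (C *v z) \<in> range (\<lambda>w. P ((A ** G) *v w) ((C ** G) *v w))" for z
    by (rule image_eqI[of _ _ "H *v z"])
      (simp_all add: matrix_vector_mul_assoc assms flip: matrix_mul_assoc)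
  ultimately show ?thesis unfolding plane_def by blast
qed

lemma matrix_zero_mul [simp]: "(0 :: 'a^3^3) ** A = 0" "A ** (0 :: 'a^3^3) = 0" for A :: "'a^3^3"
  by (simp_all add: matrix_matrix_mult_def vec_eq_iff)

text \<open>A left shear fixes the plane of the \<open>x\<close> coordinates and takes any
  prescribed graph as the new plane of the \<open>y\<close> coordinates. With a graph disjoint from
  \<open>U\<close>, the plane \<open>U\<close> becomes a cograph.\<close>

lemma ex_frame_cograph:
  assumes P: "frame P" and U: "U \<in> W"
  obtains P' T where "frame P'" "T \<in> Sym" "plane P' (mat 1) 0 = plane P (mat 1) 0"
    "U = plane P' (mat 1) T"
proof -
  obtain S where S: "S \<in> Sym" "plane P S (mat 1) \<inter> U = {0}" using ex_disjoint_graph[OF P U] .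
  let ?P = "\<lambda>x y. P (x + S *v y) y"
  have P': "frame ?P" by (rule frame_shear_left[OF P S(1)])
  have "plane ?P 0 (mat 1) \<inter> U = {0}" using S(2) by (simp add: plane_shear_left)
  then obtain T where T: "T \<in> Sym" "U = plane ?P (mat 1) T" using ex_cograph[OF P' U] by blast
  show ?thesis by (rule that[OF P' T(1) _ T(2)]) (simp add: plane_shear_left)
qed

lemma ex_frame_at:
  assumes "U \<in> W"
  obtains P where "frame P" "U = plane P (mat 1) 0"
proof -
  obtain P0 where P0: "frame P0" using ex_frame by blast
  obtain P T where P: "frame P" "T \<in> Sym" "U = plane P (mat 1) T"
    using ex_frame_cograph[OF P0 assms] by metis
  show ?thesis
    by (rule that[OF frame_shear_right[OF P(1,2)]]) (simp add: plane_shear_right P(3))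
qed

text \<open>Spanned by f_i for i \<le> r and e_i for i > r; for r \<le> 3 it meets
  \<open>std P 0\<close> in dimension 3 - r.\<close>

definition std :: "('a^3 \<Rightarrow> 'a^3 \<Rightarrow> 'b) \<Rightarrow> nat \<Rightarrow> 'b set" where
  "std P r = plane P (mat 1 - proj r) (proj r)"

lemma proj_idem: "proj r ** proj r = (proj r :: 'a^3^3)"
  by (simp add: proj_def matrix_matrix_mult_def mat3_eq_iff forall_3 sum_3)

lemma lagrangian_std: "lagrangian (mat 1 - proj r) (proj r :: 'a^3^3)"
proof -
  have "dot (proj r *v x) y = dot x (proj r *v y)" for x y :: "'a^3" by (rule Sym_dot[OF Sym_proj])
  moreover have "proj r *v (proj r *v x) = proj r *v x" for x :: "'a^3"
    by (simp add: matrix_vector_mul_assoc proj_idem)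
  ultimately show ?thesis
    by (auto simp: lagrangian_def matrix_vector_mult_diff_rdistrib dot_diff_left dot_diff_right)
qed

lemma std_in_W: "frame P \<Longrightarrow> std P r \<in> W"
  unfolding std_def by (rule plane_in_W[OF _ lagrangian_std])

lemma std_0: "std P 0 = plane P (mat 1) 0"
proof -
  have "proj 0 = (0 :: 'a^3^3)" by (simp add: proj_def mat3_eq_iff forall_3)
  then show ?thesis by (simp add: std_def)
qed

text \<open>Takes the place of Witt's theorem for pairs. A congruence and then a shear along the
  partial inverse \<open>S\<close> turn the cograph of \<open>T\<close> into a coordinate plane, and
  both fix the plane of the \<open>x\<close> coordinates.\<close>

lemma pair_normal_form:
  assumes U: "U \<in> W" and U': "U' \<in> W"
  obtains P r where "frame P" "r \<le> 3" "U = std P 0" "U' = std P r"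
proof -
  obtain P0 where P0: "frame P0" "U = plane P0 (mat 1) 0" using ex_frame_at[OF U] .
  obtain P T where P: "frame P" "T \<in> Sym" "U = plane P (mat 1) 0" "U' = plane P (mat 1) T"
    using ex_frame_cograph[OF P0(1) U'] P0(2) by metis
  obtain G S r where G: "det G \<noteq> 0" "S \<in> Sym" "r \<le> 3"
    "proj r ** S ** (transpose G ** T ** G) = proj r"
    "proj r ** (transpose G ** T ** G) = transpose G ** T ** G"
    using Sym_normal_form[OF P(2)] .
  define T' where "T' = transpose G ** T ** G"
  note G = G(1-3) G(4,5)[folded T'_def]
  obtain K where K: "G ** K = mat 1" "K ** G = mat 1" using inverse_matrices[OF G(1)] by blast
  define H where "H = transpose K"
  have GH: "transpose G ** H = mat 1" "H ** transpose G = mat 1"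
    unfolding H_def by (simp_all add: K flip: matrix_transpose_mul)
  define P1 where "P1 x y = P (G *v x) (H *v y)" for x y
  have P1: "frame P1" unfolding P1_def by (rule frame_congruence[OF P(1) GH(1)])
  have U1: "plane P1 (mat 1) 0 = U"
    unfolding P(3) P1_def plane_congruence using plane_reparametrize[OF K(1), of P "mat 1" 0] by simp
  have "H ** T' = T ** G" unfolding T'_def by (simp add: matrix_mul_assoc GH(2))
  then have U1': "plane P1 (mat 1) T' = U'"
    unfolding P(4) P1_def plane_congruence using plane_reparametrize[OF K(1), of P "mat 1" T] by simp
  define P2 where "P2 x y = P1 (x + S *v y) y" for x y
  have P2: "frame P2" unfolding P2_def by (rule frame_shear_left[OF P1 G(2)])
  have U2: "plane P2 (mat 1) 0 = U" unfolding P2_def plane_shear_left using U1 by simp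
  have "plane P2 (mat 1 - S ** T') T' = U'" unfolding P2_def plane_shear_left using U1' by simp
  \<comment> \<open>One inclusion suffices for planes. The two equations on \<open>S\<close> place
    the components of a vector in the complementary ranges of \<open>mat 1 - proj r\<close> and
    \<open>proj r\<close>.\<close>
  moreover have "plane P2 (mat 1 - S ** T') T' \<subseteq> std P2 r"
  proof
    fix u assume "u \<in> plane P2 (mat 1 - S ** T') T'"
    then obtain z where z: "u = P2 ((mat 1 - S ** T') *v z) (T' *v z)" by (auto simp: plane_def)
    define p t where "p = (mat 1 - S ** T') *v z" and "t = T' *v z"
    have a: "proj r *v t = t" using G(5) by (simp add: t_def matrix_vector_mul_assoc)
    have b: "proj r *v p = 0"
      using G(4) by (simp add: p_def matrix_vector_mult_diff_rdistrib matrix_vector_mult_diff_distrib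
        matrix_vector_mul_assoc matrix_mul_assoc)
    have "u = P2 ((mat 1 - proj r) *v (p + t)) (proj r *v (p + t))"
      unfolding z p_def[symmetric] t_def[symmetric]
      by (simp add: matrix_vector_mult_diff_rdistrib matrix_vector_right_distrib a b)
    then show "u \<in> std P2 r" unfolding std_def plane_def by blast
  qed
  ultimately have "U' = std P2 r" using W_eqI[OF U' std_in_W[OF P2]] by blast
  then show ?thesis using that[OF P2 G(3)] U2 by (simp add: std_0)
qed

text \<open>The matrix is the Gram matrix of the form between the two planes. A kernel vector
  corresponds to a vector of the first plane orthogonal to the second, and the second plane is its
  own orthogonal space.\<close>

lemma disjoint_plane:
  assumes P: "frame P" and L: "lagrangian A C" and L': "lagrangian A' C'"
  shows "disj (plane P A C) (plane P A' C') \<longleftrightarrow>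
    det (transpose A' ** C - transpose C' ** A) \<noteq> 0"
proof -
  let ?U = "plane P A C" and ?U' = "plane P A' C'" and ?M = "transpose A' ** C - transpose C' ** A"
  have U: "?U \<in> W" and U': "?U' \<in> W" using plane_in_W[OF P] L L' by blast+
  have pair: "B (P (A' *v w) (C' *v w)) (P (A *v z) (C *v z)) = dot w (?M *v z)" for w z
    by (simp add: frame_form[OF P] dot_matrix_left matrix_vector_mul_assoc
      matrix_vector_mult_diff_rdistrib dot_diff_right)
  have ker: "?M *v z = 0 \<longleftrightarrow> (\<forall>u\<in>?U'. B u (P (A *v z) (C *v z)) = 0)" for z
    using dot_eq_0[of "?M *v z"] by (auto simp: plane_def pair dot_commute)
  have max: "u \<in> ?U'" if "\<forall>w\<in>?U'. B w u = 0" for u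
  proof -
    obtain P' where P': "frame P'" "?U' = plane P' (mat 1) 0" using ex_frame_at[OF U'] .
    obtain x y where u: "u = P' x y" using frame_surj[OF P'(1)] .
    have "dot y z = 0" for z
    proof -
      have "P' z 0 \<in> ?U'" unfolding P'(2) by (simp add: plane_def)
      then have "B (P' z 0) u = 0" using that by blast
      then show ?thesis by (simp add: u frame_form[OF P'(1)] dot_commute)
    qed
    then have "y = 0" by (rule dot_eq_0)
    then show ?thesis unfolding P'(2) u by (simp add: plane_def)
  qed
  have z0: "P (A *v z) (C *v z) = 0 \<longleftrightarrow> z = 0" for z
    using L by (auto simp: lagrangian_def frame_eq_0_iff[OF P])
  have "disj ?U ?U' \<longleftrightarrow> (\<forall>z. P (A *v z) (C *v z) \<in> ?U' \<longrightarrow> z = 0)"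
    using W_zero[OF U] W_zero[OF U'] z0 by (auto simp: disjoint_subspaces_def plane_def)
  also have "\<dots> \<longleftrightarrow> (\<forall>z. ?M *v z = 0 \<longrightarrow> z = 0)"
    using ker max W_isotropic[OF U'] by blast
  finally show ?thesis using det_nonzero_iff_ker by blast
qed

end

section \<open>Strong regularity\<close>

lemma det_minus3: "det (- A) = - det A" for A :: "'a::comm_ring_1^3^3"
  by (simp add: det_3 algebra_simps)

abbreviation block :: "'a^3^3 \<Rightarrow> 'a \<times> 'a \<times> 'a" where
  "block S \<equiv> (S$1$1, S$2$2, S$1$2)"

text \<open>For \<open>r = 2\<close> the singular blocks are \<open>(a, d * d / a, d)\<close> with
  nonzero \<open>a\<close>, and \<open>(0, b, 0)\<close>: together q^2 of them. For
  \<open>r = 1\<close> the blocks with \<open>a = 0\<close> are equally many.\<close>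

lemma card_minor:
  assumes "r = 1 \<or> r = 2"
  shows "card {z :: 'a::{field,finite} \<times> 'a \<times> 'a. minor r z \<noteq> 0} = CARD('a)^2 * (CARD('a) - 1)"
  using assms
proof
  assume "r = 1"
  then have "{z :: 'a \<times> 'a \<times> 'a. minor r z \<noteq> 0} = {a. a \<noteq> 0} \<times> UNIV" by auto
  then show ?thesis
    by (simp add: card_cartesian_product card_diff_singleton power2_eq_square mult.commute)
next
  assume r: "r = 2"
  let ?q = "CARD('a)"
  let ?N = "{z :: 'a \<times> 'a \<times> 'a. minor r z = 0}"
  have "?N = (\<lambda>(a, d). (a, d * d / a, d)) ` ({a. a \<noteq> 0} \<times> UNIV) \<union> (\<lambda>b. (0, b, 0)) ` UNIV"
    using r by (auto simp: image_iff field_simps)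
  then have "card ?N = card ((\<lambda>(a, d). (a, d * d / a, d)) ` ({a::'a. a \<noteq> 0} \<times> UNIV)) +
      card ((\<lambda>b::'a. (0::'a, b, 0::'a)) ` UNIV)"
    by (simp only:) (rule card_Un_disjoint, auto)
  also have "\<dots> = (?q - 1) * ?q + ?q"
    by (subst (1 2) card_image) (auto simp: inj_on_def card_cartesian_product card_diff_singleton)
  also have "\<dots> = ?q ^ 2"
    using zero_less_card_finite[where 'a='a] by (cases ?q) (auto simp: power2_eq_square)
  finally have N: "card ?N = ?q ^ 2" .
  have "{z :: 'a \<times> 'a \<times> 'a. minor r z \<noteq> 0} = UNIV - ?N" by blast
  then have "card {z :: 'a \<times> 'a \<times> 'a. minor r z \<noteq> 0} = ?q * (?q * ?q) - ?q ^ 2"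
    by (simp add: card_Diff_subset N)
  then show ?thesis by (simp add: power2_eq_square algebra_simps diff_mult_distrib2)
qed

lemma card_minor_shift:
  fixes z0 :: "'a::{field,finite} \<times> 'a \<times> 'a"
  assumes r: "r = 1 \<or> r = 2" and z0: "minor r z0 \<noteq> 0"
  shows "card {z. z \<noteq> 0 \<and> minor r (z + z0) \<noteq> 0} = CARD('a)^2 * (CARD('a) - 1) - 1"
proof -
  have "bij_betw (\<lambda>z. z + z0) {z. z \<noteq> 0 \<and> minor r (z + z0) \<noteq> 0} ({z. minor r z \<noteq> 0} - {z0})"
    by (rule bij_betwI[of _ _ _ "\<lambda>z. z - z0"]) auto
  then have "card {z. z \<noteq> 0 \<and> minor r (z + z0) \<noteq> 0} = card ({z. minor r z \<noteq> 0} - {z0})"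
    by (rule bij_betw_same_card)
  then show ?thesis using z0 card_minor[OF r, where 'a='a] by (simp add: card_Diff_singleton)
qed

text \<open>Passing to the difference with \<open>Z\<close> leaves nonsingular matrices with a
  shifted condition on the leading block. Every admissible block contributes equally, except the
  zero block, which meets the shifted condition but contributes nothing.\<close>

lemma card_common_minor:
  fixes Z :: "'a::{field,finite}^3^3"
  assumes r: "r = 1 \<or> r = 2" and Z: "Z \<in> Sym" "minor r (block Z) \<noteq> 0"
  shows "card {S\<in>Sym. minor r (block S) \<noteq> 0 \<and> det (S - Z) \<noteq> 0} =
    (CARD('a)^2 * (CARD('a) - 1) - 1) * ((CARD('a) - 1) * CARD('a)^2)"
proof -
  have "bij_betw (\<lambda>S. S - Z) {S\<in>Sym. minor r (block S) \<noteq> 0 \<and> det (S - Z) \<noteq> 0}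
      {S\<in>Sym. det S \<noteq> 0 \<and> minor r (block S + block Z) \<noteq> 0}"
    by (rule bij_betwI[of _ _ _ "\<lambda>S. S + Z"]) (auto simp: Sym_add Sym_diff Z(1))
  then have "card {S\<in>Sym. minor r (block S) \<noteq> 0 \<and> det (S - Z) \<noteq> 0} =
      card {S\<in>Sym. det S \<noteq> 0 \<and> minor r (block S + block Z) \<noteq> 0}"
    by (rule bij_betw_same_card)
  then show ?thesis
    using card_det_nonzero_block[of "\<lambda>z. minor r (z + block Z) \<noteq> 0"] card_minor_shift[OF r Z(2)]
    by simp
qed

section \<open>Neighbourhoods in standard position\<close>

context symplectic_space6
begin

abbreviation \<Gamma> :: "'b set \<Rightarrow> 'b set set" where
  "\<Gamma> \<equiv> neighbors W disj"

abbreviation graph :: "('a^3 \<Rightarrow> 'a^3 \<Rightarrow> 'b) \<Rightarrow> 'a^3^3 \<Rightarrow> 'b set" where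
  "graph P S \<equiv> plane P S (mat 1)"

text \<open>The rotated frame exchanges the two coordinate planes, so that \<open>ex_cograph\<close>
  applies; the rotation is responsible for the sign in \<open>- T\<close>.\<close>

lemma neighbors_std_0:
  assumes P: "frame P"
  shows "\<Gamma> (std P 0) = graph P ` Sym"
proof (intro equalityI subsetI)
  fix U assume U: "U \<in> \<Gamma> (std P 0)"
  let ?P = "\<lambda>x y. P (- y) x"
  have "plane ?P 0 (mat 1) = std P 0"
    unfolding std_0 plane_def by (auto simp: image_iff) (metis minus_minus)+
  then have "plane ?P 0 (mat 1) \<inter> U = {0}" and "U \<in> W"
    using U by (simp_all add: neighbors_def disjoint_subspaces_def)
  then obtain T where T: "T \<in> Sym" "U = plane ?P (mat 1) T"
    using ex_cograph[OF frame_rotate[OF P]] by blast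
  have "(- T) *v z = - (T *v z)" for z
    by (simp add: matrix_vector_mult_def vec_eq_iff sum_3)
  then have "U = graph P (- T)" unfolding T(2) plane_def by simp
  then show "U \<in> graph P ` Sym" using Sym_uminus[OF T(1)] by blast
next
  fix U assume "U \<in> graph P ` Sym"
  then obtain S where S: "S \<in> Sym" "U = graph P S" by blast
  have "disj (plane P (mat 1) 0) (graph P S)"
    using disjoint_plane[OF P lagrangian_cograph[OF Sym_0] lagrangian_graph[OF S(1)]]
    by (simp add: det_minus3 transpose_mat)
  then show "U \<in> \<Gamma> (std P 0)"
    using plane_in_W[OF P lagrangian_graph[OF S(1)]] by (simp add: neighbors_def std_0 S(2))
qed

lemma graph_disjoint_graph:
  assumes P: "frame P" and "S \<in> Sym" "T \<in> Sym"
  shows "disj (graph P S) (graph P T) \<longleftrightarrow> det (S - T) \<noteq> 0"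
proof -
  have "det (S - T) = - det (T - S)" using det_minus3[of "T - S"] by simp
  then show ?thesis
    using disjoint_plane[OF P lagrangian_graph[OF assms(2)] lagrangian_graph[OF assms(3)]] assms(3)
    by (simp add: transpose_mat Sym_def)
qed

lemma graph_inj:
  assumes P: "frame P"
  shows "inj (graph P)"
proof (rule injI)
  fix S T assume eq: "graph P S = graph P T"
  have "S *v z = T *v z" for z
  proof -
    have "P (S *v z) z \<in> graph P T" unfolding eq[symmetric] by (auto simp: plane_def)
    then show ?thesis by (auto simp: plane_def frame_eq_iff[OF P])
  qed
  then show "S = T" by (simp add: matrix_eq)
qed

lemma disjoint_commute: "disj U U' \<longleftrightarrow> disj U' U"
  by (simp add: disjoint_subspaces_def Int_commute)

lemma proj_3: "proj 3 = (mat 1 :: 'a^3^3)"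
  by (simp add: proj_def mat3_eq_iff forall_3 mat_def)

lemma std_3: "std P 3 = graph P 0"
  by (simp add: std_def proj_3)

text \<open>The Gram matrix has its first r columns from \<open>S\<close> and the others from minus
  the identity, so up to sign its determinant is the leading minor of order r.\<close>

lemma std_disjoint_graph:
  assumes P: "frame P" and S: "S \<in> Sym" and r: "r = 1 \<or> r = 2"
  shows "disj (std P r) (graph P S) \<longleftrightarrow> minor r (block S) \<noteq> 0"
proof -
  have "disj (std P r) (graph P S) \<longleftrightarrow>
      det (transpose S ** proj r - transpose (mat 1) ** (mat 1 - proj r)) \<noteq> 0"
    unfolding std_def by (rule disjoint_plane[OF P lagrangian_std lagrangian_graph[OF S]])
  also have "transpose S ** proj r - transpose (mat 1) ** (mat 1 - proj r) = S ** proj r + proj r - mat 1"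
    using S by (simp add: Sym_def transpose_mat)
  also have "det (S ** proj r + proj r - mat 1) \<noteq> 0 \<longleftrightarrow> minor r (block S) \<noteq> 0"
    using r
  proof
    assume "r = 1" then show ?thesis
      by (simp add: det_3 matrix_matrix_mult_def sum_3 proj_def mat_def)
  next
    assume "r = 2" then show ?thesis using Sym_entries[OF S]
      by (auto simp: det_3 matrix_matrix_mult_def sum_3 proj_def mat_def)
  qed
  finally show ?thesis .
qed

lemma std_disjoint_iff:
  assumes P: "frame P" and "r \<le> 3"
  shows "disj (std P 0) (std P r) \<longleftrightarrow> r = 3"
proof -
  have "disj (plane P (mat 1) 0) (std P r) \<longleftrightarrow> det (- proj r :: 'a^3^3) \<noteq> 0"
    unfolding std_def disjoint_plane[OF P lagrangian_cograph[OF Sym_0] lagrangian_std]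
    using Sym_proj[of r, where 'a='a] by (simp add: Sym_def)
  moreover have "det (- proj r :: 'a^3^3) \<noteq> 0 \<longleftrightarrow> r = 3"
    using assms(2) by (auto simp: det_3 proj_def)
  ultimately show ?thesis by (simp add: std_0)
qed

lemma std_neq:
  assumes P: "frame P" and "1 \<le> r"
  shows "std P 0 \<noteq> std P r"
proof
  assume "std P 0 = std P r"
  moreover have "P (axis 1 1) 0 \<in> std P 0" by (auto simp: std_0 plane_def)
  ultimately have "P (axis 1 1) 0 \<in> std P r" by simp
  then obtain z where "P (axis 1 1) 0 = P ((mat 1 - proj r) *v z) (proj r *v z)"
    unfolding std_def plane_def by blast
  then have "axis 1 1 = (mat 1 - proj r) *v z" by (simp add: frame_eq_iff[OF P])
  then have "(axis 1 1 :: 'a^3)$1 = ((mat 1 - proj r) *v z)$1" by simp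
  then show False
    using assms(2) by (simp add: axis_def matrix_vector_mult_def sum_3 mat_def proj_def)
qed

lemma card_W_neighbors:
  assumes "U \<in> W"
  shows "card (\<Gamma> U) = CARD('a) ^ 6"
proof -
  obtain P where P: "frame P" "U = std P 0" using ex_frame_at[OF assms] std_0 by metis
  show ?thesis
    unfolding P(2) neighbors_std_0[OF P(1)]
    using card_Sym[where 'a='a] card_image[OF inj_on_subset[OF graph_inj[OF P(1)] subset_UNIV]] by metis
qed

lemma common_neighbors_graphs:
  assumes P: "frame P" and U': "\<And>S. S \<in> Sym \<Longrightarrow> disj U' (graph P S) \<longleftrightarrow> R S"
  shows "\<Gamma> (std P 0) \<inter> \<Gamma> U' = graph P ` {S\<in>Sym. R S}"
proof -
  have "\<Gamma> (std P 0) \<inter> \<Gamma> U' = {V \<in> \<Gamma> (std P 0). disj U' V}"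
    by (auto simp: neighbors_def)
  then show ?thesis unfolding neighbors_std_0[OF P] using U' by auto
qed

lemma common_neighbors_std_3:
  assumes P: "frame P"
  shows "\<Gamma> (std P 0) \<inter> \<Gamma> (std P 3) = graph P ` {S\<in>Sym. det S \<noteq> 0}"
proof (rule common_neighbors_graphs[OF P])
  fix S :: "'a^3^3" assume "S \<in> Sym"
  then show "disj (std P 3) (graph P S) \<longleftrightarrow> det S \<noteq> 0"
    using graph_disjoint_graph[OF P _ Sym_0, of S] disjoint_commute[of "std P 3"] by (simp add: std_3)
qed

lemma common_neighbors_std_12:
  assumes P: "frame P" and r: "r = 1 \<or> r = 2"
  shows "\<Gamma> (std P 0) \<inter> \<Gamma> (std P r) = graph P ` {S\<in>Sym. minor r (block S) \<noteq> 0}"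
  by (rule common_neighbors_graphs[OF P std_disjoint_graph[OF P _ r]])

lemma triple_neighbors:
  assumes P: "frame P" and eq: "\<Gamma> U \<inter> \<Gamma> U' = graph P ` {S\<in>Sym. R S}" and Z: "Z \<in> Sym"
  shows "\<Gamma> U \<inter> \<Gamma> U' \<inter> \<Gamma> (graph P Z) = graph P ` {S\<in>Sym. R S \<and> det (S - Z) \<noteq> 0}"
proof -
  have "\<Gamma> U \<inter> \<Gamma> U' \<inter> \<Gamma> (graph P Z) = {X \<in> \<Gamma> U \<inter> \<Gamma> U'. disj X (graph P Z)}"
    using disjoint_commute by (auto simp: neighbors_def)
  then show ?thesis unfolding eq using graph_disjoint_graph[OF P _ Z] by auto
qed

lemma card_graph_image:
  assumes "frame P"
  shows "card (graph P ` X) = card X"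
  by (rule card_image[OF inj_on_subset[OF graph_inj[OF assms] subset_UNIV]])

lemma adjacent_pair:
  assumes U: "U \<in> W" and U': "U' \<in> W" and adj: "disj U U'"
  obtains P where "frame P" "U = std P 0" "U' = std P 3"
proof -
  obtain P r where P: "frame P" "r \<le> 3" "U = std P 0" "U' = std P r"
    using pair_normal_form[OF U U'] .
  then have "r = 3" using std_disjoint_iff[OF P(1,2)] adj by simp
  then show ?thesis using that P by blast
qed

lemma nonadjacent_pair:
  assumes U: "U \<in> W" and U': "U' \<in> W" and "U \<noteq> U'" "\<not> disj U U'"
  obtains P r where "frame P" "U = std P 0" "U' = std P r" "r = 1 \<or> r = 2"
proof -
  obtain P r where P: "frame P" "r \<le> 3" "U = std P 0" "U' = std P r"
    using pair_normal_form[OF U U'] .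
  then have "r \<noteq> 3" "r \<noteq> 0" using std_disjoint_iff[OF P(1,2)] assms(3,4) by auto
  then have "r = 1 \<or> r = 2" using P(2) by linarith
  then show ?thesis using that P by blast
qed

lemma card_common_adjacent:
  assumes "U \<in> W" "U' \<in> W" "disj U U'"
  shows "card (\<Gamma> U \<inter> \<Gamma> U') = CARD('a)^2 * (CARD('a)^3 - 1) * (CARD('a) - 1)"
proof -
  obtain P where P: "frame P" "U = std P 0" "U' = std P 3" using adjacent_pair[OF assms] .
  show ?thesis
    unfolding P(2,3) common_neighbors_std_3[OF P(1)] card_graph_image[OF P(1)] by (rule card_det_nonzero)
qed

lemma card_common_nonadjacent:
  assumes "U \<in> W" "U' \<in> W" "U \<noteq> U'" "\<not> disj U U'"
  shows "card (\<Gamma> U \<inter> \<Gamma> U') = (CARD('a) - 1) * CARD('a)^5"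
proof -
  obtain P r where P: "frame P" "U = std P 0" "U' = std P r" and r: "r = 1 \<or> r = 2"
    using nonadjacent_pair[OF assms] .
  show ?thesis
    unfolding P(2,3) common_neighbors_std_12[OF P(1) r] card_graph_image[OF P(1)]
    using card_block[of "\<lambda>z :: 'a \<times> 'a \<times> 'a. minor r z \<noteq> 0"] card_minor[OF r, where 'a='a]
    by (simp add: power_numeral_reduce)
qed

text \<open>Only the non-adjacent pair is brought into standard position; the third plane enters as
  the graph of an arbitrary admissible matrix \<open>Z\<close>, and the count does not depend on
  \<open>Z\<close>.\<close>

lemma card_triple_nonadjacent:
  assumes U: "U \<in> W" "U' \<in> W" "U \<noteq> U'" "\<not> disj U U'" and V: "V \<in> \<Gamma> U \<inter> \<Gamma> U'"
  shows "card (\<Gamma> U \<inter> \<Gamma> U' \<inter> \<Gamma> V) =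
    (CARD('a)^2 * (CARD('a) - 1) - 1) * ((CARD('a) - 1) * CARD('a)^2)"
proof -
  obtain P r where P: "frame P" "U = std P 0" "U' = std P r" and r: "r = 1 \<or> r = 2"
    using nonadjacent_pair[OF U] .
  note eq = common_neighbors_std_12[OF P(1) r, folded P(2,3)]
  obtain Z where Z: "Z \<in> Sym" "minor r (block Z) \<noteq> 0" "V = graph P Z" using V unfolding eq by blast
  show ?thesis
    unfolding Z(3) triple_neighbors[OF P(1) eq Z(1)] card_graph_image[OF P(1)]
    by (rule card_common_minor[OF r Z(1,2)])
qed

lemma card_triple_adjacent:
  assumes U: "U \<in> W" "U' \<in> W" "disj U U'" and V: "V \<in> \<Gamma> U \<inter> \<Gamma> U'"
  shows "card (\<Gamma> U \<inter> \<Gamma> U' \<inter> \<Gamma> V) = common_nonsingular (sym_mat ((0, 0, 1), (1, 0, 0 :: 'a)))"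
proof -
  obtain P where P: "frame P" "U = std P 0" "U' = std P 3" using adjacent_pair[OF U] .
  note eq = common_neighbors_std_3[OF P(1), folded P(2,3)]
  obtain Z where Z: "Z \<in> Sym" "det Z \<noteq> 0" "V = graph P Z" using V unfolding eq by blast
  show ?thesis
    unfolding Z(3) triple_neighbors[OF P(1) eq Z(1)] card_graph_image[OF P(1)]
    using common_nonsingular_const[OF Z(1,2)] by (simp only: common_nonsingular_def)
qed

end

section \<open>Solving the edge counts for v and \<lambda>'\<close>

lemma int_params:
  fixes q :: nat
  assumes "q > 1"
  shows "int (q^2 * (q^3 - 1) * (q - 1)) = (int q)^2 * ((int q)^3 - 1) * (int q - 1)"
    and "int ((q - 1) * q^5) = (int q - 1) * (int q)^5"
    and "int (q^2 * (q - 1) * (q^3 - q^2 - 1)) = (int q)^2 * (int q - 1) * ((int q)^3 - (int q)^2 - 1)"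
    and "int (q^2 * (q - 1) * (q^3 - q^2 - 1) - q^2 * (q - 2)) =
      (int q)^2 * (int q - 1) * ((int q)^3 - (int q)^2 - 1) - (int q)^2 * (int q - 2)"
proof -
  have 1: "int (q - 1) = int q - 1" "int (q - 2) = int q - 2" using assms by auto
  have q3: "1 \<le> q ^ 3" using assms by simp
  then have 2: "int (q^3 - 1) = (int q)^3 - 1" by (simp add: of_nat_diff)
  have "q^2 * 2 \<le> q^2 * q" using assms by (intro mult_left_mono) auto
  then have "q^2 * 2 \<le> q^3" by (simp only: power3_eq_cube power2_eq_square)
  moreover have "q + 2 \<le> q ^ 2"
  proof -
    have "2 * q \<le> q * q" using assms by (intro mult_right_mono) auto
    then show ?thesis using assms unfolding power2_eq_square by linarith
  qed
  ultimately have sub: "q^2 + 1 \<le> q^3" and big: "q - 2 \<le> q^3 - q^2 - 1" by linarith+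
  have 3: "int (q^3 - q^2 - 1) = (int q)^3 - (int q)^2 - 1"
    using sub by (simp add: of_nat_diff)
  show "int (q^2 * (q^3 - 1) * (q - 1)) = (int q)^2 * ((int q)^3 - 1) * (int q - 1)"
    by (simp only: of_nat_mult 1 2 of_nat_power)
  show "int ((q - 1) * q^5) = (int q - 1) * (int q)^5" by (simp only: of_nat_mult 1 of_nat_power)
  show m: "int (q^2 * (q - 1) * (q^3 - q^2 - 1)) = (int q)^2 * (int q - 1) * ((int q)^3 - (int q)^2 - 1)"
    by (simp only: of_nat_mult 1 3 of_nat_power)
  \<comment> \<open>Needed for the subtraction of natural numbers in \<lambda>' to be exact.\<close>
  have "q^2 * (q - 2) \<le> q^2 * (q - 1) * (q^3 - q^2 - 1)"
  proof -
    have "1 * (q - 2) \<le> (q - 1) * (q^3 - q^2 - 1)" using assms big by (intro mult_mono) auto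
    then show ?thesis by (simp add: mult.assoc)
  qed
  then show "int (q^2 * (q - 1) * (q^3 - q^2 - 1) - q^2 * (q - 2)) =
      (int q)^2 * (int q - 1) * ((int q)^3 - (int q)^2 - 1) - (int q)^2 * (int q - 2)"
    by (simp only: of_nat_diff m) (simp only: of_nat_mult 1 of_nat_power)
qed

lemma vertex_count:
  fixes q v :: nat
  assumes q: "q > 1" and eq: "int (q^6) * (int (q^6) - 1 - int (q^2 * (q^3 - 1) * (q - 1))) =
    (int v - 1 - int (q^6)) * int ((q - 1) * q^5)"
  shows "v = (q^3 + 1) * (q^2 + 1) * (q + 1)"
proof -
  let ?x = "int q"
  \<comment> \<open>Cancelling \<mu> leaves the number of planes that meet a given plane without
    being equal to it.\<close>
  have "(?x - 1) * ?x^5 * (int v - 1 - ?x^6) = (?x - 1) * ?x^5 * (?x * (?x^2 + ?x + 1) * (?x^2 + 1))"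
    using eq unfolding int_params[OF q] of_nat_power by (simp add: algebra_simps power_numeral_reduce)
  moreover have "(?x - 1) * ?x^5 \<noteq> 0" using q by simp
  ultimately have "int v - 1 - ?x^6 = ?x * (?x^2 + ?x + 1) * (?x^2 + 1)"
    by (metis mult_left_cancel)
  then have "int v = int ((q^3 + 1) * (q^2 + 1) * (q + 1))"
    by (simp add: algebra_simps power_numeral_reduce)
  then show ?thesis by (simp only: of_nat_eq_iff)
qed

text \<open>The edge count in the local graph, divided by its valency \<lambda>, becomes linear in
  the unknown \<open>n\<close>.\<close>

lemma local_lambda:
  fixes q n :: nat
  assumes q: "q > 1" and eq: "int (q^2 * (q^3 - 1) * (q - 1)) * (int (q^2 * (q^3 - 1) * (q - 1)) - 1 - int n) =
    (int (q^6) - 1 - int (q^2 * (q^3 - 1) * (q - 1))) * int (q^2 * (q - 1) * (q^3 - q^2 - 1))"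
  shows "n = q^2 * (q - 1) * (q^3 - q^2 - 1) - q^2 * (q - 2)"
proof -
  let ?x = "int q" and ?l = "(int q)^2 * ((int q)^3 - 1) * (int q - 1)"
  have "?l * (?l - 1 - int n) = ?l * ((?x^2 + 1) * (?x^3 - ?x^2 - 1))"
    using eq unfolding int_params[OF q] of_nat_power by (simp add: algebra_simps power_numeral_reduce)
  moreover have "?l \<noteq> 0"
  proof -
    have "q^3 > 1" using one_less_power[OF q, of 3] by simp
    then have "?x^3 \<noteq> 1" by (metis less_irrefl of_nat_1 of_nat_eq_iff of_nat_power)
    then show ?thesis using q by simp
  qed
  ultimately have "?l - 1 - int n = (?x^2 + 1) * (?x^3 - ?x^2 - 1)" by (metis mult_left_cancel)
  then have "int n = ?x^2 * (?x - 1) * (?x^3 - ?x^2 - 1) - ?x^2 * (?x - 2)"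
    by (simp add: algebra_simps power_numeral_reduce)
  then show ?thesis unfolding int_params(4)[OF q, symmetric] by (simp only: of_nat_eq_iff)
qed

context symplectic_space6
begin

lemma simple_graph_W: "simple_graph W disj"
proof -
  have "finite W" 
    by (rule finite_subset[OF _ finite_Pow_iff[THEN iffD2, OF finite_V]]) (simp add: subset_iff)
  moreover have "\<not> disj U U" if "U \<in> W" for U
  proof
    assume "disj U U"
    then have "U = {0}" by (simp add: disjoint_subspaces_def)
    then show False using W_card[OF that] one_less_power[OF card_gt_1, of 3] by simp
  qed
  ultimately show ?thesis using disjoint_commute unfolding simple_graph_def by blast
qed

lemma strongly_regular_W:
  assumes q: "q = CARD('a)"
  shows "strongly_regular W disj ((q^3 + 1) * (q^2 + 1) * (q + 1))
    (q^6) (q^2 * (q^3 - 1) * (q - 1)) ((q - 1) * q^5)"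
proof -
  obtain P where P: "frame P" using ex_frame by blast
  note sr = simple_graph_W std_in_W[OF P, of 0]
  have deg: "\<forall>x\<in>W. card (\<Gamma> x) = q^6" using card_W_neighbors q by simp
  have adj: "\<forall>x\<in>W. \<forall>y\<in>W. disj x y \<longrightarrow>
      card (\<Gamma> x \<inter> \<Gamma> y) = q^2 * (q^3 - 1) * (q - 1)"
    using card_common_adjacent q by simp
  have nonadj: "\<forall>x\<in>W. \<forall>y\<in>W. x \<noteq> y \<longrightarrow> \<not> disj x y \<longrightarrow>
      card (\<Gamma> x \<inter> \<Gamma> y) = (q - 1) * q^5"
    using card_common_nonadjacent q by simp
  have "card W = (q^3 + 1) * (q^2 + 1) * (q + 1)"
    using vertex_count[OF _ strongly_regular_double_count[OF sr deg adj nonadj]] card_gt_1 q by simp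
  moreover have "\<exists>x\<in>W. \<exists>y\<in>W. x \<noteq> y \<and> \<not> disj x y"
  proof (intro bexI conjI)
    show "std P 0 \<noteq> std P 1" by (rule std_neq[OF P]) simp
    show "\<not> disj (std P 0) (std P 1)" using std_disjoint_iff[OF P, of 1] by simp
  qed (rule std_in_W[OF P])+
  moreover have "\<exists>x\<in>W. \<exists>y\<in>W. disj x y"
    using std_disjoint_iff[OF P, of 3] std_in_W[OF P, of 0] std_in_W[OF P, of 3]
    by (intro bexI[of _ "std P 0"] bexI[of _ "std P 3"]) simp_all
  ultimately show ?thesis
    using simple_graph_W deg adj nonadj unfolding strongly_regular_def by blast
qed

lemma strongly_regular_local:
  assumes q: "q = CARD('a)" and x: "x \<in> W"
  shows "strongly_regular (\<Gamma> x) disj (q^6) (q^2 * (q^3 - 1) * (q - 1))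
    (q^2 * (q - 1) * (q^3 - q^2 - 1) - q^2 * (q - 2)) (q^2 * (q - 1) * (q^3 - q^2 - 1))"
proof -
  let ?N = "neighbors (\<Gamma> x) disj"
  let ?n = "common_nonsingular (sym_mat ((0, 0, 1), (1, 0, 0 :: 'a)))"
  have sub: "y \<in> W \<and> disj x y" if "y \<in> \<Gamma> x" for y
    using that by (simp add: neighbors_def)
  have N: "?N y = \<Gamma> x \<inter> \<Gamma> y" for y by (rule neighbors_within[OF neighbors_subset])
  have sg: "simple_graph (\<Gamma> x) disj"
    by (rule simple_graph_subset[OF simple_graph_W neighbors_subset])
  have deg: "\<forall>y\<in>\<Gamma> x. card (?N y) = q^2 * (q^3 - 1) * (q - 1)"
    using card_common_adjacent[OF x] sub by (simp add: N q)
  \<comment> \<open>The roles change: \<open>y\<close> and \<open>z\<close> become the pair to be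
    normalised, and the centre \<open>x\<close> of the local graph becomes the third plane.\<close>
  have comm: "?N y \<inter> ?N z = \<Gamma> y \<inter> \<Gamma> z \<inter> \<Gamma> x" for y z unfolding N by blast
  have mem: "x \<in> \<Gamma> y \<inter> \<Gamma> z" if "y \<in> \<Gamma> x" "z \<in> \<Gamma> x" for y z
    using sub[OF that(1)] sub[OF that(2)] x disjoint_commute by (auto simp: neighbors_def)
  have adj: "\<forall>y\<in>\<Gamma> x. \<forall>z\<in>\<Gamma> x. disj y z \<longrightarrow> card (?N y \<inter> ?N z) = ?n"
    unfolding comm using card_triple_adjacent mem sub by blast
  have nonadj: "\<forall>y\<in>\<Gamma> x. \<forall>z\<in>\<Gamma> x. y \<noteq> z \<longrightarrow> \<not> disj y z \<longrightarrow>
      card (?N y \<inter> ?N z) = q^2 * (q - 1) * (q^3 - q^2 - 1)"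
  proof (intro ballI impI)
    fix y z assume yz: "y \<in> \<Gamma> x" "z \<in> \<Gamma> x" "y \<noteq> z" "\<not> disj y z"
    have "q^2 * (q - 1) - 1 = q^3 - q^2 - 1"
      by (simp add: power2_eq_square power3_eq_cube right_diff_distrib')
    then show "card (?N y \<inter> ?N z) = q^2 * (q - 1) * (q^3 - q^2 - 1)"
      unfolding comm using card_triple_nonadjacent[OF _ _ yz(3,4) mem[OF yz(1,2)]] sub yz(1,2) q
      by (simp add: mult.commute)
  qed
  obtain P where P: "frame P" "x = std P 0" using ex_frame_at[OF x] std_0 by metis
  have graphs: "graph P S \<in> \<Gamma> x" if "S \<in> Sym" for S
    using neighbors_std_0[OF P(1)] P(2) that by blast
  \<comment> \<open>Only here does the constant obtained from congruence acquire its value, forced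
    by the other parameters of the local graph.\<close>
  have "?n = q^2 * (q - 1) * (q^3 - q^2 - 1) - q^2 * (q - 2)"
    using local_lambda[of q ?n] strongly_regular_double_count[OF sg graphs[OF Sym_0] deg adj nonadj]
      card_gt_1 card_W_neighbors[OF x] q by simp
  moreover have "\<exists>y\<in>\<Gamma> x. \<exists>z\<in>\<Gamma> x. y \<noteq> z \<and> \<not> disj y z"
  proof -
    let ?S = "sym_mat ((1, 0, 0), (0, 0, 0)) :: 'a^3^3"
    have S: "?S \<in> Sym" by (rule Sym_sym_mat)
    have "?S \<noteq> 0" "det (?S - 0) = 0" by (simp_all add: mat3_eq_iff forall_3 det_3)
    then have "graph P ?S \<noteq> graph P 0" "\<not> disj (graph P ?S) (graph P 0)"
      using graph_inj[OF P(1)] graph_disjoint_graph[OF P(1) S Sym_0] by (auto dest: injD)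
    then show ?thesis using graphs[OF S] graphs[OF Sym_0] by blast
  qed
  moreover have "\<exists>y\<in>\<Gamma> x. \<exists>z\<in>\<Gamma> x. disj y z"
  proof -
    have S: "mat 1 \<in> (Sym :: ('a^3^3) set)" by (simp add: Sym_def transpose_mat)
    have "disj (graph P (mat 1)) (graph P 0)"
      using graph_disjoint_graph[OF P(1) S Sym_0] by simp
    then show ?thesis using graphs[OF S] graphs[OF Sym_0] by blast
  qed
  ultimately show ?thesis
    using sg card_W_neighbors[OF x] deg adj nonadj q unfolding strongly_regular_def by simp
qed

end

section \<open>Odd characteristic: rank four\<close>

context symplectic_space6
begin

abbreviation aut :: "('b set \<Rightarrow> 'b set) \<Rightarrow> bool" where
  "aut \<equiv> graph_aut W disj"

section \<open>Automorphisms induced by isometries\<close>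

lemma frame_change:
  assumes P: "frame P" and P': "frame P'"
  obtains h where "bij h" "\<forall>x y. h (P x y) = P' x y" "\<forall>U\<in>W. h ` U \<in> W"
proof -
  define h where "h v = (\<lambda>(x, y). P' x y) (inv_into UNIV (\<lambda>(x, y). P x y) v)" for v
  have h: "h (P x y) = P' x y" for x y
    using inv_f_f[OF bij_is_inj[OF frame_bij[OF P]], of "(x, y)"] by (simp add: h_def)
  have add: "h (u + v) = h u + h v" for u v
    by (rule frame_surj[OF P, of u], rule frame_surj[OF P, of v])
      (simp add: h frame_add[OF P'] flip: frame_add[OF P])
  have scale: "h (scale c u) = scale c (h u)" for c u
    by (rule frame_surj[OF P, of u]) (simp add: h frame_scale[OF P'] flip: frame_scale[OF P])
  have form: "B (h u) (h v) = B u v" for u v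
    by (rule frame_surj[OF P, of u], rule frame_surj[OF P, of v])
      (simp add: h frame_form[OF P] frame_form[OF P'])
  have zero: "h 0 = 0" using h[of 0 0] by (simp add: frame_zero[OF P] frame_zero[OF P'])
  have "bij h"
    using bij_comp[OF bij_imp_bij_inv[OF frame_bij[OF P]] frame_bij[OF P']]
    by (simp add: h_def[abs_def] comp_def)
  moreover have "h ` U \<in> W" if U: "U \<in> W" for U
  proof -
    have "subspace (h ` U)"
    proof (rule subspaceI)
      show "0 \<in> h ` U" using zero W_zero[OF U] by (metis imageI)
      show "x + y \<in> h ` U" if "x \<in> h ` U" "y \<in> h ` U" for x y
        using that subspace_add[OF W_subspace[OF U]] by (auto simp flip: add)
      show "scale c x \<in> h ` U" if "x \<in> h ` U" for c x
        using that subspace_scale[OF W_subspace[OF U]] by (auto simp flip: scale)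
    qed
    moreover have "card (h ` U) = CARD('a) ^ 3"
      using W_card[OF U] card_image[OF inj_on_subset[OF bij_is_inj[OF \<open>bij h\<close>] subset_UNIV]] by metis
    ultimately show ?thesis using W_isotropic[OF U] by (auto simp: W_iff form)
  qed
  ultimately show ?thesis using that h by blast
qed

lemma frame_change_aut:
  assumes P: "frame P" and P': "frame P'"
  obtains f where "aut f" "\<forall>A C. f (plane P A C) = plane P' A C"
proof -
  obtain h where h: "bij h" "\<forall>x y. h (P x y) = P' x y" "\<forall>U\<in>W. h ` U \<in> W"
    using frame_change[OF P P'] .
  obtain g where g: "bij g" "\<forall>x y. g (P' x y) = P x y" "\<forall>U\<in>W. g ` U \<in> W"
    using frame_change[OF P' P] .
  have "g (h v) = v" for v by (rule frame_surj[OF P, of v]) (simp add: h g)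
  moreover have "h (g v) = v" for v by (rule frame_surj[OF P', of v]) (simp add: h g)
  ultimately have "bij_betw (\<lambda>U. h ` U) W W"
    by (intro bij_betwI[of _ _ _ "\<lambda>U. g ` U"]) (auto simp: h(3) g(3) image_image)
  moreover have "disj (h ` U) (h ` U') \<longleftrightarrow> disj U U'" for U U'
  proof -
    have "h 0 = 0" using h(2)[rule_format, of 0 0] by (simp add: frame_zero[OF P] frame_zero[OF P'])
    then have "{0} = h ` {0}" by simp
    then show ?thesis unfolding disjoint_subspaces_def
      using inj_image_eq_iff[OF bij_is_inj[OF h(1)], of "U \<inter> U'" "{0}"] image_Int[OF bij_is_inj[OF h(1)]]
      by metis
  qed
  ultimately have "aut (\<lambda>U. h ` U)" by (simp add: graph_aut_def)
  moreover have "h ` plane P A C = plane P' A C" for A C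
    by (simp add: plane_def image_image h(2))
  ultimately show ?thesis using that by blast
qed

lemma frame_change_std:
  assumes "frame P" "frame P'"
  obtains f where "aut f" "\<forall>r. f (std P r) = std P' r"
  using frame_change_aut[OF assms] unfolding std_def by metis

lemma aut_transitive:
  assumes "U \<in> W" "U' \<in> W"
  shows "\<exists>f. aut f \<and> f U = U'"
proof -
  obtain P where P: "frame P" "U = plane P (mat 1) 0" using ex_frame_at[OF assms(1)] .
  obtain P' where P': "frame P'" "U' = plane P' (mat 1) 0" using ex_frame_at[OF assms(2)] .
  show ?thesis using frame_change_aut[OF P(1) P'(1)] P(2) P'(2) by metis
qed

lemma meets_iff:
  assumes "U \<in> W" "U' \<in> W"
  shows "\<not> disj U U' \<longleftrightarrow> (\<exists>u\<in>U \<inter> U'. u \<noteq> 0)"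
  using W_zero[OF assms(1)] W_zero[OF assms(2)] unfolding disjoint_subspaces_def by blast

text \<open>Existence of a third vertex in the hyperbolic line of the complementary graph spanned by a
  non-adjacent pair. For odd \<open>q\<close> this separates planes meeting in a line from planes meeting in a
  point.\<close>

definition has_third :: "'b set \<Rightarrow> 'b set \<Rightarrow> bool" where
  "has_third U U' \<longleftrightarrow> (\<exists>Z\<in>W. Z \<noteq> U \<and> Z \<noteq> U' \<and> (\<forall>X\<in>W. \<not> disj X U \<longrightarrow>
     \<not> disj X U' \<longrightarrow> \<not> disj X Z))"

lemma aut_has_third:
  assumes f: "aut f" and U: "U \<in> W" "U' \<in> W" and t: "has_third U U'"
  shows "has_third (f U) (f U')"
proof -
  obtain Z where Z: "Z \<in> W" "Z \<noteq> U" "Z \<noteq> U'"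
    "\<And>X. X \<in> W \<Longrightarrow> \<not> disj X U \<Longrightarrow> \<not> disj X U' \<Longrightarrow>
      \<not> disj X Z"
    using t unfolding has_third_def by blast
  have inj: "inj_on f W" and img: "f ` W = W"
    and adj: "\<And>x y. x \<in> W \<Longrightarrow> y \<in> W \<Longrightarrow> disj (f x) (f y) \<longleftrightarrow> disj x y"
    using f by (auto simp: graph_aut_def bij_betw_def)
  show ?thesis
    unfolding has_third_def
  proof (intro bexI[of _ "f Z"] conjI ballI impI)
    show "f Z \<noteq> f U" "f Z \<noteq> f U'" using inj Z(1-3) U by (auto simp: inj_on_def)
    show "f Z \<in> W" using img Z(1) by blast
    fix X assume X: "X \<in> W" "\<not> disj X (f U)" "\<not> disj X (f U')"
    then obtain Y where Y: "Y \<in> W" "X = f Y" using img by blast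
    then show "\<not> disj X (f Z)" using Z(1,4) X adj U by simp
  qed
qed

section \<open>Third vertices in coordinates\<close>

definition coords :: "('a^3 \<Rightarrow> 'a^3 \<Rightarrow> 'b) \<Rightarrow> 'a \<Rightarrow> 'a \<Rightarrow> 'a \<Rightarrow> 'a \<Rightarrow> 'a \<Rightarrow> 'a \<Rightarrow> 'b" where
  "coords P x1 x2 x3 y1 y2 y3 = P (vector [x1, x2, x3]) (vector [y1, y2, y3])"

context
  fixes P assumes P: "frame P"
begin

lemma coords_add: "coords P x1 x2 x3 y1 y2 y3 + coords P x1' x2' x3' y1' y2' y3' =
    coords P (x1 + x1') (x2 + x2') (x3 + x3') (y1 + y1') (y2 + y2') (y3 + y3')"
  unfolding coords_def frame_add[OF P, symmetric]
  by (intro arg_cong2[of _ _ _ _ P]) (simp_all add: vec_eq_iff forall_3)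

lemma coords_scale: "scale c (coords P x1 x2 x3 y1 y2 y3) =
    coords P (c * x1) (c * x2) (c * x3) (c * y1) (c * y2) (c * y3)"
  unfolding coords_def frame_scale[OF P, symmetric]
  by (intro arg_cong2[of _ _ _ _ P]) (simp_all add: vec_eq_iff forall_3)

lemma coords_form: "B (coords P x1 x2 x3 y1 y2 y3) (coords P x1' x2' x3' y1' y2' y3') =
    x1 * y1' + x2 * y2' + x3 * y3' - (y1 * x1' + y2 * x2' + y3 * x3')"
  by (simp add: coords_def frame_form[OF P] dot_def)

lemma coords_eq_0: "coords P x1 x2 x3 y1 y2 y3 = 0 \<longleftrightarrow>
    x1 = 0 \<and> x2 = 0 \<and> x3 = 0 \<and> y1 = 0 \<and> y2 = 0 \<and> y3 = 0"
  by (auto simp: coords_def frame_eq_0_iff[OF P] vec_eq_iff forall_3)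

lemma in_plane_coords:
  "u \<in> plane P A C \<longleftrightarrow> (\<exists>z. u = coords P ((A *v z)$1) ((A *v z)$2) ((A *v z)$3)
     ((C *v z)$1) ((C *v z)$2) ((C *v z)$3))"
proof -
  have "vector [x$1, x$2, x$3] = x" for x :: "'a^3" by (simp add: vec_eq_iff forall_3)
  then show ?thesis by (auto simp: plane_def coords_def)
qed

lemma in_std_0: "u \<in> std P 0 \<longleftrightarrow> (\<exists>x1 x2 x3. u = coords P x1 x2 x3 0 0 0)"
  and in_std_1: "u \<in> std P 1 \<longleftrightarrow> (\<exists>x2 x3 y1. u = coords P 0 x2 x3 y1 0 0)"
  and in_std_2: "u \<in> std P 2 \<longleftrightarrow> (\<exists>x3 y1 y2. u = coords P 0 0 x3 y1 y2 0)"
  unfolding std_def in_plane_coords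
  by (simp_all add: matrix_vector_mult_diff_rdistrib proj_vec)
    (metis vector_3)+

lemma in_cograph_proj_1: "u \<in> plane P (mat 1) (proj 1) \<longleftrightarrow> (\<exists>x1 x2 x3. u = coords P x1 x2 x3 x1 0 0)"
  unfolding in_plane_coords by (simp add: proj_vec) (metis vector_3)

text \<open>The third plane is spanned by e_1 + f_1, e_2, e_3. A plane meeting both given ones
  contains nonzero \<open>u\<close> and \<open>v\<close> with \<open>B u v = x1 * y1\<close>.
  Isotropy makes one factor vanish, so \<open>u\<close> or \<open>v\<close> lies in the line common
  to all three planes.\<close>

lemma has_third_std_1: "has_third (std P 0) (std P 1)"
  unfolding has_third_def
proof (intro bexI[of _ "plane P (mat 1) (proj 1)"] conjI ballI impI)
  show Z: "plane P (mat 1) (proj 1) \<in> W" by (rule plane_in_W[OF P lagrangian_cograph[OF Sym_proj]])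
  have eq: "coords P x1 x2 x3 y1 y2 y3 = coords P x1' x2' x3' y1' y2' y3' \<longleftrightarrow>
    x1 = x1' \<and> x2 = x2' \<and> x3 = x3' \<and> y1 = y1' \<and> y2 = y2' \<and> y3 = y3'"
    for x1 x2 x3 y1 y2 y3 x1' x2' x3' y1' y2' y3'
    by (auto simp: coords_def frame_eq_iff[OF P] vec_eq_iff forall_3)
  have "coords P 1 0 0 1 0 0 \<in> plane P (mat 1) (proj 1)" unfolding in_cograph_proj_1 by blast
  moreover have "coords P 1 0 0 1 0 0 \<notin> std P 0" "coords P 1 0 0 1 0 0 \<notin> std P 1"
    unfolding in_std_0 in_std_1 eq by simp_all
  ultimately show "plane P (mat 1) (proj 1) \<noteq> std P 0" "plane P (mat 1) (proj 1) \<noteq> std P 1" by blast+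
  fix X assume X: "X \<in> W" "\<not> disj X (std P 0)" "\<not> disj X (std P 1)"
  obtain u where u: "u \<in> X" "u \<in> std P 0" "u \<noteq> 0" using X(2) meets_iff[OF X(1) std_in_W[OF P]] by blast
  obtain v where v: "v \<in> X" "v \<in> std P 1" "v \<noteq> 0" using X(3) meets_iff[OF X(1) std_in_W[OF P]] by blast
  obtain x1 x2 x3 where u': "u = coords P x1 x2 x3 0 0 0" using u(2) in_std_0 by blast
  obtain w2 w3 y1 where v': "v = coords P 0 w2 w3 y1 0 0" using v(2) in_std_1 by blast
  have "x1 * y1 = 0" using W_isotropic[OF X(1) u(1) v(1)] by (simp add: u' v' coords_form)
  then have "u \<in> plane P (mat 1) (proj 1) \<or> v \<in> plane P (mat 1) (proj 1)"
    unfolding in_cograph_proj_1 u' v' eq by auto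
  then show "\<not> disj X (plane P (mat 1) (proj 1))"
    using meets_iff[OF X(1) Z] u v by blast
qed

lemma span3_in_W:
  assumes orth: "B p r = 0" "B p s = 0" "B r s = 0"
    and ind: "\<And>a b c. scale a p + scale b r + scale c s = 0 \<Longrightarrow> a = 0 \<and> b = 0 \<and> c = 0"
  shows "range (\<lambda>(a, b, c). scale a p + scale b r + scale c s) \<in> W"
proof -
  let ?h = "\<lambda>(a, b, c). scale a p + scale b r + scale c s"
  have add: "?h z + ?h z' = ?h (z + z')" for z z'
    by (cases z, cases z') (simp add: scale_left_distrib algebra_simps)
  have sc: "scale k (?h z) = ?h (k * fst z, k * fst (snd z), k * snd (snd z))" for k z
    by (cases z) (simp add: scale_right_distrib)
  have "subspace (range ?h)"
  proof (rule subspaceI)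
    show "0 \<in> range ?h" by (rule image_eqI[of _ _ "(0, 0, 0)"]) simp_all
    show "x + y \<in> range ?h" if "x \<in> range ?h" "y \<in> range ?h" for x y
      using that by (elim rangeE) (simp only: add rangeI)
    show "scale k x \<in> range ?h" if "x \<in> range ?h" for k x
      using that by (elim rangeE) (simp only: sc rangeI)
  qed
  moreover have "inj ?h"
  proof (rule injI)
    fix z z' assume eq: "?h z = ?h z'"
    have 0: "?h (z - z') = 0" using add[of "z - z'" z'] eq by simp
    obtain a b c where z: "z = (a, b, c)" by (metis prod_cases3)
    obtain a' b' c' where z': "z' = (a', b', c')" by (metis prod_cases3)
    have "a - a' = 0 \<and> b - b' = 0 \<and> c - c' = 0" by (rule ind) (use 0 in \<open>simp add: z z'\<close>)
    then show "z = z'" by (simp add: z z')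
  qed
  then have "card (range ?h) = CARD('a) ^ 3"
    by (simp add: card_image power_numeral_reduce)
  moreover have "B x y = 0" if "x \<in> range ?h" "y \<in> range ?h" for x y
    using that orth B_skew[of r p] B_skew[of s p] B_skew[of s r]
    by (auto simp: B_add_left B_add_right B_scale_left B_scale_right)
  ultimately show ?thesis unfolding W_iff by blast
qed

text \<open>Two planes through the isotropic line spanned by \<open>p\<close> and \<open>r\<close> already force \<open>Z\<close> to meet it.\<close>

lemma meets_line:
  assumes Z: "Z \<in> W"
    and closed: "\<And>X. X \<in> W \<Longrightarrow> \<not> disj X (std P 0) \<Longrightarrow>
      \<not> disj X (std P 2) \<Longrightarrow> \<not> disj X Z"
    and p: "p \<in> std P 0" "p \<noteq> 0" and m: "m = p \<or> m = r" "m \<in> std P 2" "m \<noteq> 0"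
    and orth: "B p r = 0" "B p s = 0" "B r s = 0" "B p t = 0" "B r t = 0" "B s t \<noteq> 0"
    and ind: "\<And>a b c. scale a p + scale b r + scale c s = 0 \<Longrightarrow> a = 0 \<and> b = 0 \<and> c = 0"
      "\<And>a b c. scale a p + scale b r + scale c t = 0 \<Longrightarrow> a = 0 \<and> b = 0 \<and> c = 0"
  obtains a b where "a \<noteq> 0 \<or> b \<noteq> 0" "scale a p + scale b r \<in> Z"
proof -
  have *: "\<exists>a b c. scale a p + scale b r + scale c x \<in> Z \<and> (a \<noteq> 0 \<or> b \<noteq> 0 \<or> c \<noteq> 0)"
    if X: "range (\<lambda>(a, b, c). scale a p + scale b r + scale c x) \<in> W" (is "?X \<in> W") for x
  proof -
    have pX: "p \<in> ?X" by (rule image_eqI[of _ _ "(1, 0, 0)"]) simp_all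
    have rX: "r \<in> ?X" by (rule image_eqI[of _ _ "(0, 1, 0)"]) simp_all
    have "\<not> disj ?X (std P 0)"
      using meets_iff[OF X std_in_W[OF P]] p pX by blast
    moreover have "\<not> disj ?X (std P 2)"
      using meets_iff[OF X std_in_W[OF P]] m pX rX by blast
    ultimately obtain u where u: "u \<in> ?X" "u \<in> Z" "u \<noteq> 0"
      using closed[OF X] meets_iff[OF X Z] by blast
    then obtain a b c where "u = scale a p + scale b r + scale c x" by auto
    then show ?thesis using u by (intro exI[of _ a] exI[of _ b] exI[of _ c]) auto
  qed
  obtain a b c where 1: "scale a p + scale b r + scale c s \<in> Z" "a \<noteq> 0 \<or> b \<noteq> 0 \<or> c \<noteq> 0"
    using *[OF span3_in_W[OF orth(1-3) ind(1)]] by blast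
  obtain a' b' c' where 2: "scale a' p + scale b' r + scale c' t \<in> Z" "a' \<noteq> 0 \<or> b' \<noteq> 0 \<or> c' \<noteq> 0"
    using *[OF span3_in_W[OF orth(1,4,5) ind(2)]] by blast
  have "c * c' * B s t = 0"
    using W_isotropic[OF Z 1(1) 2(1)] orth(1-5) B_skew[of r p] B_skew[of s p] B_skew[of s r]
    by (auto simp: B_add_left B_add_right B_scale_left B_scale_right)
  then have "c = 0 \<or> c' = 0" using orth(6) by simp
  then show ?thesis
  proof
    assume "c = 0" then show ?thesis using 1 by (intro that[of a b]) auto
  next
    assume "c' = 0" then show ?thesis using 2 by (intro that[of a' b']) auto
  qed
qed

text \<open>\<open>Z\<close> has to meet each isotropic line joining the two planes. Lines through
  their common point e_3 force e_3 into \<open>Z\<close>. Three transversals, through e_1 and f_2,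
  through e_2 and f_1, and through e_1 + e_2 and f_1 - f_2, meet \<open>Z\<close> in mutually
  orthogonal points. For odd q these points all lie in the same one of the two planes, which then
  equals \<open>Z\<close>.\<close>

lemma not_has_third_std_2:
  assumes two: "(2 :: 'a) \<noteq> 0"
  shows "\<not> has_third (std P 0) (std P 2)"
proof
  assume "has_third (std P 0) (std P 2)"
  then obtain Z where Z: "Z \<in> W" "Z \<noteq> std P 0" "Z \<noteq> std P 2"
    and closed: "\<And>X. X \<in> W \<Longrightarrow> \<not> disj X (std P 0) \<Longrightarrow>
      \<not> disj X (std P 2) \<Longrightarrow> \<not> disj X Z"
    unfolding has_third_def by blast
  define e1 e2 e3 f1 f2 f3 where "e1 = coords P 1 0 0 0 0 0" and "e2 = coords P 0 1 0 0 0 0"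
    and "e3 = coords P 0 0 1 0 0 0" and "f1 = coords P 0 0 0 1 0 0" and "f2 = coords P 0 0 0 0 1 0"
    and "f3 = coords P 0 0 0 0 0 1"
  note defs = e1_def e2_def e3_def f1_def f2_def f3_def
  note calc = coords_add coords_scale coords_form coords_eq_0
  have in0: "e1 \<in> std P 0" "e2 \<in> std P 0" "e3 \<in> std P 0" "e1 + e2 \<in> std P 0"
    unfolding in_std_0 defs coords_add by (blast, blast, blast, metis add_0)
  have "f1 + scale (- 1) f2 = coords P 0 0 0 1 (- 1) 0" by (simp add: defs calc)
  then have in2: "e3 \<in> std P 2" "f1 \<in> std P 2" "f2 \<in> std P 2" "f1 + scale (- 1) f2 \<in> std P 2"
    unfolding in_std_2 by (metis defs)+
  note iso = W_isotropic[OF Z(1)] and sub = W_subspace[OF Z(1)]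
  have scale_cancel: "v \<in> Z" if "scale c v \<in> Z" "c \<noteq> 0" for c v
    using subspace_scale[OF sub that(1), of "inverse c"] that(2) by simp
  have e3: "e3 \<in> Z"
  proof -
    obtain a b where 1: "a \<noteq> 0 \<or> b \<noteq> 0" "scale a e3 + scale b e1 \<in> Z"
      by (rule meets_line[OF Z(1) closed in0(3) _ _ in2(1), of e1 e2 f2]) (auto simp: defs calc)
    obtain a' b' where 2: "a' \<noteq> 0 \<or> b' \<noteq> 0" "scale a' e3 + scale b' f1 \<in> Z"
      by (rule meets_line[OF Z(1) closed in0(3) _ _ in2(1), of f1 e2 f2]) (auto simp: defs calc)
    have "b * b' = 0" using iso[OF 1(2) 2(2)] by (simp add: defs calc)
    then show ?thesis using 1 2 scale_cancel[of a e3] scale_cancel[of a' e3] by auto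
  qed
  obtain \<alpha> \<beta> where u1: "\<alpha> \<noteq> 0 \<or> \<beta> \<noteq> 0" "scale \<alpha> e1 + scale \<beta> f2 \<in> Z"
    by (rule meets_line[OF Z(1) closed in0(1) _ _ in2(3), of f2 e3 f3]) (auto simp: defs calc)
  obtain \<gamma> \<delta> where u2: "\<gamma> \<noteq> 0 \<or> \<delta> \<noteq> 0" "scale \<gamma> e2 + scale \<delta> f1 \<in> Z"
    by (rule meets_line[OF Z(1) closed in0(2) _ _ in2(2), of f1 e3 f3]) (auto simp: defs calc)
  obtain a b where u3: "a \<noteq> 0 \<or> b \<noteq> 0" "scale a (e1 + e2) + scale b (f1 + scale (- 1) f2) \<in> Z"
    by (rule meets_line[OF Z(1) closed in0(4) _ _ in2(4), of "f1 + scale (- 1) f2" e3 f3])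
      (auto simp: defs calc)
  \<comment> \<open>Isotropy of \<open>Z\<close> for the three pairs of intersection points. The
    sign in the last equation comes from f_1 - f_2; in characteristic two it disappears and mixed
    solutions exist.\<close>
  have eqs: "\<alpha> * \<delta> = \<beta> * \<gamma>" "a * \<beta> = b * \<alpha>" "a * \<delta> = - b * \<gamma>"
    using iso[OF u1(2) u2(2)] iso[OF u3(2) u1(2)] iso[OF u3(2) u2(2)]
    by (simp_all add: defs calc eq_neg_iff_add_eq_0)
  have "b = 0 \<and> \<beta> = 0 \<and> \<delta> = 0 \<or> a = 0 \<and> \<alpha> = 0 \<and> \<gamma> = 0"
  proof (cases "a = 0")
    case True
    then show ?thesis using eqs u3(1) by auto
  next
    case False
    define t where "t = b * \<gamma> * \<alpha>"
    have "a * (\<alpha> * \<delta>) = - (b * \<gamma>) * \<alpha>" using eqs(3) by (metis mult.assoc mult.commute minus_mult_left)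
    moreover have "a * (\<beta> * \<gamma>) = b * \<gamma> * \<alpha>" using eqs(2) by (metis mult.assoc mult.commute)
    ultimately have t: "- t = t" using eqs(1) by (simp add: t_def)
    have "2 * t = t + - t" unfolding t by (rule mult_2)
    then have "2 * (b * \<gamma> * \<alpha>) = 0" by (simp add: t_def)
    then have "b = 0 \<or> \<gamma> = 0 \<or> \<alpha> = 0" using two by simp
    \<comment> \<open>As \<open>a\<close> is nonzero, \<open>\<gamma> = 0\<close> or
      \<open>\<alpha> = 0\<close> would make both coefficients of the corresponding point
      vanish.\<close>
    then have "b = 0" using eqs False u1(1) u2(1) by auto
    then show ?thesis using eqs False by auto
  qed
  then show False
  proof
    assume *: "b = 0 \<and> \<beta> = 0 \<and> \<delta> = 0"
    then have e12: "e1 \<in> Z" "e2 \<in> Z" using u1 u2 scale_cancel by auto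
    have "std P 0 \<subseteq> Z"
    proof
      fix v assume "v \<in> std P 0"
      then obtain x1 x2 x3 where "v = coords P x1 x2 x3 0 0 0" using in_std_0 by blast
      then have "v = scale x1 e1 + scale x2 e2 + scale x3 e3" by (simp add: defs calc)
      then show "v \<in> Z" using e12 e3 by (auto intro!: subspace_add[OF sub] subspace_scale[OF sub])
    qed
    then show False using W_eqI[OF std_in_W[OF P] Z(1)] Z(2) by blast
  next
    assume *: "a = 0 \<and> \<alpha> = 0 \<and> \<gamma> = 0"
    then have f12: "f1 \<in> Z" "f2 \<in> Z" using u1 u2 scale_cancel by auto
    have "std P 2 \<subseteq> Z"
    proof
      fix v assume "v \<in> std P 2"
      then obtain x3 y1 y2 where "v = coords P 0 0 x3 y1 y2 0" using in_std_2 by blast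
      then have "v = scale y1 f1 + scale y2 f2 + scale x3 e3" by (simp add: defs calc)
      then show "v \<in> Z" using f12 e3 by (auto intro!: subspace_add[OF sub] subspace_scale[OF sub])
    qed
    then show False using W_eqI[OF std_in_W[OF P] Z(1)] Z(3) by blast
  qed
qed

end

text \<open>Equality with \<open>std P 0\<close> and adjacency to it single out the indices 0 and 3,
  so that only 1 and 2 are left to be compared.\<close>

lemma aut_std_index:
  assumes P: "frame P" and f: "aut f" "map_prod f f (std P 0, std P i) = (std P 0, std P j)"
    and ij: "i \<le> 3" "j \<le> 3"
  shows "i = 0 \<longleftrightarrow> j = 0" "i = 3 \<longleftrightarrow> j = 3"
proof -
  note W = std_in_W[OF P]
  have f0: "f (std P 0) = std P 0" and fi: "f (std P i) = std P j" using f(2) by simp_all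
  have inj: "inj_on f W" and adj: "disj (f (std P 0)) (f (std P i)) \<longleftrightarrow> disj (std P 0) (std P i)"
    using f(1) W by (auto simp: graph_aut_def bij_betw_def)
  show "i = 3 \<longleftrightarrow> j = 3"
    using adj unfolding f0 fi std_disjoint_iff[OF P ij(1)] std_disjoint_iff[OF P ij(2)] by blast
  have "std P 0 = std P i \<longleftrightarrow> std P 0 = std P j"
    using inj_onD[OF inj, of "std P 0" "std P i"] W f0 fi by metis
  moreover have "std P 0 = std P n \<longleftrightarrow> n = 0" for n
    using std_neq[OF P, of n] by (cases n) auto
  ultimately show "i = 0 \<longleftrightarrow> j = 0" by simp
qed

lemma rank_4:
  assumes two: "(2 :: 'a) \<noteq> 0"
  shows "has_rank W disj 4"
proof -
  obtain P where P: "frame P" using ex_frame by blast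
  note W = std_in_W[OF P]
  show ?thesis
  proof (rule has_rankI[where rep = "\<lambda>r. (std P 0, std P r)"])
    fix U U' assume U: "U \<in> W" "U' \<in> W"
    show "\<exists>f. aut f \<and> f U = U'" by (rule aut_transitive[OF U])
    obtain P' r where P': "frame P'" "r \<le> 3" "U = std P' 0" "U' = std P' r"
      using pair_normal_form[OF U] .
    obtain f where "aut f" "\<forall>r. f (std P r) = std P' r" using frame_change_std[OF P P'(1)] .
    then show "\<exists>r<4. \<exists>f. aut f \<and> map_prod f f (std P 0, std P r) = (U, U')"
      using P' by (intro exI[of _ r] conjI exI[of _ f]) auto
  next
    fix i j f
    assume ij: "i < 4" "j < 4" and f: "aut f" "map_prod f f (std P 0, std P i) = (std P 0, std P j)"
    have f0: "f (std P 0) = std P 0" and fi: "f (std P i) = std P j" using f(2) by simp_all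
    note idx = aut_std_index[OF P f]
    have inj: "inj_on f W" using f(1) by (simp add: graph_aut_def bij_betw_def)
    have 12: "\<not> (i = 1 \<and> j = 2)"
      using aut_has_third[OF f(1) W[of 0] W[of i]] has_third_std_1[OF P] not_has_third_std_2[OF P two]
      by (auto simp: f0 fi)
    \<comment> \<open>\<open>aut_has_third\<close> transports the property forward only; the inverse
      automorphism covers the opposite direction.\<close>
    have 21: "\<not> (i = 2 \<and> j = 1)"
    proof
      assume "i = 2 \<and> j = 1"
      then have "inv_into W f (std P 0) = std P 0" "inv_into W f (std P 1) = std P 2"
        using inv_into_f_f[OF inj W] f0 fi by metis+
      then show False
        using aut_has_third[OF graph_aut_inv[OF f(1)] W[of 0] W[of 1]] has_third_std_1[OF P]
          not_has_third_std_2[OF P two] by simp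
    qed
    show "i = j" using ij idx 12 21 by linarith
  qed (use W in auto)
qed

end

section \<open>Characteristic two: the spin embedding and rank three\<close>

text \<open>Keeps one of the two coordinate rows of each hyperbolic pair. Together with the
  complementary selection as second block it exchanges e_i and f_i for i outside \<open>c\<close>,
  which is symplectic in characteristic two.\<close>

definition rowsel :: "(3 \<Rightarrow> bool) \<Rightarrow> 'a^3^3 \<Rightarrow> 'a^3^3 \<Rightarrow> 'a^3^3" where
  "rowsel c A C = (\<chi> i. if c i then A $ i else C $ i)"

lemma rowsel_vec: "(rowsel c A C *v z)$i = (if c i then (A *v z)$i else (C *v z)$i)"
  for A C :: "'a::comm_ring_1^3^3"
  by (simp add: rowsel_def matrix_vector_mult_def)

text \<open>The eight minors of the \<open>6 \<times> 3\<close> matrix with blocks \<open>A\<close>, \<open>C\<close> that use one row of each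
  hyperbolic pair; these are the coordinates of the spin embedding of the plane spanned by the
  columns.\<close>

definition spin :: "'a^3^3 \<Rightarrow> 'a^3^3 \<Rightarrow> (3 \<Rightarrow> bool) \<Rightarrow> 'a::comm_ring_1" where
  "spin A C c = det (rowsel c A C)"

text \<open>The bilinear form associated with the quadratic form \<open>quad\<close>; each
  coordinate is paired with the complementary choice of rows.\<close>

definition polar :: "((3 \<Rightarrow> bool) \<Rightarrow> 'a::comm_ring_1) \<Rightarrow> ((3 \<Rightarrow> bool) \<Rightarrow> 'a) \<Rightarrow> 'a" where
  "polar p r = (\<Sum>c\<in>UNIV. p c * r (\<lambda>i. \<not> c i))"

definition tri :: "bool \<Rightarrow> bool \<Rightarrow> bool \<Rightarrow> 3 \<Rightarrow> bool" where
  "tri a b c i = (if i = 1 then a else if i = 2 then b else c)"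

lemma tri_simps [simp]: "tri a b c 1 = a" "tri a b c 2 = b" "tri a b c 3 = c"
  by (simp_all add: tri_def)

lemma tri_eta: "tri (c 1) (c 2) (c 3) = c"
proof (rule ext)
  fix i show "tri (c 1) (c 2) (c 3) i = c i" using exhaust_3[of i] by (auto simp: tri_def)
qed

lemma tri_eq_iff: "c = tri x y z \<longleftrightarrow> c 1 = x \<and> c 2 = y \<and> c 3 = z"
  using tri_eta[of c] by auto

lemma tri_not: "(\<lambda>i. \<not> tri a b c i) = tri (\<not> a) (\<not> b) (\<not> c)"
  by (auto simp: tri_def fun_eq_iff)

lemma sum_bool3: "(\<Sum>c\<in>UNIV. g c) = g (tri True True True) + g (tri True True False) +
    g (tri True False True) + g (tri True False False) + g (tri False True True) +
    g (tri False True False) + g (tri False False True) + g (tri False False False)"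
proof -
  have "bij_betw (\<lambda>(a, b, c). tri a b c) UNIV UNIV"
    by (rule bij_betwI[of _ _ _ "\<lambda>c. (c 1, c 2, c 3)"]) (auto simp: tri_eta)
  then have "(\<Sum>c\<in>UNIV. g c) = (\<Sum>z\<in>UNIV. g ((\<lambda>(a, b, c). tri a b c) z))"
    by (rule sum.reindex_bij_betw[symmetric])
  also have "\<dots> = (\<Sum>a\<in>UNIV. \<Sum>b\<in>UNIV. \<Sum>c\<in>UNIV. g (tri a b c))"
    by (simp add: sum.cartesian_product case_prod_unfold flip: UNIV_Times_UNIV)
  finally show ?thesis by (simp add: UNIV_bool algebra_simps)
qed

text \<open>The hyperbolic quadric in projective 7-space, one product for each of the four
  complementary pairs of coordinates.\<close>

definition quad :: "((3 \<Rightarrow> bool) \<Rightarrow> 'a::comm_ring_1) \<Rightarrow> 'a" where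
  "quad p = p (tri True True True) * p (tri False False False) +
    p (tri True True False) * p (tri False False True) +
    p (tri True False True) * p (tri False True False) +
    p (tri True False False) * p (tri False True True)"

lemma polar_expand: "polar p r =
    p (tri True True True) * r (tri False False False) +
    p (tri True True False) * r (tri False False True) +
    p (tri True False True) * r (tri False True False) +
    p (tri True False False) * r (tri False True True) +
    p (tri False True True) * r (tri True False False) +
    p (tri False True False) * r (tri True False True) +
    p (tri False False True) * r (tri True True False) +
    p (tri False False False) * r (tri True True True)"
  by (simp add: polar_def sum_bool3 tri_not)

definition d3 :: "'a::comm_ring_1^3 \<Rightarrow> 'a^3 \<Rightarrow> 'a^3 \<Rightarrow> 'a" where
  "d3 x y z = det (vector [x, y, z])"

lemma d3_expand: "d3 x y z = x$1 * y$2 * z$3 + x$2 * y$3 * z$1 + x$3 * y$1 * z$2 -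
    x$1 * y$3 * z$2 - x$2 * y$1 * z$3 - x$3 * y$2 * z$1"
  by (simp add: d3_def det_3)

lemma spin_d3: "spin A C (tri a b c) =
    d3 (if a then A$1 else C$1) (if b then A$2 else C$2) (if c then A$3 else C$3)"
  unfolding spin_def rowsel_def d3_def by (rule arg_cong[of _ _ det]) (simp add: vec_eq_iff forall_3)

lemma d3_linear:
  "d3 (x + x') y z = d3 x y z + d3 x' y z" "d3 x (y + y') z = d3 x y z + d3 x y' z"
  "d3 x y (z + z') = d3 x y z + d3 x y z'"
  "d3 (k *s x) y z = k * d3 x y z" "d3 x (k *s y) z = k * d3 x y z" "d3 x y (k *s z) = k * d3 x y z"
  by (simp_all add: d3_expand algebra_simps)

lemma d3_alt: "d3 x x z = 0" "d3 x y x = 0" "d3 x y y = 0"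
  by (simp_all add: d3_expand algebra_simps)

text \<open>Symmetry of \<open>transpose A ** C\<close> says that the wedge products of
  corresponding rows of \<open>A\<close> and \<open>C\<close> add up to zero; here the sum is wedged
  with \<open>x\<close>. This relates the minors that use both rows of a hyperbolic pair.\<close>

lemma d3_contraction:
  fixes A C :: "'a::field^3^3"
  assumes "lagrangian A C"
  shows "d3 (A$1) (C$1) x + d3 (A$2) (C$2) x + d3 (A$3) (C$3) x = 0"
proof -
  have "dot (A *v axis j 1) (C *v axis k 1) = dot (C *v axis j 1) (A *v axis k 1)" for j k
    using assms by (simp add: lagrangian_def)
  then have sym: "A$1$j * C$1$k + A$2$j * C$2$k + A$3$j * C$3$k =
      C$1$j * A$1$k + C$2$j * A$2$k + C$3$j * A$3$k" for j k
    by (simp add: dot_def matrix_axis)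
  have "d3 (A$1) (C$1) x + d3 (A$2) (C$2) x + d3 (A$3) (C$3) x =
    x$1 * ((A$1$2 * C$1$3 + A$2$2 * C$2$3 + A$3$2 * C$3$3) -
      (C$1$2 * A$1$3 + C$2$2 * A$2$3 + C$3$2 * A$3$3)) +
    x$2 * ((A$1$3 * C$1$1 + A$2$3 * C$2$1 + A$3$3 * C$3$1) -
      (C$1$3 * A$1$1 + C$2$3 * A$2$1 + C$3$3 * A$3$1)) +
    x$3 * ((A$1$1 * C$1$2 + A$2$1 * C$2$2 + A$3$1 * C$3$2) -
      (C$1$1 * A$1$2 + C$2$1 * A$2$2 + C$3$1 * A$3$2))"
    by (simp add: d3_expand algebra_simps)
  then show ?thesis by (simp add: sym)
qed

section \<open>Minors of Lagrangian matrices in characteristic two\<close>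

context
  assumes two: "(2 :: 'a::field) = 0"
begin

lemma char2_cancel: "x + x = (0::'a)" "x + (x + y) = y"
proof -
  show "x + x = 0" using two by (metis mult_2 mult_zero_left)
  then show "x + (x + y) = y" by (simp flip: add.assoc)
qed

lemma char2_minus: "- x = (x::'a)"
  using char2_cancel(1)[of x] by (simp add: neg_eq_iff_add_eq_0)

lemma char2_diff: "x - y = (x + y :: 'a)"
  using char2_minus[of y] by (metis diff_conv_add_uminus)

lemma char2_eq_iff: "x = y \<longleftrightarrow> x + y = (0::'a)"
  by (metis char2_diff right_minus_eq)

lemma d3_perm: "d3 x y z = d3 y x z" "d3 x y z = d3 x z y" for x y z :: "'a^3"
  by (simp_all add: d3_expand char2_diff mult_ac add_ac)

text \<open>The spin coordinates of a graph are the principal minors of its matrix. The term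
  \<open>2 * d * e * f\<close> disappears, so the off-diagonal entries enter only through their
  squares.\<close>

lemma spin_sym_mat:
  fixes a b c d e f :: 'a
  defines "p \<equiv> spin (sym_mat ((a, b, d), (c, e, f))) (mat 1)"
  shows "p (tri True True True) = a * b * c + a * (f * f) + b * (e * e) + c * (d * d)"
    "p (tri True True False) = a * b + d * d" "p (tri True False True) = a * c + e * e"
    "p (tri True False False) = a" "p (tri False True True) = b * c + f * f"
    "p (tri False True False) = b" "p (tri False False True) = c" "p (tri False False False) = 1"
  unfolding p_def by (simp_all add: spin_d3 d3_expand mat_def char2_diff algebra_simps char2_cancel)

text \<open>Multilinear expansion in the rows produces, besides the wanted products, minors with
  both rows of a hyperbolic pair. The contraction identity makes these equal in pairs, and equal
  terms cancel in characteristic two.\<close>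

lemma det_chart:
  fixes S A C :: "'a^3^3"
  assumes S: "S \<in> Sym" and L: "lagrangian A C"
  shows "det (A + S ** C) = polar (spin S (mat 1)) (spin A C)"
proof -
  obtain a b d c e f where Seq: "S = sym_mat ((a, b, d), (c, e, f))"
    using S bij_sym_mat by (metis bij_betw_imp_surj_on image_iff prod_cases3 surj_pair)
  define x y z u v w where "x = A$1" and "y = A$2" and "z = A$3" and "u = C$1" and "v = C$2" and "w = C$3"
  note rows = x_def y_def z_def u_def v_def w_def
  have "A + S ** C = vector [x + (a *s u + (d *s v + e *s w)), y + (d *s u + (b *s v + f *s w)),
      z + (e *s u + (f *s v + c *s w))]"
    by (simp add: Seq rows vec_eq_iff forall_3 matrix_matrix_mult_def sum_3)
  then have lhs: "det (A + S ** C) = d3 (x + (a *s u + (d *s v + e *s w)))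
      (y + (d *s u + (b *s v + f *s w))) (z + (e *s u + (f *s v + c *s w)))"
    by (simp add: d3_def)
  have contr: "d3 x u t = d3 y v t + d3 z w t" for t
    using d3_contraction[OF L, of t] by (simp add: rows[symmetric] char2_eq_iff[of "d3 x u t"] add.assoc)
  have perm: "d3 x y z = d3 y x z" "d3 x y z = d3 x z y" for x y z :: "'a^3" by (rule d3_perm)+
  have contr': "d3 w x z = d3 v x y" "d3 u w z = d3 u v y" "d3 w y z = d3 u x y"
      "d3 v w z = d3 u v x" "d3 v y z = d3 u x z" "d3 v w y = d3 u w x"
    using contr[of x] contr[of u] contr[of y] contr[of v] contr[of z] contr[of w]
    by (simp_all add: d3_alt perm char2_eq_iff[symmetric])
  show ?thesis
    unfolding lhs polar_expand spin_sym_mat[of a b d c e f, folded Seq] spin_d3[of A C]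
    by (simp add: d3_linear d3_alt distrib_left distrib_right perm contr' char2_cancel ac_simps flip: rows)
qed

lemma gram_swap:
  fixes A C A' C' :: "'a^3^3"
  shows "transpose (rowsel c A' C') ** rowsel (\<lambda>i. \<not> c i) A C -
    transpose (rowsel (\<lambda>i. \<not> c i) A' C') ** rowsel c A C =
    transpose A' ** C - transpose C' ** A"
  by (simp add: mat3_eq_iff matrix_matrix_mult_def transpose_def rowsel_def sum_3 char2_diff add_ac)

lemma lagrangian_swap:
  fixes A C :: "'a^3^3"
  assumes "lagrangian A C"
  shows "lagrangian (rowsel c A C) (rowsel (\<lambda>i. \<not> c i) A C)"
  unfolding lagrangian_def
proof (intro conjI allI impI)
  fix z w
  have "dot (A *v z) (C *v w) + dot (C *v z) (A *v w) = 0"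
    using assms unfolding lagrangian_def char2_eq_iff[symmetric] by blast
  then have "dot (rowsel c A C *v z) (rowsel (\<lambda>i. \<not> c i) A C *v w) +
      dot (rowsel (\<lambda>i. \<not> c i) A C *v z) (rowsel c A C *v w) = 0"
    unfolding dot_def rowsel_vec
    by (cases "c 1"; cases "c 2"; cases "c 3") (simp_all only: if_True if_False not_True_eq_False not_False_eq_True ac_simps)
  then show "dot (rowsel c A C *v z) (rowsel (\<lambda>i. \<not> c i) A C *v w) =
      dot (rowsel (\<lambda>i. \<not> c i) A C *v z) (rowsel c A C *v w)"
    by (subst char2_eq_iff)
next
  fix z assume *: "rowsel c A C *v z = 0" "rowsel (\<lambda>i. \<not> c i) A C *v z = 0"
  have "(A *v z)$i = 0 \<and> (C *v z)$i = 0" for i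
    using arg_cong[OF *(1), of "\<lambda>x. x$i"] arg_cong[OF *(2), of "\<lambda>x. x$i"]
    by (cases "c i") (simp_all add: rowsel_vec)
  then have "A *v z = 0" "C *v z = 0" by (simp_all add: vec_eq_iff)
  then show "z = 0" using assms by (simp add: lagrangian_def)
qed

end

lemma rowsel_rowsel:
  "rowsel d (rowsel c A C) (rowsel (\<lambda>i. \<not> c i) A C) = rowsel (\<lambda>i. d i = c i) A C"
  by (auto simp: rowsel_def vec_eq_iff)

lemma spin_swap:
  "spin (rowsel c A C) (rowsel (\<lambda>i. \<not> c i) A C) = (\<lambda>d. spin A C (\<lambda>i. d i = c i))"
  by (simp add: spin_def[abs_def] rowsel_rowsel)

lemma bij_xor: "bij (\<lambda>d i. d i = c i)" for c :: "'n \<Rightarrow> bool"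
  by (rule involuntory_imp_bij) auto

lemma polar_swap: "polar (\<lambda>d. p (\<lambda>i. d i = c i)) (\<lambda>d. r (\<lambda>i. d i = c i)) = polar p r"
proof -
  have "polar p r = (\<Sum>d\<in>UNIV. p (\<lambda>i. d i = c i) * r (\<lambda>i. \<not> (d i = c i)))"
    unfolding polar_def by (rule sum.reindex_bij_betw[OF bij_xor, symmetric])
  moreover have "(\<lambda>i. \<not> (d i = c i)) = (\<lambda>i. (\<not> d i) = c i)" for d by auto
  ultimately show ?thesis by (simp add: polar_def)
qed

lemma spin_reparametrize: "spin (A ** G) (C ** G) c = det G * spin A C c"
  for A C G :: "'a::field^3^3"
proof -
  have "rowsel c (A ** G) (C ** G) = rowsel c A C ** G"
    by (simp add: rowsel_def matrix_matrix_mult_def vec_eq_iff)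
  then show ?thesis by (simp add: spin_def det_mul mult.commute)
qed

lemma polar_scale_left: "polar (\<lambda>c. k * p c) r = k * polar p r"
  by (simp add: polar_def sum_distrib_left mult.assoc)

text \<open>The affine chart of planes disjoint from the plane of the \<open>x\<close> coordinates.
  Column operations change the spin vector only by a determinant.\<close>

lemma lagrangian_chart:
  fixes A C :: "'a::field^3^3"
  assumes L: "lagrangian A C" and C: "det C \<noteq> 0"
  obtains S where "S \<in> Sym" "A = S ** C" "spin A C = (\<lambda>c. det C * spin S (mat 1) c)"
proof -
  obtain K where K: "C ** K = mat 1" "K ** C = mat 1" using inverse_matrices[OF C] by blast
  define S where "S = A ** K"
  have A: "A = S ** C" by (simp add: S_def K flip: matrix_mul_assoc)
  have S: "S \<in> Sym"
  proof (rule SymI_dot)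
    fix x y
    have "dot (A *v (K *v x)) (C *v (K *v y)) = dot (C *v (K *v x)) (A *v (K *v y))"
      using L by (simp add: lagrangian_def)
    then show "dot (S *v x) y = dot x (S *v y)" by (simp add: matrix_vector_mul_assoc K S_def)
  qed
  have "spin A C = (\<lambda>c. det C * spin S (mat 1) c)"
    using spin_reparametrize[of S C "mat 1"] by (simp add: A[symmetric] fun_eq_iff)
  then show ?thesis using that S A by blast
qed

text \<open>With \<open>A = S ** C\<close> the factor \<open>C\<close> splits off on the right, and
  the transpose of what remains is the matrix treated in \<open>det_chart\<close>.\<close>

lemma det_gram_chart:
  fixes A C A' C' :: "'a::field^3^3"
  assumes two: "(2 :: 'a) = 0" and L: "lagrangian A C" and L': "lagrangian A' C'" and C: "det C \<noteq> 0"
  shows "det (transpose A' ** C - transpose C' ** A) = polar (spin A C) (spin A' C')"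
proof -
  obtain S where S: "S \<in> Sym" and A: "A = S ** C"
    and spin: "spin A C = (\<lambda>c. det C * spin S (mat 1) c)"
    using lagrangian_chart[OF L C] .
  have "transpose A' ** C - transpose C' ** A = (transpose A' - transpose C' ** S) ** C"
    unfolding A by (simp add: matrix_matrix_mult_def vec_eq_iff sum_3 algebra_simps)
  moreover have "transpose A' - transpose C' ** S = transpose (A' + S ** C')"
    using S by (simp add: Sym_def transpose_def matrix_matrix_mult_def vec_eq_iff sum_3
      char2_diff[OF two] mult.commute)
  ultimately have "det (transpose A' ** C - transpose C' ** A) = det C * det (A' + S ** C')"
    by (simp add: det_mul det_transpose mult.commute)
  also have "\<dots> = det C * polar (spin S (mat 1)) (spin A' C')"
    by (simp add: det_chart[OF two S L'])
  also have "\<dots> = polar (spin A C) (spin A' C')"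
    by (simp only: spin polar_scale_left)
  finally show ?thesis .
qed

lemma quad_swap: "quad (\<lambda>d. p (\<lambda>i. d i = c i)) = quad p"
proof -
  have "(\<lambda>i. tri a b d i = c i) = tri (a = c 1) (b = c 2) (d = c 3)" for a b d
  proof (rule ext)
    fix i show "(tri a b d i = c i) = tri (a = c 1) (b = c 2) (d = c 3) i"
      using exhaust_3[of i] by auto
  qed
  then show ?thesis
    by (cases "c 1"; cases "c 2"; cases "c 3") (simp_all add: quad_def algebra_simps)
qed

text \<open>A symmetric matrix is recovered from its principal minors: the diagonal is read off, the
  off-diagonal entries are square roots, which exist here, and \<open>quad p = 0\<close> settles the
  minor of order three. The factor \<open>D\<close>, of determinant \<open>t\<close>, restores the
  scale.\<close>

lemma spin_surj_chart:
  fixes p :: "(3 \<Rightarrow> bool) \<Rightarrow> 'a::{field,finite}"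
  assumes two: "(2 :: 'a) = 0" and Q: "quad p = 0" and t: "p (tri False False False) \<noteq> 0"
  obtains A C where "lagrangian A C" "spin A C = p"
proof -
  define t where "t = p (tri False False False)"
  define a b c where "a = p (tri True False False) / t" and "b = p (tri False True False) / t"
    and "c = p (tri False False True) / t"
  obtain d where d: "d * d = a * b + p (tri True True False) / t" using square_root_char_2[OF two] by blast
  obtain e where e: "e * e = a * c + p (tri True False True) / t" using square_root_char_2[OF two] by blast
  obtain f where f: "f * f = b * c + p (tri False True True) / t" using square_root_char_2[OF two] by blast
  define S where "S = sym_mat ((a, b, d), (c, e, f))"
  define D where "D = sym_mat ((t, 1, 0), (1, 0, 0))"
  have S: "S \<in> Sym" by (simp only: S_def Sym_sym_mat)
  have "t \<noteq> 0" using assms(3) by (simp add: t_def)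
  have detD: "det D = t" by (simp add: D_def det_3)
  then obtain K where K: "D ** K = mat 1" "K ** D = mat 1"
    using inverse_matrices[of D] \<open>t \<noteq> 0\<close> by blast
  note c2 = char2_cancel[OF two] char2_diff[OF two]
  note spinS = spin_sym_mat[OF two, of a b d c e f, folded S_def]
  have Q': "p (tri True True True) = t * (c * (p (tri True True False) / t) +
      b * (p (tri True False True) / t) + a * (p (tri False True True) / t))"
  proof -
    have "t * p (tri True True True) = p (tri True True False) * p (tri False False True) +
      p (tri True False True) * p (tri False True False) + p (tri True False False) * p (tri False True True)"
      by (subst char2_eq_iff[OF two]) (use Q in \<open>simp add: quad_def t_def ac_simps\<close>)
    then show ?thesis using \<open>t \<noteq> 0\<close>
      by (simp add: a_def b_def c_def field_simps)
  qed
  have "lagrangian (S ** D) (mat 1 ** D)"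
  proof -
    have "z = 0" if "D *v z = 0" for z
      using that K(2) by (metis matrix_vector_mul_assoc matrix_vector_mul_lid matrix_vector_mult_0_right)
    then show ?thesis using Sym_dot[OF S] by (auto simp: lagrangian_def simp flip: matrix_vector_mul_assoc)
  qed
  moreover have "spin (S ** D) (mat 1 ** D) = p"
  proof (rule ext)
    fix k :: "3 \<Rightarrow> bool"
    have "t * spin S (mat 1) (tri (k 1) (k 2) (k 3)) = p (tri (k 1) (k 2) (k 3))"
      using \<open>t \<noteq> 0\<close>
      by (cases "k 1"; cases "k 2"; cases "k 3")
        (simp_all add: spinS d e f Q' c2 ac_simps distrib_left, simp_all add: a_def b_def c_def t_def)
    then show "spin (S ** D) (mat 1 ** D) k = p k"
      by (simp only: spin_reparametrize detD tri_eta)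
  qed
  ultimately show ?thesis using that by blast
qed

text \<open>Exchanging e_i and f_i for suitable i moves the nonzero coordinate to the position that
  the chart requires.\<close>

lemma spin_surj:
  fixes p :: "(3 \<Rightarrow> bool) \<Rightarrow> 'a::{field,finite}"
  assumes two: "(2 :: 'a) = 0" and Q: "quad p = 0" and c: "p c \<noteq> 0"
  obtains A C where "lagrangian A C" "spin A C = p"
proof -
  define k where "k i = (\<not> c i)" for i
  have k: "(\<lambda>i. tri False False False i = k i) = c" by (auto simp: k_def tri_def)
  obtain A C where AC: "lagrangian A C" "spin A C = (\<lambda>d. p (\<lambda>i. d i = k i))"
    by (rule spin_surj_chart[OF two, of "\<lambda>d. p (\<lambda>i. d i = k i)"]) (use Q c k in \<open>simp_all add: quad_swap\<close>)
  have "spin (rowsel k A C) (rowsel (\<lambda>i. \<not> k i) A C) = p"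
  proof (rule ext)
    fix d
    have "(\<lambda>i. (d i = k i) = k i) = d" by auto
    then show "spin (rowsel k A C) (rowsel (\<lambda>i. \<not> k i) A C) d = p d" by (simp add: spin_swap AC(2))
  qed
  then show ?thesis using that lagrangian_swap[OF two AC(1)] by blast
qed

lemma quad_scale: "quad (\<lambda>c. k * p c) = k * k * quad p"
  by (simp add: quad_def algebra_simps)

lemma quad_spin_chart:
  fixes A C :: "'a::field^3^3"
  assumes two: "(2 :: 'a) = 0" and L: "lagrangian A C" and C: "det C \<noteq> 0"
  shows "quad (spin A C) = 0"
proof -
  obtain S where S: "S \<in> Sym" and A: "A = S ** C"
    and spin: "spin A C = (\<lambda>c. det C * spin S (mat 1) c)"
    using lagrangian_chart[OF L C] .
  obtain a b d c e f where Seq: "S = sym_mat ((a, b, d), (c, e, f))"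
    using S bij_sym_mat by (metis bij_betw_imp_surj_on image_iff prod_cases3 surj_pair)
  have "quad (spin S (mat 1)) = 0"
    unfolding quad_def Seq spin_sym_mat[OF two] by (simp add: algebra_simps char2_cancel[OF two])
  then show ?thesis by (simp add: spin quad_scale)
qed

text \<open>Exchanges the coordinates TTF and TFF as well as FTT and FFT. This interchanges two of
  the four complementary pairs as a whole, so that \<open>quad\<close> and \<open>polar\<close> are
  preserved.\<close>

definition twist :: "((3 \<Rightarrow> bool) \<Rightarrow> 'a) \<Rightarrow> (3 \<Rightarrow> bool) \<Rightarrow> 'a" where
  "twist p c = p (tri (c 1) (if c 1 = c 3 then c 2 else \<not> c 2) (c 3))"

lemma polar_twist: "polar (twist p) (twist r) = polar p r"
  by (simp add: polar_expand twist_def algebra_simps)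

lemma quad_twist: "quad (twist p) = quad p"
  by (simp add: quad_def twist_def algebra_simps)

lemma det_zero_row:
  fixes M :: "'a::field^3^3"
  assumes "M$i = 0"
  shows "det M = 0"
  using exhaust_3[of i] assms by (auto simp: det_3)

section \<open>The quadric model of the graph\<close>

context symplectic_space6
begin

text \<open>Some spin coordinate is nonzero: take a coordinate plane disjoint from the given plane,
  with one axis from each hyperbolic pair. Projection along it is injective on the given plane, and
  its matrix consists of the rows belonging to the other axes.\<close>

lemma ex_invertible_rowsel:
  assumes L: "lagrangian A (C :: 'a^3^3)"
  obtains k where "det (rowsel (\<lambda>i. \<not> k i) A C) \<noteq> 0"
proof -
  obtain P where P: "frame P" using ex_frame by blast
  let ?e = "\<lambda>i. P (axis i 1) 0" and ?f = "\<lambda>i. P 0 (axis i 1)"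
  let ?U = "plane P A C"
  have U: "?U \<in> W" by (rule plane_in_W[OF P L])
  obtain x where x: "\<forall>i. x i = ?e i \<or> x i = ?f i"
    and ind: "\<And>a b c. scale a (x 1) + scale b (x 2) + scale c (x 3) \<in> ?U \<Longrightarrow> a = 0 \<and> b = 0 \<and> c = 0"
    by (rule greedy[OF U, of ?e ?f]) (simp_all add: frame_form[OF P] dot_axis)
  define k where "k i \<longleftrightarrow> x i = ?e i" for i
  have x': "x i = (if k i then ?e i else ?f i)" for i
    using x by (auto simp: k_def)
  have "z = 0" if z: "rowsel (\<lambda>i. \<not> k i) A C *v z = 0" for z
  proof -
    let ?x = "A *v z" and ?y = "C *v z"
    have 0: "if k i then ?y$i = 0 else ?x$i = 0" for i
      using arg_cong[OF z, of "\<lambda>x. x$i"] by (simp add: rowsel_vec split: if_splits)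
    have sel: "scale (if k i then ?x$i else ?y$i) (if k i then ?e i else ?f i) =
        P (?x$i *s axis i 1) (?y$i *s axis i 1)" for i
      using 0[of i] by (auto simp flip: frame_scale[OF P])
    have "P ?x ?y = P (?x$1 *s axis 1 1 + ?x$2 *s axis 2 1 + ?x$3 *s axis 3 1)
        (?y$1 *s axis 1 1 + ?y$2 *s axis 2 1 + ?y$3 *s axis 3 1)"
      using vec3_sum[of ?x] vec3_sum[of ?y] by simp
    also have "\<dots> = scale (if k 1 then ?x$1 else ?y$1) (x 1) + scale (if k 2 then ?x$2 else ?y$2) (x 2) +
        scale (if k 3 then ?x$3 else ?y$3) (x 3)"
      unfolding x' sel by (simp only: frame_add[OF P])
    finally have eq: "P ?x ?y = \<dots>" .
    have "P ?x ?y \<in> ?U" by (auto simp: plane_def)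
    then have "(if k 1 then ?x$1 else ?y$1) = 0 \<and> (if k 2 then ?x$2 else ?y$2) = 0 \<and>
        (if k 3 then ?x$3 else ?y$3) = 0"
      unfolding eq by (rule ind)
    then have "?x = 0 \<and> ?y = 0"
      using 0[of 1] 0[of 2] 0[of 3] by (auto simp: vec_eq_iff forall_3 split: if_splits)
    then show "z = 0" using L by (simp add: lagrangian_def)
  qed
  then show ?thesis using that[of k] det_nonzero_iff_ker by blast
qed

text \<open>The frame stays fixed here, in contrast to \<open>ex_frame_at\<close>, so that the spin
  vectors of different planes can be compared; the matrices expand a basis of \<open>U\<close> in
  that frame.\<close>

lemma ex_plane:
  assumes P: "frame P" and U: "U \<in> W"
  obtains A C where "lagrangian A C" "U = plane P A C"
proof -
  obtain P' where P': "frame P'" "U = plane P' (mat 1) 0" using ex_frame_at[OF U] .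
  have "\<exists>x y. P' v 0 = P x y" for v by (rule frame_surj[OF P]) blast
  then obtain f g where fg: "P' v 0 = P (f v) (g v)" for v by metis
  define A C :: "'a^3^3" where "A = transpose (vector [f (axis 1 1), f (axis 2 1), f (axis 3 1)])"
    and "C = transpose (vector [g (axis 1 1), g (axis 2 1), g (axis 3 1)])"
  have AC: "P (A *v z) (C *v z) = P' z 0" for z
  proof -
    have A: "A *v z = z$1 *s f (axis 1 1) + z$2 *s f (axis 2 1) + z$3 *s f (axis 3 1)"
      and C: "C *v z = z$1 *s g (axis 1 1) + z$2 *s g (axis 2 1) + z$3 *s g (axis 3 1)"
      unfolding A_def C_def by (rule columns_vec)+
    have "P' z 0 = P' (z$1 *s axis 1 1 + z$2 *s axis 2 1 + z$3 *s axis 3 1)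
        (z$1 *s 0 + z$2 *s 0 + z$3 *s 0)"
      using vec3_sum[of z] by simp
    then show ?thesis unfolding A C frame_sum3[OF P] frame_sum3[OF P'(1)] fg by simp
  qed
  have "lagrangian A C"
    unfolding lagrangian_def
  proof (intro conjI allI impI)
    fix z w
    show "dot (A *v z) (C *v w) = dot (C *v z) (A *v w)"
      using frame_form[OF P, of "A *v z" "C *v z" "A *v w" "C *v w"] frame_form[OF P'(1), of z 0 w 0]
      by (simp add: AC)
  next
    fix z assume "A *v z = 0" "C *v z = 0"
    then show "z = 0" using AC[of z] frame_eq_0_iff[OF P'(1), of z 0] by (simp add: frame_zero[OF P])
  qed
  moreover have "U = plane P A C" unfolding P'(2) by (simp add: plane_def AC)
  ultimately show ?thesis using that by blast
qed

text \<open>This holds because \<open>\<mu> < k\<close>.\<close>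

lemma neighbors_inject:
  assumes U: "U \<in> W" "U' \<in> W" and eq: "\<Gamma> U = \<Gamma> U'"
  shows "U = U'"
proof (rule ccontr)
  assume ne: "U \<noteq> U'"
  show False
  proof (cases "disj U U'")
    case True
    then have "U' \<in> \<Gamma> U" using U by (simp add: neighbors_def)
    then have "disj U' U'" unfolding eq by (simp add: neighbors_def)
    then show False using simple_graph_W U by (simp add: simple_graph_def)
  next
    case False
    have "CARD('a) ^ 6 = (CARD('a) - 1) * CARD('a) ^ 5"
      using card_common_nonadjacent[OF U ne False] card_W_neighbors[OF U(1)] eq by simp
    then have "CARD('a) * CARD('a) ^ 5 = (CARD('a) - 1) * CARD('a) ^ 5" by (simp add: power_Suc[symmetric])
    then show False using card_gt_1 by simp
  qed
qed

context
  assumes two: "(2 :: 'a) = 0"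
begin

text \<open>Both sides are unchanged when the same e_i and f_i are exchanged in both planes. A
  suitable exchange makes the second block of the first plane invertible and so reduces to the
  chart.\<close>

lemma det_gram_spin:
  fixes A C A' C' :: "'a^3^3"
  assumes L: "lagrangian A C" and L': "lagrangian A' C'"
  shows "det (transpose A' ** C - transpose C' ** A) = polar (spin A C) (spin A' C')"
proof -
  obtain k where "det (rowsel (\<lambda>i. \<not> k i) A C) \<noteq> 0" using ex_invertible_rowsel[OF L] .
  from det_gram_chart[OF two lagrangian_swap[OF two L] lagrangian_swap[OF two L', of k] this]
  show ?thesis unfolding gram_swap[OF two] spin_swap polar_swap .
qed

lemma quad_spin:
  fixes A C :: "'a^3^3"
  assumes L: "lagrangian A C"
  shows "quad (spin A C) = 0"
proof -
  obtain k where "det (rowsel (\<lambda>i. \<not> k i) A C) \<noteq> 0" using ex_invertible_rowsel[OF L] .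
  from quad_spin_chart[OF two lagrangian_swap[OF two L] this]
  show ?thesis unfolding spin_swap quad_swap .
qed

lemma disjoint_spin:
  assumes "frame P" "lagrangian A C" "lagrangian A' C'"
  shows "disj (plane P A C) (plane P A' C') \<longleftrightarrow> polar (spin A C) (spin A' C') \<noteq> 0"
  using disjoint_plane[OF assms] det_gram_spin[OF assms(2,3)] by simp

text \<open>Injectivity of the spin embedding, read off from the graph: proportional spin vectors
  are orthogonal to the same vectors, so the planes have the same neighbours.\<close>

lemma plane_eqI_spin:
  assumes P: "frame P" and L: "lagrangian A C" and L': "lagrangian A' C'"
    and t: "t \<noteq> 0" "spin A C = (\<lambda>c. t * spin A' C' c)"
  shows "plane P A C = plane P A' C'"
proof (rule neighbors_inject[OF plane_in_W[OF P L] plane_in_W[OF P L']])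
  have "disj (plane P A C) V \<longleftrightarrow> disj (plane P A' C') V" if V: "V \<in> W" for V
  proof -
    obtain X Y where XY: "lagrangian X Y" "V = plane P X Y" using ex_plane[OF P V] .
    show ?thesis unfolding XY(2) disjoint_spin[OF P L XY(1)] disjoint_spin[OF P L' XY(1)] t(2)
      using t(1) by (simp add: polar_scale_left)
  qed
  then show "\<Gamma> (plane P A C) = \<Gamma> (plane P A' C')" by (auto simp: neighbors_def)
qed

text \<open>Coordinate planes correspond to coordinate points, because every other minor contains a
  zero row.\<close>

lemma spin_std:
  assumes P: "frame P" and L: "lagrangian A C" and eq: "plane P A C = std P r"
  obtains t where "t \<noteq> 0"
    "spin A C = (\<lambda>c. if c = tri (r < 1) (r < 2) (r < 3) then t else 0)"
proof -
  define k where "k = tri (r < 1) (r < 2) (r < 3)"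
  have rows: "(A *v z)$i = 0 \<and> \<not> k i \<or> (C *v z)$i = 0 \<and> k i" for z i
  proof -
    have "P (A *v z) (C *v z) \<in> std P r" unfolding eq[symmetric] by (auto simp: plane_def)
    then obtain w where "A *v z = (mat 1 - proj r) *v w" "C *v z = proj r *v w"
      by (auto simp: std_def plane_def frame_eq_iff[OF P])
    then show ?thesis
      using exhaust_3[of i] by (auto simp: matrix_vector_mult_diff_rdistrib proj_vec k_def)
  qed
  have zero_row: "(if k i then C$i else A$i) = 0" for i
    using rows[of _ i] by (auto simp: vec_eq_iff simp flip: matrix_axis)
  have "spin A C c = 0" if ne: "c \<noteq> k" for c
  proof -
    obtain i where "c i \<noteq> k i" using ne by blast
    then have "rowsel c A C $ i = 0" using zero_row[of i] by (auto simp: rowsel_def split: if_splits)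
    then show ?thesis unfolding spin_def by (rule det_zero_row)
  qed
  then have "spin A C = (\<lambda>c. if c = k then spin A C k else 0)" by auto
  moreover have "spin A C k \<noteq> 0"
    unfolding spin_def det_nonzero_iff_ker
  proof (intro allI impI)
    fix z assume z: "rowsel k A C *v z = 0"
    have "(A *v z)$i = 0 \<and> (C *v z)$i = 0" for i
      using arg_cong[OF z, of "\<lambda>x. x$i"] rows[of z i] by (auto simp: rowsel_vec split: if_splits)
    then show "z = 0" using L by (simp add: lagrangian_def vec_eq_iff)
  qed
  ultimately show ?thesis using that[of "spin A C k"] unfolding k_def[symmetric] by blast
qed

text \<open>The isometry \<open>twist\<close> of the spin quadric fixes the point representing \<open>std P 0\<close> and maps the
  point of \<open>std P 1\<close> to that of \<open>std P 2\<close>, although these planes meet \<open>std P 0\<close> in a line and in a point.\<close>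

lemma ex_twist_aut:
  assumes P: "frame P"
  obtains g where "aut g" "g (std P 0) = std P 0" "g (std P 1) = std P 2"
proof -
  have ex: "\<exists>A C A' C'. U = plane P A C \<and> lagrangian A C \<and> lagrangian A' C' \<and>
      spin A' C' = twist (spin A C)" if U: "U \<in> W" for U
  proof -
    obtain A C where AC: "lagrangian A C" "U = plane P A C" using ex_plane[OF P U] .
    obtain c where "spin A C c \<noteq> 0" using ex_invertible_rowsel[OF AC(1)] unfolding spin_def .
    \<comment> \<open>Being an involution, \<open>twist\<close> maps nonzero vectors to nonzero
      vectors, as surjectivity of the spin embedding requires.\<close>
    moreover have "twist (twist (spin A C)) = spin A C"
    proof (rule ext)
      fix d show "twist (twist (spin A C)) d = spin A C d"
        using tri_eta[of d] by (cases "d 1"; cases "d 3") (simp_all add: twist_def)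
    qed
    ultimately obtain d where d: "twist (spin A C) d \<noteq> 0" by (metis twist_def)
    obtain A' C' where "lagrangian A' C'" "spin A' C' = twist (spin A C)"
      by (rule spin_surj[OF two, of "twist (spin A C)"]) (use d in \<open>auto simp: quad_twist quad_spin[OF AC(1)]\<close>)
    then show ?thesis using AC by blast
  qed
  then obtain a c a' c' where ac: "\<And>U. U \<in> W \<Longrightarrow> U = plane P (a U) (c U)"
    "\<And>U. U \<in> W \<Longrightarrow> lagrangian (a U) (c U)" "\<And>U. U \<in> W \<Longrightarrow> lagrangian (a' U) (c' U)"
    "\<And>U. U \<in> W \<Longrightarrow> spin (a' U) (c' U) = twist (spin (a U) (c U))"
    by metis
  define g where "g U = plane P (a' U) (c' U)" for U
  have gW: "g U \<in> W" if "U \<in> W" for U unfolding g_def by (rule plane_in_W[OF P ac(3)[OF that]])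
  have adj: "disj (g U) (g V) \<longleftrightarrow> disj U V" if "U \<in> W" "V \<in> W" for U V
  proof -
    have "disj (g U) (g V) \<longleftrightarrow> polar (spin (a U) (c U)) (spin (a V) (c V)) \<noteq> 0"
      unfolding g_def disjoint_spin[OF P ac(3)[OF that(1)] ac(3)[OF that(2)]]
        ac(4)[OF that(1)] ac(4)[OF that(2)] polar_twist ..
    also have "\<dots> \<longleftrightarrow> disj (plane P (a U) (c U)) (plane P (a V) (c V))"
      by (rule disjoint_spin[OF P ac(2)[OF that(1)] ac(2)[OF that(2)], symmetric])
    finally show ?thesis using ac(1)[OF that(1)] ac(1)[OF that(2)] by simp
  qed
  \<comment> \<open>Adjacency is preserved in both directions, so planes with the same image have
    the same neighbours.\<close>
  have "inj_on g W"
  proof (rule inj_onI)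
    fix U V assume UV: "U \<in> W" "V \<in> W" "g U = g V"
    have "\<Gamma> U = \<Gamma> V" using adj[OF UV(1)] adj[OF UV(2)] UV(3) by (auto simp: neighbors_def)
    then show "U = V" by (rule neighbors_inject[OF UV(1,2)])
  qed
  moreover have "g ` W = W"
    using endo_inj_surj[of W g] simple_graph_W gW \<open>inj_on g W\<close> by (auto simp: simple_graph_def)
  ultimately have "aut g" using adj by (simp add: graph_aut_def bij_betw_def)
  \<comment> \<open>Both sides have spin vectors supported on the same single coordinate, so they
    differ only by the factor \<open>t / t'\<close>.\<close>
  moreover have "g (std P r) = std P s"
    if rs: "\<And>t. twist (\<lambda>c. if c = tri (r < 1) (r < 2) (r < 3) then t else 0) =
        (\<lambda>c. if c = tri (s < 1) (s < 2) (s < 3) then t else (0::'a))" for r s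
  proof -
    let ?U = "std P r"
    note W = std_in_W[OF P, of r]
    obtain t where t: "t \<noteq> 0" "spin (a ?U) (c ?U) = (\<lambda>c. if c = tri (r < 1) (r < 2) (r < 3) then t else 0)"
      using spin_std[OF P ac(2)[OF W] ac(1)[OF W, symmetric]] .
    obtain t' where t': "t' \<noteq> 0" "spin (mat 1 - proj s) (proj s :: 'a^3^3) =
        (\<lambda>c. if c = tri (s < 1) (s < 2) (s < 3) then t' else 0)"
      using spin_std[OF P lagrangian_std std_def[symmetric]] .
    show ?thesis
      unfolding g_def std_def[of P s]
    proof (rule plane_eqI_spin[OF P ac(3)[OF W] lagrangian_std, of "t / t'"])
      show "spin (a' ?U) (c' ?U) = (\<lambda>c. t / t' * spin (mat 1 - proj s) (proj s) c)"
        unfolding ac(4)[OF W] t(2) rs t'(2) using t'(1) by auto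
    qed (use t t' in simp)
  qed
  moreover have "twist (\<lambda>c. if c = tri True True True then t else 0) =
      (\<lambda>c. if c = tri True True True then t else (0::'a))" for t
  proof (rule ext)
    fix c show "twist (\<lambda>c. if c = tri True True True then t else 0) c =
      (if c = tri True True True then t else 0)"
      unfolding twist_def tri_eq_iff tri_simps by (cases "c 1"; cases "c 3") simp_all
  qed
  moreover have "twist (\<lambda>c. if c = tri False True True then t else 0) =
      (\<lambda>c. if c = tri False False True then t else (0::'a))" for t
  proof (rule ext)
    fix c show "twist (\<lambda>c. if c = tri False True True then t else 0) c =
      (if c = tri False False True then t else 0)"
      unfolding twist_def tri_eq_iff tri_simps by (cases "c 1"; cases "c 3") simp_all
  qed
  ultimately show ?thesis using that[of g] by simp
qed

lemma rank_3: "has_rank W disj 3"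
proof -
  obtain P where P: "frame P" using ex_frame by blast
  note W = std_in_W[OF P]
  \<comment> \<open>The representatives have indices 0, 1 and 3; pairs of index 2 are reached from
    index 1 by the twist automorphism.\<close>
  let ?s = "\<lambda>i. if i = 2 then 3 else i :: nat"
  show ?thesis
  proof (rule has_rankI[where rep = "\<lambda>i. (std P 0, std P (?s i))"])
    fix U U' assume U: "U \<in> W" "U' \<in> W"
    show "\<exists>f. aut f \<and> f U = U'" by (rule aut_transitive[OF U])
    obtain P' r where P': "frame P'" "r \<le> 3" "U = std P' 0" "U' = std P' r"
      using pair_normal_form[OF U] .
    obtain f where f: "aut f" "\<forall>r. f (std P r) = std P' r" using frame_change_std[OF P P'(1)] .
    obtain g where g: "aut g" "g (std P 0) = std P 0" "g (std P 1) = std P 2" using ex_twist_aut[OF P] .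
    consider "r = 0" | "r = 1" | "r = 2" | "r = 3" using P'(2) by linarith
    then show "\<exists>i<3. \<exists>f. aut f \<and> map_prod f f (std P 0, std P (?s i)) = (U, U')"
    proof cases
      case 1 then show ?thesis using f P' by (intro exI[of _ 0] conjI exI[of _ f]) auto
    next
      case 2 then show ?thesis using f P' by (intro exI[of _ 1] conjI exI[of _ f]) auto
    next
      case 3 then show ?thesis
        using f g P' graph_aut_comp[OF g(1) f(1)] by (intro exI[of _ 1] conjI exI[of _ "f \<circ> g"]) auto
    next
      case 4 then show ?thesis using f P' by (intro exI[of _ 2] conjI exI[of _ f]) auto
    qed
  next
    fix i j f
    assume ij: "i < 3" "j < 3" and f: "aut f"
      "map_prod f f (std P 0, std P (?s i)) = (std P 0, std P (?s j))"
    have s: "?s i \<le> 3" "?s j \<le> 3" using ij by auto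
    have "i = 0 \<longleftrightarrow> j = 0" "i = 2 \<longleftrightarrow> j = 2"
      using aut_std_index[OF P f s] ij by (auto split: if_splits)
    then show "i = j" using ij by linarith
  qed (use W in auto)
qed

end

end

section \<open>The main theorem\<close>

text \<open>Translation by 1 permutes the field, so comparing sums shows that its order is zero in
  it. If the order is a power of 2, a power of 2 vanishes in the field, hence 2 itself does; an odd
  order together with \<open>2 = 0\<close> would give \<open>1 = 0\<close>.\<close>

lemma even_card_iff:
  assumes "primepow CARD('a::{field,finite})"
  shows "even CARD('a) \<longleftrightarrow> (2 :: 'a) = 0"
proof -
  have "(\<Sum>x\<in>UNIV. x + 1) = (\<Sum>x\<in>UNIV. x :: 'a)"
    by (rule sum.reindex_bij_witness[of _ "\<lambda>x. x - 1" "\<lambda>x. x + 1"]) auto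
  then have card_0: "of_nat CARD('a) = (0 :: 'a)" by (simp add: sum.distrib)
  show ?thesis
  proof
    assume "even CARD('a)"
    moreover obtain p k where "prime p" "CARD('a) = p ^ k"
      using assms unfolding primepow_def by blast
    ultimately have "2 dvd p" by simp
    then have "p = 2" using primes_dvd_imp_eq[OF two_is_prime_nat \<open>prime p\<close>] by simp
    then have "(2 :: 'a) ^ k = 0" using card_0 \<open>CARD('a) = p ^ k\<close> by simp
    then show "(2 :: 'a) = 0" by simp
  next
    assume two: "(2 :: 'a) = 0"
    show "even CARD('a)"
    proof (rule ccontr)
      assume "odd CARD('a)"
      then obtain m where "CARD('a) = 2 * m + 1" by (rule oddE)
      then show False using card_0 two by simp
    qed
  qed
qed

theorem proposition5p1:
  fixes scale :: "'a::{field, finite} \<Rightarrow> 'b::ab_group_add \<Rightarrow> 'b"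
    and B :: "'b \<Rightarrow> 'b \<Rightarrow> 'a"
    and q :: nat
  assumes "primepow q" and "CARD('a) = q"
    and "vector_space scale"
    and "vector_space.dim scale UNIV = 6"
    and "symplectic_form scale B"
    and "nondegenerate B"
  shows
    "let W = isotropic_planes scale B;
         adj = disjoint_subspaces;
         v = (q^3 + 1) * (q^2 + 1) * (q + 1);
         k = q^6;
         l = q^2 * (q^3 - 1) * (q - 1);
         m = (q - 1) * q^5;
         m' = q^2 * (q - 1) * (q^3 - q^2 - 1);
         l' = m' - q^2 * (q - 2)
     in strongly_regular W adj v k l m \<and>
        (even q \<longrightarrow> has_rank W adj 3) \<and>
        (odd q \<longrightarrow> has_rank W adj 4) \<and>
        (\<forall>x\<in>W. strongly_regular (neighbors W adj x) adj k l l' m') \<and>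
        vertex_condition 4 W adj"
proof -
  interpret symplectic_space6 scale B
    using assms(3-6) by (simp add: symplectic_space6_def symplectic_space6_axioms_def)
  have q: "q = CARD('a)" using assms(2) by simp
  have parity: "even q \<longleftrightarrow> (2 :: 'a) = 0" using even_card_iff assms(1) unfolding q by blast
  show ?thesis
    unfolding Let_def
    using strongly_regular_W[OF q] strongly_regular_local[OF q] parity rank_3 rank_4
      vertex_condition_4[OF strongly_regular_W[OF q] strongly_regular_local[OF q]]
    by blast
qed

end
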